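(* For $d=5$, there exist positive constants $c_5^-$ and $c_5^+$ such that for all $n\ge1$, $$c_5^-\cdot\sqrt n\le \mathbb E\left[\mathrm{BCap}(\mathcal R_n)\right]\le c_5^+\cdot\sqrt n .$$
   Context: Offspring law: $\mu$ is a fixed probability measure on $\mathbb N=\{0,1,2,\dots\}$ with $\sum_i i\mu(i)=1$ (critical) and finite positive variance $\sigma^2$. Its size-biased version is $\mu_{\rm sb}(i)=i\mu(i)$. Infinite tree: $\mathcal T$ is the random infinite plane tree built as follows. The root $\emptyset$ has $i$ offspring with probability $\mu(i-1)$ for $i\ge 1$; its first (leftmost) offspring is special and the others (if any) are normal. Independently, special vertices have offspring number distributed as $\mu_{\rm sb}$ and normal vertices have offspring number distributed as $\mu$. One of the offspring of each special vertex, chosen uniformly at random, is special and the others are normal; all offspring of normal vertices are normal. The unique infinite path from the root is the spine. The root has label $0$; the vertices to the right of the spine get positive labels (depth-first search from the root); the spine vertices other than the root and the vertices to the left of the spine get negative labels (depth-first search from infinity). The past $\mathcal T_-$ is the set of vertices with negative label (so it contains all spine vertices except the root, and not the root). Tree-indexed walk: for $x\in\mathbb Z^d$, $(S^x_u)_{u\in\mathcal T}$ is the random walk indexed by $\mathcal T$ with $S^x_\emptyset=x$, whose increments along edges are i.i.d. uniform on the $2d$ neighbors of the origin, independent of $\mathcal T$. Set $\mathcal T^x_-=\{S^x_u:u\in\mathcal T_-\}$. Branching capacity: for finite $A\subset\mathbb Z^d$, $d\ge5$, $\mathrm{BCap}(A)=\sum_{x\in A}\mathbb P(\mathcal T^x_-\cap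 A=\emptyset)$. $(X_n)_{n\ge0}$ is a simple random walk on $\mathbb Z^d$ started at the origin (increments uniform on the neighbors of the origin), and $\mathcal R_n=\{X_0,\dots,X_n\}$ is its range. *)

theory Defs
  imports "HOL-Probability.Probability" "HOL-Library.Numeral_Type"
begin

section \<open>The infinite plane tree\<close>

text \<open>
  For a critical law the numbers \<open>i * \<mu>(i)\<close> sum up to 1, so that they are the weights of a
  probability mass function.
\<close>

definition size_biased :: "nat pmf \<Rightarrow> nat pmf" where
  "size_biased \<mu> = embed_pmf (\<lambda>i. real i * pmf \<mu> i)"

text \<open>
  Offspring number of a special vertex, paired with the position of its special offspring (positions
  are counted from 0, from left to right). The size-biased law does not charge 0, hence
  \<^term>\<open>{..<k}\<close> is nonempty.
\<close>

definition special_offspring :: "nat pmf \<Rightarrow> (nat \<times> nat) pmf" where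
  "special_offspring \<mu> =
     bind_pmf (size_biased \<mu>) (\<lambda>k. map_pmf (\<lambda>j. (k, j)) (pmf_of_set {..<k}))"

text \<open>
  Vertices are Ulam--Harris words: the empty word is the root and \<open>u @ [i]\<close> is the offspring of
  \<open>u\<close> at position \<open>i\<close>. Independently, each word \<open>u\<close> carries the offspring number that it
  has if it is normal and, independently, the pair that it uses if it is special. The root uses the
  first component, increased by one, and its special offspring is the leftmost one.
\<close>

type_synonym vertex = "nat list"
type_synonym seed = "vertex \<Rightarrow> nat \<times> (nat \<times> nat)"

definition seed_measure :: "nat pmf \<Rightarrow> seed measure" where
  "seed_measure \<mu> =
     (\<Pi>\<^sub>M u\<in>UNIV. measure_pmf (pair_pmf \<mu> (special_offspring \<mu>)))"

definition special_position :: "seed \<Rightarrow> vertex \<Rightarrow> nat" where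
  "special_position t u = (if u = [] then 0 else snd (snd (t u)))"

primrec spine :: "seed \<Rightarrow> nat \<Rightarrow> vertex" where
  "spine t 0 = []"
| "spine t (Suc k) = spine t k @ [special_position t (spine t k)]"

definition offspring_number :: "seed \<Rightarrow> vertex \<Rightarrow> nat" where
  "offspring_number t u =
     (if u = [] then Suc (fst (t u))
      else if u \<in> range (spine t) then fst (snd (t u))
      else fst (t u))"

inductive_set tree :: "seed \<Rightarrow> vertex set" for t :: seed where
  root: "[] \<in> tree t"
| child: "u \<in> tree t \<Longrightarrow> i < offspring_number t u \<Longrightarrow> u @ [i] \<in> tree t"

definition left_of_spine :: "seed \<Rightarrow> vertex set" where
  "left_of_spine t =
     {u \<in> tree t. \<exists>k i v. u = spine t k @ i # v \<and> i < special_position t (spine t k)}"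

text \<open>
  The past consists of the vertices with negative label. Only the sign of the labels matters, and by
  construction the vertices with negative label are those left of the spine and those on the spine,
  except for the root.
\<close>

definition past :: "seed \<Rightarrow> vertex set" where
  "past t = (range (spine t) - {[]}) \<union> left_of_spine t"

section \<open>Random walks on the lattice\<close>

definition lattice_neighbors :: "(int ^ 'd) set" where
  "lattice_neighbors = {axis i 1 | i. True} \<union> {axis i (- 1) | i. True}"

definition step_pmf :: "(int ^ 'd) pmf" where
  "step_pmf = pmf_of_set lattice_neighbors"

text \<open>
  The increment attached to a nonempty word \<open>u\<close> belongs to the edge between \<open>u\<close> and its parent;
  the one attached to the empty word is not used.
\<close>

definition increment_measure :: "(vertex \<Rightarrow> int ^ 'd) measure" where
  "increment_measure = (\<Pi>\<^sub>M u\<in>UNIV. measure_pmf step_pmf)"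

definition tree_walk :: "int ^ 'd \<Rightarrow> (vertex \<Rightarrow> int ^ 'd) \<Rightarrow> vertex \<Rightarrow> int ^ 'd" where
  "tree_walk x \<xi> u = x + (\<Sum>k = 1..length u. \<xi> (take k u))"

definition past_range :: "int ^ 'd \<Rightarrow> seed \<Rightarrow> (vertex \<Rightarrow> int ^ 'd) \<Rightarrow> (int ^ 'd) set" where
  "past_range x t \<xi> = tree_walk x \<xi> ` past t"

definition tree_walk_measure :: "nat pmf \<Rightarrow> (seed \<times> (vertex \<Rightarrow> int ^ 'd)) measure" where
  "tree_walk_measure \<mu> = seed_measure \<mu> \<Otimes>\<^sub>M increment_measure"

text \<open>This is meant for finite sets \<open>A\<close> in dimension at least 5.\<close>

definition BCap :: "nat pmf \<Rightarrow> (int ^ 'd) set \<Rightarrow> real" where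
  "BCap \<mu> A =
     (\<Sum>x\<in>A. measure (tree_walk_measure \<mu>)
        {\<omega> \<in> space (tree_walk_measure \<mu>). past_range x (fst \<omega>) (snd \<omega>) \<inter> A = {}})"

definition srw_measure :: "(nat \<Rightarrow> int ^ 'd) measure" where
  "srw_measure = (\<Pi>\<^sub>M k\<in>UNIV. measure_pmf step_pmf)"

definition srw :: "(nat \<Rightarrow> int ^ 'd) \<Rightarrow> nat \<Rightarrow> int ^ 'd" where
  "srw \<omega> n = (\<Sum>k<n. \<omega> k)"

definition srw_range :: "(nat \<Rightarrow> int ^ 'd) \<Rightarrow> nat \<Rightarrow> (int ^ 'd) set" where
  "srw_range \<omega> n = srw \<omega> ` {0..n}"


end

theory Submission imports Defs begin

text \<open>
  Let \<open>f\<close> be the generating function of the offspring law, let \<open>P\<close> average a function over the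
  neighbours of a point, and let \<open>h(z)\<close> be the probability that the branching walk started by one
  normal particle at \<open>z\<close> hits the finite set \<open>A\<close>. Off \<open>A\<close> one has \<open>1 - h = f(1 - P h)\<close>. A special
  vertex has \<open>j\<close> offspring to the left of its special offspring with probability
  \<open>\<mu>(j+1) + \<mu>(j+2) + \<dots>\<close>. Integrating out the trees that hang to the left of the spine therefore turns
  the probability that the past avoids \<open>A\<close> into the probability that a simple random walk, killed at
  \<open>z\<close> with probability \<open>1 - \<phi>(z)\<close> where \<open>\<phi> = (1 - f(1 - P h)) / P h\<close>, survives forever and does not
  return to \<open>A\<close> (\<open>BCap_eq_capacity\<close>). The point is that \<open>h\<close> and the survival probability \<open>w\<close> solve
  the same linear equation \<open>u = \<phi> P u\<close> off \<open>A\<close>, with \<open>h = 1\<close> and \<open>w = 0\<close> on \<open>A\<close>. What remains is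
  potential theory for the pair \<open>(h, w)\<close>.

  Upper bound. For a cutoff \<open>\<eta>\<close> with \<open>\<eta> = 1\<close> on \<open>A\<close>, the sum of \<open>\<eta> (h P w - w P h)\<close> over the lattice is
  the capacity of \<open>A\<close>. Summation by parts leaves only the edges on which \<open>\<eta>\<close> varies. If \<open>A\<close> has radius
  \<open>r\<close>, these can be taken at distance of order \<open>r\<close>, where \<open>h\<close> is of order at most \<open>r powr -2\<close>
  (\<open>hit_le\<close>, a comparison with a half-space) and where the gradients of the subharmonic functions \<open>h\<close>
  and \<open>w\<close> are controlled by a Caccioppoli inequality (\<open>caccioppoli\<close>). The outcome is that the capacity
  is at most of order \<open>r ^ (d - 4)\<close> (\<open>capacity_le_box\<close>), so for \<open>d = 5\<close> at most linear in the maximal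
  displacement of the walk, whose mean is of order at most \<open>sqrt n\<close>.

  Lower bound. For a measure \<open>\<nu>\<close> on \<open>A\<close> with Green potential \<open>U\<close> and energy \<open>E = \<Sum> \<nu> U + \<Sum> U\<^sup>2\<close>, the
  capacity of \<open>A\<close> is at least of order \<open>\<alpha> |\<nu>| - \<alpha>\<^sup>2 E\<close> for every \<open>\<alpha> \<ge> 0\<close> (\<open>capacity_lower\<close>). Indeed,
  let \<open>N\<close> be the number of visits to \<open>A\<close> by a branching walk, weighted by \<open>\<nu>\<close>. After summation over
  the starting point, its first two moments are in the proportion of \<open>|\<nu>|\<close> to \<open>E\<close>, up to a constant,
  and the indicator of \<open>N > 0\<close> is at least \<open>\<alpha> N - \<alpha>\<^sup>2 N\<^sup>2\<close>. Hitting probabilities, summed over the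
  starting points, are turned into the capacity by time reversal of the killed walk. That sum is infinite
  for the critical tree, which is why every vertex is removed with a small probability that tends to 0 in
  the end.

  For \<open>\<nu>\<close> the local time of the walk, the mean energy is controlled by
  the sum of \<open>(j + 1) p(\<bar>k - l\<bar> + j)\<close> over \<open>k, l \<le> n\<close> and all \<open>j\<close>, where \<open>p(j)\<close> is the return
  probability at time \<open>j\<close>. As \<open>p(j)\<close> is of order at most \<open>j powr (-5/2)\<close> (\<open>walk_kernel_le\<close>), this is of
  order at most \<open>n powr (3/2)\<close> (\<open>walk_avg_pair_energy\<close>), and \<open>\<alpha>\<close> of order \<open>1 / sqrt n\<close> gives a lower
  bound of order \<open>sqrt n\<close>.
\<close>

section \<open>The generating function of the offspring law\<close>

lemma sum_power_swap:
  "(\<Sum>i<k. b ^ (k - Suc i) * a ^ i) = (\<Sum>i<k. (b::'a::comm_ring_1) ^ i * a ^ (k - Suc i))"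
  by (rule sum.reindex_bij_witness[of _ "\<lambda>i. k - Suc i" "\<lambda>i. k - Suc i"]) auto

lemma power_diff_sum: "a ^ k - b ^ k = (a - b) * (\<Sum>i<k. (b::'a::comm_ring_1) ^ i * a ^ (k - Suc i))"
  unfolding power_diff_sumr2 sum_power_swap ..

locale offspring_law =
  fixes \<mu> :: "nat pmf"
  assumes critical: "(\<lambda>i. real i * pmf \<mu> i) sums 1"
    and finite_variance: "integrable (measure_pmf \<mu>) (\<lambda>i. (real i)\<^sup>2)"
    and positive_variance: "measure_pmf.variance \<mu> real > 0"
begin

definition gf :: "real \<Rightarrow> real" where
  "gf x = measure_pmf.expectation \<mu> (\<lambda>k. x ^ k)"

text \<open>
  The divided difference of the generating function. For \<open>b = 1\<close> it is itself a generating function, the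
  one of the number of offspring to the left of the special one. Bounds on divided differences replace
  Taylor expansions, and they need no derivative at the boundary point 1.
\<close>

definition slope :: "real \<Rightarrow> real \<Rightarrow> real" where
  "slope a b = measure_pmf.expectation \<mu> (\<lambda>k. \<Sum>i<k. a ^ i * b ^ (k - Suc i))"

definition branch_prob :: real where
  "branch_prob = measure_pmf.prob \<mu> {2..}"

definition second_moment :: real where
  "second_moment = measure_pmf.expectation \<mu> (\<lambda>k. (real k)\<^sup>2)"

lemma integrable_mean: "integrable (measure_pmf \<mu>) real"
proof (rule Bochner_Integration.integrable_bound[OF finite_variance])
  show "AE k in measure_pmf \<mu>. norm (real k) \<le> norm ((real k)\<^sup>2)"
    by (intro AE_I2) (simp add: power2_eq_square flip: of_nat_mult)
qed simp

lemma mean_eq_1: "measure_pmf.expectation \<mu> real = 1"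
proof -
  have "integrable (count_space UNIV) (\<lambda>k. pmf \<mu> k * real k)"
    using integrable_mean unfolding measure_pmf_eq_density
    by (subst (asm) integrable_density) auto
  then have "(\<lambda>k. pmf \<mu> k * real k) sums (\<integral>k. pmf \<mu> k * real k \<partial>count_space UNIV)"
    by (rule sums_integral_count_space_nat)
  moreover have "(\<integral>k. pmf \<mu> k * real k \<partial>count_space UNIV) = measure_pmf.expectation \<mu> real"
    unfolding measure_pmf_eq_density by (subst integral_density) auto
  ultimately show ?thesis
    using critical by (simp add: mult.commute sums_iff)
qed

lemma integrable_power_gf:
  assumes "0 \<le> x" "x \<le> (1::real)"
  shows "integrable (measure_pmf \<mu>) (\<lambda>k. x ^ k)"
  by (rule measure_pmf.integrable_const_bound[where B = 1]) (use assms in \<open>auto simp: power_le_one\<close>)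

lemma slope_summand_le:
  assumes "0 \<le> a" "a \<le> 1" "0 \<le> b" "b \<le> (1::real)"
  shows "(\<Sum>i<k. a ^ i * b ^ (k - Suc i)) \<le> real k"
proof -
  have "(\<Sum>i<k. a ^ i * b ^ (k - Suc i)) \<le> (\<Sum>i<k. 1)"
    by (intro sum_mono) (use assms in \<open>auto intro!: mult_le_one power_le_one\<close>)
  then show ?thesis by simp
qed

lemma integrable_slope:
  assumes "0 \<le> a" "a \<le> 1" "0 \<le> b" "b \<le> (1::real)"
  shows "integrable (measure_pmf \<mu>) (\<lambda>k. \<Sum>i<k. a ^ i * b ^ (k - Suc i))"
proof (rule Bochner_Integration.integrable_bound[OF integrable_mean])
  show "AE k in measure_pmf \<mu>. norm (\<Sum>i<k. a ^ i * b ^ (k - Suc i)) \<le> norm (real k)"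
    using slope_summand_le[OF assms] assms by (intro AE_I2) (simp add: sum_nonneg)
qed simp

lemma gf_diff:
  assumes "0 \<le> a" "a \<le> 1" "0 \<le> b" "b \<le> 1"
  shows "gf b - gf a = (b - a) * slope a b"
proof -
  have "gf b - gf a = measure_pmf.expectation \<mu> (\<lambda>k. b ^ k - a ^ k)"
    unfolding gf_def using assms by (subst Bochner_Integration.integral_diff) (auto intro: integrable_power_gf)
  also have "\<dots> = measure_pmf.expectation \<mu> (\<lambda>k. (b - a) * (\<Sum>i<k. a ^ i * b ^ (k - Suc i)))"
    unfolding power_diff_sum by simp
  finally show ?thesis by (simp add: slope_def)
qed

lemma gf_1 [simp]: "gf 1 = 1"
  by (simp add: gf_def)

lemma gf_nonneg: "0 \<le> x \<Longrightarrow> x \<le> 1 \<Longrightarrow> 0 \<le> gf x"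
  unfolding gf_def by (intro integral_nonneg_AE) auto

lemma slope_nonneg: "0 \<le> a \<Longrightarrow> a \<le> 1 \<Longrightarrow> 0 \<le> b \<Longrightarrow> b \<le> 1 \<Longrightarrow> 0 \<le> slope a b"
  unfolding slope_def by (intro integral_nonneg_AE) (auto intro!: sum_nonneg)

lemma slope_mono:
  assumes "0 \<le> a" "a \<le> a'" "a' \<le> 1" "0 \<le> b" "b \<le> b'" "b' \<le> 1"
  shows "slope a b \<le> slope a' b'"
  unfolding slope_def using assms
  by (intro integral_mono integrable_slope sum_mono mult_mono power_mono) auto

lemma slope_1_1: "slope 1 1 = 1"
  unfolding slope_def using mean_eq_1 by simp

lemma slope_le_1:
  assumes "0 \<le> a" "a \<le> 1" "0 \<le> b" "b \<le> 1"
  shows "slope a b \<le> 1"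
  using slope_mono[of a 1 b 1] assms slope_1_1 by simp

lemma gf_mono: "0 \<le> a \<Longrightarrow> a \<le> b \<Longrightarrow> b \<le> 1 \<Longrightarrow> gf a \<le> gf b"
  unfolding gf_def by (intro integral_mono integrable_power_gf power_mono) auto

lemma gf_le_1: "0 \<le> x \<Longrightarrow> x \<le> 1 \<Longrightarrow> gf x \<le> 1"
  using gf_mono[of x 1] by simp

lemma gf_lipschitz:
  assumes "0 \<le> a" "a \<le> 1" "0 \<le> b" "b \<le> 1"
  shows "\<bar>gf b - gf a\<bar> \<le> \<bar>b - a\<bar>"
  using gf_diff[OF assms] slope_nonneg[OF assms] slope_le_1[OF assms]
  by (simp add: abs_mult mult_left_le)

lemma gf_ge_self: "0 \<le> x \<Longrightarrow> x \<le> 1 \<Longrightarrow> x \<le> gf x"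
  using gf_diff[of x 1] slope_le_1[of x 1] mult_left_le[of "slope x 1" "1 - x"] by simp

lemma continuous_on_gf: "continuous_on {0..1} gf"
proof (rule continuous_onI)
  fix x e :: real assume "x \<in> {0..1}" "0 < e"
  then show "\<exists>d>0. \<forall>x'\<in>{0..1}. dist x' x < d \<longrightarrow> dist (gf x') (gf x) \<le> e"
    using gf_lipschitz by (intro exI[of _ e]) (force simp: dist_real_def)
qed

text \<open>
  If the law charged only 0 and 1, then \<open>k\<^sup>2 = k\<close> almost surely, and mean 1 would leave no variance.
\<close>

lemma branch_prob_pos: "branch_prob > 0"
proof (rule ccontr)
  assume "\<not> branch_prob > 0"
  then have "branch_prob = 0"
    unfolding branch_prob_def using measure_nonneg[of "measure_pmf \<mu>"] by (simp add: order.antisym not_less)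
  then have small: "AE k in measure_pmf \<mu>. k \<le> 1"
    unfolding branch_prob_def by (subst (asm) measure_pmf.prob_eq_0) (auto elim!: eventually_mono)
  then have "measure_pmf.expectation \<mu> (\<lambda>k. (real k)\<^sup>2) = measure_pmf.expectation \<mu> real"
    by (intro integral_cong_AE) (auto elim!: eventually_mono simp: le_Suc_eq)
  then have "measure_pmf.variance \<mu> real = 0"
    using measure_pmf.variance_eq[OF integrable_mean finite_variance] mean_eq_1 by simp
  then show False using positive_variance by simp
qed

lemma second_moment_pos: "second_moment > 0"
proof -
  have "measure_pmf.variance \<mu> real = second_moment - 1"
    using measure_pmf.variance_eq[OF integrable_mean finite_variance] mean_eq_1
    by (simp add: second_moment_def)
  then show ?thesis using positive_variance by simp
qed

lemma branch_prob_le_1: "branch_prob \<le> 1"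
  unfolding branch_prob_def by simp

text \<open>
  A quantitative form of convexity: every \<open>k \<ge> 2\<close> contributes at least \<open>1 - s\<close> to the difference,
  through the summand \<open>i = 0\<close>.
\<close>

lemma slope_gap:
  assumes "0 \<le> a" "a \<le> 1" "0 \<le> s" "s \<le> 1"
  shows "slope a s \<le> slope a 1 - branch_prob * (1 - s)"
proof -
  have ind: "measure_pmf.expectation \<mu> (\<lambda>k. indicator {2..} k * (1 - s)) = branch_prob * (1 - s)"
    unfolding branch_prob_def by simp
  have "slope a s \<le> measure_pmf.expectation \<mu>
     (\<lambda>k. (\<Sum>i<k. a ^ i * 1 ^ (k - Suc i)) - indicator {2..} k * (1 - s))"
    unfolding slope_def
  proof (intro integral_mono Bochner_Integration.integrable_diff integrable_slope)
    show "integrable (measure_pmf \<mu>) (\<lambda>k. indicat_real {2..} k * (1 - s))"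
      by (intro integrable_mult_left measure_pmf.integrable_const_bound[where B = 1]) auto
    fix k
    have *: "a ^ i * s ^ (k - Suc i) \<le> a ^ i * 1 ^ (k - Suc i)" for i
      using assms by (intro mult_left_mono power_mono) auto
    show "(\<Sum>i<k. a ^ i * s ^ (k - Suc i))
        \<le> (\<Sum>i<k. a ^ i * 1 ^ (k - Suc i)) - indicator {2..} k * (1 - s)"
    proof (cases "k \<ge> 2")
      case True
      then obtain m where k: "k = Suc (Suc m)" by (metis Suc_le_D numeral_2_eq_2 Suc_le_mono)
      have "s ^ Suc m \<le> s" using assms power_le_one[of s m] by (simp add: mult_left_le)
      moreover have "(\<Sum>i<Suc m. a ^ Suc i * s ^ (k - Suc (Suc i))) \<le> (\<Sum>i<Suc m. a ^ Suc i * 1 ^ (k - Suc (Suc i)))"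
        by (intro sum_mono *)
      ultimately show ?thesis
        unfolding k by (subst (1 2) sum.lessThan_Suc_shift) (simp add: k)
    next
      case False then show ?thesis using * by (simp add: sum_mono)
    qed
  qed (use assms in auto)
  also have "\<dots> = slope a 1 - branch_prob * (1 - s)"
    unfolding slope_def ind[symmetric] using assms
    by (intro Bochner_Integration.integral_diff integrable_slope integrable_mult_left
          measure_pmf.integrable_const_bound[where B = 1]) auto
  finally show ?thesis .
qed

lemma slope_sym: "slope a b = slope b a"
  unfolding slope_def sum_power_swap[symmetric, of b] by (simp add: mult.commute)

text \<open>
  Bernoulli's inequality in each power; at \<open>a = b = 1\<close> the divided difference is the mean, which is 1.
\<close>

lemma slope_lower:
  assumes "0 \<le> a" "a \<le> 1" "0 \<le> b" "b \<le> 1"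
  shows "1 - second_moment * ((1 - a) + (1 - b)) \<le> slope a b"
proof -
  have i: "integrable (measure_pmf \<mu>) (\<lambda>k. real k - (real k)\<^sup>2 * ((1 - a) + (1 - b)))"
    using integrable_mean finite_variance by simp
  have "1 - second_moment * ((1 - a) + (1 - b))
      = measure_pmf.expectation \<mu> (\<lambda>k. real k - (real k)\<^sup>2 * ((1 - a) + (1 - b)))"
    using integrable_mean finite_variance mean_eq_1 by (simp add: second_moment_def)
  also have "\<dots> \<le> slope a b"
    unfolding slope_def
  proof (intro integral_mono i integrable_slope assms)
    fix k
    have "(\<Sum>i<k. 1 - real k * ((1 - a) + (1 - b))) \<le> (\<Sum>i<k. a ^ i * b ^ (k - Suc i))"
    proof (intro sum_mono)
      fix i assume "i \<in> {..<k}"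
      then have ik: "i < k" by simp
      have B: "1 - real j * (1 - x) \<le> x ^ j" if "0 \<le> x" "x \<le> 1" for x j
        using Bernoulli_inequality[of "x - 1" j] that by (simp add: algebra_simps)
      have pa: "0 \<le> a ^ i" "a ^ i \<le> 1" "0 \<le> b ^ (k - Suc i)" "b ^ (k - Suc i) \<le> 1"
        using assms by (auto simp: power_le_one)
      have "0 \<le> (1 - a ^ i) * (1 - b ^ (k - Suc i))" using pa by simp
      then have "a ^ i + b ^ (k - Suc i) - 1 \<le> a ^ i * b ^ (k - Suc i)" by (simp add: algebra_simps)
      moreover have "1 - real i * (1 - a) \<le> a ^ i" "1 - real (k - Suc i) * (1 - b) \<le> b ^ (k - Suc i)"
        using B assms by auto
      moreover have "real i * (1 - a) \<le> real k * (1 - a)" "real (k - Suc i) * (1 - b) \<le> real k * (1 - b)"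
        using ik assms by (auto intro!: mult_right_mono)
      ultimately show "1 - real k * ((1 - a) + (1 - b)) \<le> a ^ i * b ^ (k - Suc i)"
        by (simp add: algebra_simps)
    qed
    then show "real k - (real k)\<^sup>2 * ((1 - a) + (1 - b)) \<le> (\<Sum>i<k. a ^ i * b ^ (k - Suc i))"
      by (simp add: power2_eq_square algebra_simps)
  qed
  finally show ?thesis .
qed

text \<open>
  This is the source of the quadratic decay of hitting probabilities: they are subharmonic off the target,
  with a Laplacian of at least the order of their square.
\<close>

lemma gf_excess:
  assumes "0 \<le> g" "g \<le> 1"
  shows "branch_prob * g\<^sup>2 \<le> gf (1 - g) - (1 - g)"
proof -
  have "1 - gf (1 - g) = g * slope (1 - g) 1"
    using gf_diff[of "1 - g" 1] assms by simp
  moreover have "slope (1 - g) 1 \<le> 1 - branch_prob * g"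
    using slope_gap[of 1 "1 - g"] assms slope_1_1 slope_sym[of 1 "1 - g"] by simp
  ultimately show ?thesis
    using assms mult_left_mono[of "slope (1 - g) 1" "1 - branch_prob * g" g]
    by (simp add: power2_eq_square algebra_simps)
qed

end

section \<open>Averages over neighbours\<close>

definition avg :: "(int ^ 'd \<Rightarrow> real) \<Rightarrow> int ^ 'd \<Rightarrow> real" where
  "avg u z = measure_pmf.expectation step_pmf (\<lambda>e. u (z + e))"

lemma lattice_neighbors_eq:
  "lattice_neighbors = range (\<lambda>i. axis i 1) \<union> range (\<lambda>i::'d. axis i (- 1) :: int ^ 'd)"
  by (auto simp: lattice_neighbors_def)

lemma finite_lattice_neighbors: "finite (lattice_neighbors :: (int ^ 'd) set)"
  by (simp add: lattice_neighbors_eq)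

lemma lattice_neighbors_nonempty: "lattice_neighbors \<noteq> ({} :: (int ^ 'd) set)"
  by (simp add: lattice_neighbors_eq)

lemma card_lattice_neighbors_pos: "card (lattice_neighbors :: (int ^ 'd) set) > 0"
  by (simp add: card_gt_0_iff finite_lattice_neighbors lattice_neighbors_nonempty)

lemma uminus_lattice_neighbors: "uminus ` lattice_neighbors = (lattice_neighbors :: (int ^ 'd) set)"
proof -
  have "- axis i a = (axis i (- a) :: int ^ 'd)" for i a
    by (simp add: axis_def vec_eq_iff)
  then show ?thesis
    by (auto simp: lattice_neighbors_eq image_Un image_image)
qed

lemma sum_lattice_neighbors:
  "(\<Sum>e\<in>lattice_neighbors. g e) = (\<Sum>i\<in>UNIV. g (axis i 1) + g (axis i (- 1 :: int) :: int ^ 'd))"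
proof -
  have inj: "inj (\<lambda>i::'d. axis i a :: int ^ 'd)" if "a \<noteq> 0" for a
    using that by (auto simp: inj_def axis_eq_axis)
  have disj: "range (\<lambda>i. axis i 1) \<inter> range (\<lambda>i::'d. axis i (- 1) :: int ^ 'd) = {}"
    by (auto simp: axis_eq_axis)
  show ?thesis
    unfolding lattice_neighbors_eq
    by (subst sum.union_disjoint) (simp_all add: disj sum.reindex inj sum.distrib)
qed

lemma card_lattice_neighbors: "card (lattice_neighbors :: (int ^ 'd) set) = 2 * CARD('d)"
  using sum_lattice_neighbors[of "\<lambda>_ :: int ^ 'd. 1 :: nat"] by simp

lemma avg_eq_sum:
  "avg u z = (\<Sum>e\<in>lattice_neighbors. u (z + e)) / card (lattice_neighbors :: (int ^ 'd) set)"
  for z :: "int ^ 'd"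
  unfolding avg_def step_pmf_def
  by (rule integral_pmf_of_set) (simp_all add: finite_lattice_neighbors lattice_neighbors_nonempty)

lemma avg_mono: "(\<And>y. u y \<le> v y) \<Longrightarrow> avg u z \<le> avg v z"
  unfolding avg_eq_sum by (intro divide_right_mono sum_mono) auto

lemma avg_const [simp]: "avg (\<lambda>_. c) z = c"
  by (simp add: avg_def)

lemma avg_nonneg: "(\<And>y. 0 \<le> u y) \<Longrightarrow> 0 \<le> avg u z"
  using avg_mono[of "\<lambda>_. 0" u z] by simp

lemma avg_le: "(\<And>y. u y \<le> c) \<Longrightarrow> avg u z \<le> c"
  using avg_mono[of u "\<lambda>_. c" z] by simp

lemma avg_add: "avg (\<lambda>y. u y + v y) z = avg u z + avg v z"
  by (simp add: avg_eq_sum sum.distrib add_divide_distrib)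

lemma avg_diff: "avg (\<lambda>y. u y - v y) z = avg u z - avg v z"
  by (simp add: avg_eq_sum sum_subtractf diff_divide_distrib)

lemma avg_cmult: "avg (\<lambda>y. c * u y) z = c * avg u z"
  by (simp add: avg_eq_sum sum_distrib_left)

lemma avg_one_minus: "avg (\<lambda>y. 1 - u y) z = 1 - avg u z"
  by (simp add: avg_diff)

lemma avg_sum: "avg (\<lambda>y. \<Sum>i\<in>I. u i y) z = (\<Sum>i\<in>I. avg (u i) z)"
  by (induction I rule: infinite_finite_induct) (simp_all add: avg_add)

lemma tendsto_avg:
  assumes "\<And>y. ((\<lambda>n. u n y) \<longlongrightarrow> v y) F"
  shows "((\<lambda>n. avg (u n) z) \<longlongrightarrow> avg v z) F"
  unfolding avg_eq_sum using assms card_lattice_neighbors_pos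
  by (intro tendsto_divide tendsto_sum tendsto_const) (auto simp: neq0_conv)

lemma avg_square_le: "(avg u z)\<^sup>2 \<le> avg (\<lambda>y. (u y)\<^sup>2) z"
proof -
  have "0 \<le> avg (\<lambda>y. (u y - avg u z)\<^sup>2) z"
    by (intro avg_nonneg) simp
  also have "avg (\<lambda>y. (u y - avg u z)\<^sup>2) z = avg (\<lambda>y. (u y)\<^sup>2 - (2 * avg u z) * u y + (avg u z)\<^sup>2) z"
    by (simp add: power2_diff algebra_simps)
  also have "\<dots> = avg (\<lambda>y. (u y)\<^sup>2) z - (avg u z)\<^sup>2"
    unfolding avg_add avg_diff avg_cmult by (simp add: power2_eq_square)
  finally show ?thesis by simp
qed

section \<open>Sums of finitely supported functions\<close>

definition fin_supp :: "(int ^ 'd \<Rightarrow> real) \<Rightarrow> bool" where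
  "fin_supp u \<longleftrightarrow> finite {z. u z \<noteq> 0}"

definition lsum :: "(int ^ 'd \<Rightarrow> real) \<Rightarrow> real" where
  "lsum u = infsum u UNIV"

lemma fin_supp_summable: "fin_supp u \<Longrightarrow> u summable_on UNIV"
  unfolding fin_supp_def by (rule finite_nonzero_values_imp_summable_on) simp

lemma fin_supp_mono: "fin_supp v \<Longrightarrow> (\<And>z. u z \<noteq> 0 \<Longrightarrow> v z \<noteq> 0) \<Longrightarrow> fin_supp u"
  unfolding fin_supp_def by (erule rev_finite_subset) auto

lemma fin_supp_on: "finite B \<Longrightarrow> (\<And>z. z \<notin> B \<Longrightarrow> u z = 0) \<Longrightarrow> fin_supp u"
  unfolding fin_supp_def by (erule rev_finite_subset) auto

lemma fin_supp_zero [simp]: "fin_supp (\<lambda>_. 0)"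
  by (simp add: fin_supp_def)

lemma fin_supp_add: "fin_supp u \<Longrightarrow> fin_supp v \<Longrightarrow> fin_supp (\<lambda>z. u z + v z)"
  unfolding fin_supp_def by (rule finite_subset[of _ "{z. u z \<noteq> 0} \<union> {z. v z \<noteq> 0}"]) auto

lemma fin_supp_diff: "fin_supp u \<Longrightarrow> fin_supp v \<Longrightarrow> fin_supp (\<lambda>z. u z - v z)"
  unfolding fin_supp_def by (rule finite_subset[of _ "{z. u z \<noteq> 0} \<union> {z. v z \<noteq> 0}"]) auto

lemma fin_supp_mult1: "fin_supp u \<Longrightarrow> fin_supp (\<lambda>z. u z * v z)"
  by (erule fin_supp_mono) auto

lemma fin_supp_mult2: "fin_supp v \<Longrightarrow> fin_supp (\<lambda>z. u z * v z)"
  by (erule fin_supp_mono) auto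

lemma fin_supp_translate: "fin_supp u \<Longrightarrow> fin_supp (\<lambda>z. u (z + e))"
  unfolding fin_supp_def
proof -
  assume "finite {z. u z \<noteq> 0}"
  then have "finite ((\<lambda>z. z - e) ` {z. u z \<noteq> 0})" by simp
  moreover have "{z. u (z + e) \<noteq> 0} \<subseteq> (\<lambda>z. z - e) ` {z. u z \<noteq> 0}"
    by (auto intro!: image_eqI[of _ _ "_ + e"])
  ultimately show "finite {z. u (z + e) \<noteq> 0}" by (rule finite_subset[rotated])
qed

lemma fin_supp_sum: "(\<And>i. i \<in> I \<Longrightarrow> fin_supp (u i)) \<Longrightarrow> fin_supp (\<lambda>z. \<Sum>i\<in>I. u i z)"
  by (induction I rule: infinite_finite_induct) (auto intro: fin_supp_add)

lemma fin_supp_avg: "fin_supp u \<Longrightarrow> fin_supp (avg u)"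
proof -
  assume "fin_supp u"
  then have "fin_supp (\<lambda>z. \<Sum>e\<in>lattice_neighbors. u (z + e))"
    by (intro fin_supp_sum fin_supp_translate)
  then show ?thesis
    by (rule fin_supp_mono) (auto simp: avg_eq_sum)
qed

lemma lsum_add: "fin_supp u \<Longrightarrow> fin_supp v \<Longrightarrow> lsum (\<lambda>z. u z + v z) = lsum u + lsum v"
  unfolding lsum_def by (intro infsum_add fin_supp_summable)

lemma lsum_cmult: "lsum (\<lambda>z. c * u z) = c * lsum u"
  unfolding lsum_def by (rule infsum_cmult_right')

lemma lsum_diff: "fin_supp u \<Longrightarrow> fin_supp v \<Longrightarrow> lsum (\<lambda>z. u z - v z) = lsum u - lsum v"
  using lsum_add[of u "\<lambda>z. (- 1) * v z"] lsum_cmult[of "- 1" v] by (simp add: fin_supp_def)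

lemma lsum_zero [simp]: "lsum (\<lambda>_. 0) = 0"
  by (simp add: lsum_def)

lemma lsum_sum: "(\<And>i. i \<in> I \<Longrightarrow> fin_supp (u i)) \<Longrightarrow> lsum (\<lambda>z. \<Sum>i\<in>I. u i z) = (\<Sum>i\<in>I. lsum (u i))"
  by (induction I rule: infinite_finite_induct) (auto simp: lsum_add fin_supp_sum)

lemma lsum_mono: "fin_supp u \<Longrightarrow> fin_supp v \<Longrightarrow> (\<And>z. u z \<le> v z) \<Longrightarrow> lsum u \<le> lsum v"
  unfolding lsum_def by (intro infsum_mono fin_supp_summable) auto

lemma lsum_nonneg: "(\<And>z. 0 \<le> u z) \<Longrightarrow> 0 \<le> lsum u"
  unfolding lsum_def by (intro infsum_nonneg) auto

lemma lsum_on: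
  assumes "finite B" "\<And>z. z \<notin> B \<Longrightarrow> u z = 0"
  shows "lsum u = (\<Sum>z\<in>B. u z)"
proof -
  have "infsum u UNIV = infsum u B"
    by (rule infsum_cong_neutral) (use assms in auto)
  then show ?thesis using assms by (simp add: lsum_def)
qed

lemma lsum_translate: "lsum (\<lambda>z. u (z + e)) = lsum u"
  unfolding lsum_def
  by (rule infsum_reindex_bij_witness[of UNIV "\<lambda>z. z - e" "\<lambda>z. z + e"]) auto

lemma sum_neighbors_uminus: "(\<Sum>e\<in>lattice_neighbors. g (- e)) = (\<Sum>e\<in>lattice_neighbors. g (e :: int ^ 'd))"
  using sum.reindex[of uminus "lattice_neighbors :: (int ^ 'd) set" g]
  by (simp add: uminus_lattice_neighbors)

lemma lsum_avg_swap:
  assumes "fin_supp u \<or> fin_supp v"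
  shows "lsum (\<lambda>z. u z * avg v z) = lsum (\<lambda>z. avg u z * v z)"
proof -
  define c where "c = inverse (real (card (lattice_neighbors :: (int ^ 'a) set)))"
  have f1: "fin_supp (\<lambda>z. u z * v (z + e))" for e
    using assms by (auto intro: fin_supp_mult1 fin_supp_mult2 fin_supp_translate)
  have f2: "fin_supp (\<lambda>z. u (z + e) * v z)" for e
    using assms by (auto intro: fin_supp_mult1 fin_supp_mult2 fin_supp_translate)
  have "lsum (\<lambda>z. u z * avg v z) = lsum (\<lambda>z. c * (\<Sum>e\<in>lattice_neighbors. u z * v (z + e)))"
    unfolding avg_eq_sum c_def by (simp add: sum_distrib_left divide_inverse mult_ac)
  also have "\<dots> = c * (\<Sum>e\<in>lattice_neighbors. lsum (\<lambda>z. u z * v (z + e)))"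
    unfolding lsum_cmult using f1 by (subst lsum_sum) auto
  also have "(\<Sum>e\<in>lattice_neighbors. lsum (\<lambda>z. u z * v (z + e)))
      = (\<Sum>e\<in>lattice_neighbors. lsum (\<lambda>z. u (z + - e) * v z))"
  proof (rule sum.cong[OF refl])
    fix e
    show "lsum (\<lambda>z. u z * v (z + e)) = lsum (\<lambda>z. u (z + - e) * v z)"
      using lsum_translate[of "\<lambda>z. u (z + - e) * v z" e] by simp
  qed
  also have "\<dots> = (\<Sum>e\<in>lattice_neighbors. lsum (\<lambda>z. u (z + e) * v z))"
    by (rule sum_neighbors_uminus)
  also have "c * \<dots> = lsum (\<lambda>z. c * (\<Sum>e\<in>lattice_neighbors. u (z + e) * v z))"
    unfolding lsum_cmult using f2 by (subst lsum_sum) auto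
  also have "\<dots> = lsum (\<lambda>z. avg u z * v z)"
    unfolding avg_eq_sum c_def
    by (intro arg_cong[of _ _ lsum] ext) (simp add: sum_distrib_left divide_inverse mult_ac)
  finally show ?thesis .
qed

lemma lsum_avg: "fin_supp u \<Longrightarrow> lsum (avg u) = lsum u"
  using lsum_avg_swap[of u "\<lambda>_. 1"] by simp

section \<open>Avoidance and survival probabilities\<close>

context offspring_law
begin

text \<open>
  \<open>avoid A n z\<close> is the probability that a normal vertex whose parent is at \<open>z\<close> and its descendants
  miss \<open>A\<close> in the first \<open>n\<close> generations. Starting from the parent makes both recursions below of the
  form "average a local functional", and makes independent subtrees share a starting point.
\<close>

primrec avoid :: "(int ^ 'd) set \<Rightarrow> nat \<Rightarrow> int ^ 'd \<Rightarrow> real" where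
  "avoid A 0 = (\<lambda>_. 1)"
| "avoid A (Suc n) = avg (\<lambda>y. if y \<in> A then 0 else gf (avoid A n y))"

definition avoid_lim :: "(int ^ 'd) set \<Rightarrow> int ^ 'd \<Rightarrow> real" where
  "avoid_lim A z = lim (\<lambda>n. avoid A n z)"

definition hit :: "(int ^ 'd) set \<Rightarrow> int ^ 'd \<Rightarrow> real" where
  "hit A z = (if z \<in> A then 1 else 1 - gf (avoid_lim A z))"

text \<open>
  The probability that a special vertex at \<open>z\<close> lies off \<open>A\<close> and that all trees hanging to the left of
  the spine at this vertex miss \<open>A\<close>.
\<close>

definition survive :: "(int ^ 'd) set \<Rightarrow> int ^ 'd \<Rightarrow> real" where
  "survive A z = (if z \<in> A then 0 else slope (avoid_lim A z) 1)"

text \<open>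
  The first \<open>n\<close> special vertices after a vertex at \<open>z\<close>, together with the trees to their left, miss
  \<open>A\<close>.
\<close>

primrec escape :: "(int ^ 'd) set \<Rightarrow> nat \<Rightarrow> int ^ 'd \<Rightarrow> real" where
  "escape A 0 = (\<lambda>_. 1)"
| "escape A (Suc n) = avg (\<lambda>y. survive A y * escape A n y)"

definition escape_lim :: "(int ^ 'd) set \<Rightarrow> int ^ 'd \<Rightarrow> real" where
  "escape_lim A z = lim (\<lambda>n. escape A n z)"

lemma avoid_bounds: "0 \<le> avoid A n z \<and> avoid A n z \<le> 1"
proof (induction n arbitrary: z)
  case (Suc n)
  then show ?case
    by (auto intro!: avg_nonneg avg_le gf_nonneg gf_le_1)
qed simp

lemma avoid_nonneg: "0 \<le> avoid A n z" and avoid_le_1: "avoid A n z \<le> 1"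
  using avoid_bounds by auto

lemma avoid_Suc_le: "avoid A (Suc n) z \<le> avoid A n z"
proof (induction n arbitrary: z)
  case 0
  then show ?case using avoid_le_1[of A "Suc 0" z] by simp
next
  case (Suc n)
  have "avg (\<lambda>y. if y \<in> A then 0 else gf (avoid A (Suc n) y)) z
      \<le> avg (\<lambda>y. if y \<in> A then 0 else gf (avoid A n y)) z"
    using gf_mono[OF avoid_nonneg Suc avoid_le_1] by (intro avg_mono) (auto simp del: avoid.simps)
  then show ?case by (simp only: avoid.simps)
qed

lemma avoid_tendsto: "(\<lambda>n. avoid A n z) \<longlonglongrightarrow> avoid_lim A z"
proof -
  have "decseq (\<lambda>n. avoid A n z)" by (intro decseq_SucI avoid_Suc_le)
  then have "convergent (\<lambda>n. avoid A n z)"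
    using decseq_bounded[of _ 0] avoid_nonneg by (intro Bseq_monoseq_convergent)
      (auto simp: decseq_imp_monoseq)
  then show ?thesis unfolding avoid_lim_def by (simp add: convergent_LIMSEQ_iff)
qed

lemma avoid_lim_nonneg: "0 \<le> avoid_lim A z"
  by (rule LIMSEQ_le_const[OF avoid_tendsto]) (auto simp: avoid_nonneg)

lemma avoid_lim_le_avoid: "avoid_lim A z \<le> avoid A n z"
  by (rule decseq_ge[OF _ avoid_tendsto]) (intro decseq_SucI avoid_Suc_le)

lemma avoid_lim_le_1: "avoid_lim A z \<le> 1"
  using avoid_lim_le_avoid[of A z 0] by simp

lemmas avoid_lim_01 [simp] = avoid_lim_nonneg avoid_lim_le_1

lemma gf_avoid_tendsto: "(\<lambda>n. gf (avoid A n z)) \<longlonglongrightarrow> gf (avoid_lim A z)"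
  by (rule continuous_on_tendsto_compose[OF continuous_on_gf avoid_tendsto])
     (auto simp: avoid_nonneg avoid_le_1)

lemma avoid_lim_fixed: "avoid_lim A z = avg (\<lambda>y. 1 - hit A y) z"
proof (rule LIMSEQ_unique)
  show "(\<lambda>n. avoid A (Suc n) z) \<longlonglongrightarrow> avoid_lim A z"
    by (rule LIMSEQ_Suc[OF avoid_tendsto])
  show "(\<lambda>n. avoid A (Suc n) z) \<longlonglongrightarrow> avg (\<lambda>y. 1 - hit A y) z"
    unfolding avoid.simps by (rule tendsto_avg) (auto simp: hit_def intro: gf_avoid_tendsto)
qed

lemma avg_hit: "avg (hit A) z = 1 - avoid_lim A z"
  unfolding avoid_lim_fixed avg_one_minus by simp

lemma hit_nonneg: "0 \<le> hit A z" and hit_le_1: "hit A z \<le> 1"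
  by (auto simp: hit_def gf_nonneg gf_le_1)

lemma hit_on: "z \<in> A \<Longrightarrow> hit A z = 1"
  by (simp add: hit_def)

text \<open>
  \<open>survive\<close> is the slope of the generating function between \<open>avoid_lim A z\<close> and 1, so the nonlinear
  equation for \<open>hit\<close> is also a linear one, the same as for the survival probability.
\<close>

lemma hit_eq: "z \<notin> A \<Longrightarrow> hit A z = survive A z * avg (hit A) z"
  using gf_diff[of "avoid_lim A z" 1] by (simp add: hit_def survive_def avg_hit mult.commute)

lemma survive_nonneg: "0 \<le> survive A z" and survive_le_1: "survive A z \<le> 1"
  by (auto simp: survive_def slope_nonneg slope_le_1)

lemma escape_bounds: "0 \<le> escape A n z \<and> escape A n z \<le> 1"
proof (induction n arbitrary: z)
  case (Suc n)
  then show ?case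
    by (auto intro!: avg_nonneg avg_le mult_nonneg_nonneg mult_le_one survive_nonneg survive_le_1)
qed simp

lemma escape_nonneg: "0 \<le> escape A n z" and escape_le_1: "escape A n z \<le> 1"
  using escape_bounds by auto

lemma escape_Suc_le: "escape A (Suc n) z \<le> escape A n z"
proof (induction n arbitrary: z)
  case 0
  then show ?case using escape_le_1[of A "Suc 0" z] by simp
next
  case (Suc n)
  have "avg (\<lambda>y. survive A y * escape A (Suc n) y) z \<le> avg (\<lambda>y. survive A y * escape A n y) z"
    by (intro avg_mono mult_left_mono Suc survive_nonneg)
  then show ?case by (simp only: escape.simps)
qed

lemma escape_tendsto: "(\<lambda>n. escape A n z) \<longlonglongrightarrow> escape_lim A z"
proof -
  have "decseq (\<lambda>n. escape A n z)" by (intro decseq_SucI escape_Suc_le)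
  then have "convergent (\<lambda>n. escape A n z)"
    using decseq_bounded[of _ 0] escape_nonneg by (intro Bseq_monoseq_convergent)
      (auto simp: decseq_imp_monoseq)
  then show ?thesis unfolding escape_lim_def by (simp add: convergent_LIMSEQ_iff)
qed

lemma escape_lim_nonneg: "0 \<le> escape_lim A z"
  by (rule LIMSEQ_le_const[OF escape_tendsto]) (auto simp: escape_nonneg)

lemma escape_lim_le_1: "escape_lim A z \<le> 1"
  by (rule LIMSEQ_le_const2[OF escape_tendsto]) (auto simp: escape_le_1)

lemma escape_lim_fixed: "escape_lim A z = avg (\<lambda>y. survive A y * escape_lim A y) z"
proof (rule LIMSEQ_unique)
  show "(\<lambda>n. escape A (Suc n) z) \<longlonglongrightarrow> escape_lim A z"
    by (rule LIMSEQ_Suc[OF escape_tendsto])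
  show "(\<lambda>n. escape A (Suc n) z) \<longlonglongrightarrow> avg (\<lambda>y. survive A y * escape_lim A y) z"
    unfolding escape.simps by (intro tendsto_avg tendsto_mult tendsto_const escape_tendsto)
qed

end

section \<open>Hitting probabilities decay quadratically\<close>

text \<open>
  The discrete form of the fact that a positive decreasing solution of \<open>v'' \<ge> c v\<^sup>2\<close> decays like
  \<open>1 / m\<^sup>2\<close>. Convexity gives slope at least \<open>c (v m)\<^sup>2 m / 2\<close> on the first half of \<open>[0, m]\<close>, hence
  \<open>(v m)\<^sup>2\<close> is at most of order \<open>v (m div 4) / m\<^sup>2\<close>, and this improves by itself along \<open>m, m div 4, \<dots>\<close>.
\<close>

lemma quadratic_decay:
  fixes v :: "nat \<Rightarrow> real"
  assumes nonneg: "\<And>m. 0 \<le> v m" and le_1: "\<And>m. v m \<le> 1" and dec: "\<And>m. v (Suc m) \<le> v m"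
    and conv: "\<And>m. v (Suc (Suc m)) + v m - 2 * v (Suc m) \<ge> c * (v (Suc m))\<^sup>2"
    and c: "c > 0" and K: "K \<ge> 16" "K \<ge> 256 / c"
  shows "v m \<le> K / (real m + 1)\<^sup>2"
proof (induction m rule: less_induct)
  case (less m)
  have mono: "v b \<le> v a" if "a \<le> b" for a b
    using dec that by (rule lift_Suc_antimono_le)
  show ?case
  proof (cases "m < 4")
    case True
    then have "(real m + 1)\<^sup>2 \<le> 4\<^sup>2" by (intro power_mono) auto
    then have "1 \<le> K / (real m + 1)\<^sup>2" using K by (simp add: field_simps)
    then show ?thesis using le_1[of m] by linarith
  next
    case False
    (* The slope is estimated on [k, 2 k]; the remaining distance from 2 k to m is at least m / 2. *)
    define k where "k = m div 4"
    have k: "k \<ge> 1" "4 * k \<le> m" "m \<le> 4 * k + 3" using False by (auto simp: k_def)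
    have d: "v j - v (Suc j) \<ge> real (m - j) * (c * (v m)\<^sup>2)" if "j \<le> m" for j
      using that
    proof (induction rule: inc_induct)
      case base
      then show ?case using dec[of m] by simp
    next
      case (step j)
      have "(v m)\<^sup>2 \<le> (v (Suc j))\<^sup>2"
        using mono[of "Suc j" m] step nonneg by (intro power_mono) auto
      then have "c * (v m)\<^sup>2 \<le> c * (v (Suc j))\<^sup>2" using c by simp
      moreover have "real (m - j) = real (m - Suc j) + 1" using step by linarith
      ultimately show ?case using step conv[of j] by (simp add: algebra_simps)
    qed
    (* Summing the slopes over t steps. *)
    have s: "v k - v (k + t) \<ge> real t * (real (Suc m - 2 * k) * (c * (v m)\<^sup>2))" if "t \<le> k" for t
      using that
    proof (induction t)
      case (Suc t)
      have "real (Suc m - 2 * k) \<le> real (m - (k + t))" using Suc.prems k by linarith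
      then have "real (Suc m - 2 * k) * (c * (v m)\<^sup>2) \<le> real (m - (k + t)) * (c * (v m)\<^sup>2)"
        using c by (intro mult_right_mono) auto
      then show ?case using Suc d[of "k + t"] k by (simp add: algebra_simps)
    qed simp
    define M where "M = real m + 1"
    have M: "M > 0" "real k \<ge> M / 8" "real (Suc m - 2 * k) \<ge> M / 2" "real k + 1 \<ge> M / 4"
    proof -
      have "8 * k \<ge> m + 1" "2 * (Suc m - 2 * k) \<ge> m + 1" "4 * (k + 1) \<ge> m + 1" using k by auto
      then have *: "real (m + 1) \<le> real (8 * k)" "real (m + 1) \<le> real (2 * (Suc m - 2 * k))"
        "real (m + 1) \<le> real (4 * (k + 1))" by (simp_all only: of_nat_le_iff)
      note * = *[unfolded of_nat_mult of_nat_add of_nat_1 of_nat_numeral]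
      show "real k \<ge> M / 8" using *(1) unfolding M_def by (simp add: pos_divide_le_eq mult.commute)
      show "real (Suc m - 2 * k) \<ge> M / 2" using *(2) unfolding M_def by (simp add: pos_divide_le_eq mult.commute)
      show "real k + 1 \<ge> M / 4" using *(3) unfolding M_def by (simp add: pos_divide_le_eq mult.commute)
    qed (simp add: M_def)
    have "(M / 8) * ((M / 2) * (c * (v m)\<^sup>2)) \<le> real k * (real (Suc m - 2 * k) * (c * (v m)\<^sup>2))"
    proof (rule mult_mono[OF M(2) mult_right_mono[OF M(3)]])
      show "0 \<le> c * (v m)\<^sup>2" using c by simp
      then show "0 \<le> M / 2 * (c * (v m)\<^sup>2)" using M(1) by simp
    qed simp_all
    also have "\<dots> \<le> v k" using s[OF order_refl] nonneg[of "k + k"] by linarith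
    also have "\<dots> \<le> K / (real k + 1)\<^sup>2" using k by (intro less.IH) linarith
    also have "\<dots> \<le> K / (M / 4)\<^sup>2"
    proof (rule divide_left_mono)
      show "(M / 4)\<^sup>2 \<le> (real k + 1)\<^sup>2" using M(1,4) by (intro power_mono) auto
      show "0 < (real k + 1)\<^sup>2 * (M / 4)\<^sup>2"
        using M(1) by (intro mult_pos_pos zero_less_power) auto
    qed (use K in simp)
    finally have le: "M / 8 * (M / 2 * (c * (v m)\<^sup>2)) \<le> K / (M / 4)\<^sup>2" .
    have "c * (v m * M\<^sup>2)\<^sup>2 = 16 * M\<^sup>2 * (M / 8 * (M / 2 * (c * (v m)\<^sup>2)))"
      by (simp add: power2_eq_square)
    also have "\<dots> \<le> 16 * M\<^sup>2 * (K / (M / 4)\<^sup>2)"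
      using le by (rule mult_left_mono) simp
    also have "\<dots> = 256 * K"
      using M(1) by (simp add: power2_eq_square)
    also have "256 * K \<le> (c * K) * K"
    proof (rule mult_right_mono)
      show "256 \<le> c * K" using K(2) c by (simp add: pos_divide_le_eq mult.commute)
    qed (use K(1) in linarith)
    also have "\<dots> = c * K\<^sup>2" by (simp add: power2_eq_square)
    finally have "(v m * M\<^sup>2)\<^sup>2 \<le> K\<^sup>2"
      using c by simp
    then have "v m * M\<^sup>2 \<le> K"
      by (rule power2_le_imp_le) (use K(1) in linarith)
    then have "v m \<le> K / M\<^sup>2" using M(1) by (simp add: pos_le_divide_eq)
    then show ?thesis by (simp only: M_def)
  qed
qed

text \<open>
  One coordinate of the simple random walk in dimension \<open>D\<close> moves only with probability \<open>1 / D\<close>. At 0,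
  where the half-space has been reached, truncated subtraction makes 0 its own left neighbour.
\<close>

definition lazy_avg :: "real \<Rightarrow> (nat \<Rightarrow> real) \<Rightarrow> nat \<Rightarrow> real" where
  "lazy_avg D u m = ((D - 1) * u m + (u (Suc m) + u (m - 1)) / 2) / D"

lemma lazy_avg_mono: "D \<ge> 1 \<Longrightarrow> (\<And>m. u m \<le> v m) \<Longrightarrow> lazy_avg D u m \<le> lazy_avg D v m"
  unfolding lazy_avg_def by (intro divide_right_mono add_mono mult_left_mono) auto

lemma lazy_avg_const: "D \<ge> 1 \<Longrightarrow> lazy_avg D (\<lambda>_. a) m = a"
  by (simp add: lazy_avg_def field_simps)

context offspring_law
begin

text \<open>
  The probability that the tree of a particle at distance \<open>m\<close> from a half-space reaches it within \<open>n\<close>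
  generations.
\<close>

primrec half_space_hit :: "real \<Rightarrow> nat \<Rightarrow> nat \<Rightarrow> real" where
  "half_space_hit D 0 = (\<lambda>m. if m = 0 then 1 else 0)"
| "half_space_hit D (Suc n) = (\<lambda>m. if m = 0 then 1 else 1 - gf (1 - lazy_avg D (half_space_hit D n) m))"

context
  fixes D :: real
  assumes D: "D \<ge> 1"
begin

lemma half_space_hit_0: "half_space_hit D n 0 = 1"
  by (cases n) auto

lemma half_space_hit_bounds: "0 \<le> half_space_hit D n m \<and> half_space_hit D n m \<le> 1"
proof (induction n arbitrary: m)
  case (Suc n)
  have "0 \<le> lazy_avg D (half_space_hit D n) m" "lazy_avg D (half_space_hit D n) m \<le> 1"
    using lazy_avg_mono[OF D, of "\<lambda>_. 0" "half_space_hit D n" m]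
      lazy_avg_mono[OF D, of "half_space_hit D n" "\<lambda>_. 1" m] Suc
    by (simp_all add: lazy_avg_const[OF D])
  then show ?case by (auto intro: gf_nonneg gf_le_1)
qed simp

lemma lazy_avg_half_space_01:
  "0 \<le> lazy_avg D (half_space_hit D n) m" "lazy_avg D (half_space_hit D n) m \<le> 1"
  using lazy_avg_mono[OF D, of "\<lambda>_. 0" "half_space_hit D n" m]
    lazy_avg_mono[OF D, of "half_space_hit D n" "\<lambda>_. 1" m] half_space_hit_bounds
  by (simp_all add: lazy_avg_const[OF D])

lemma half_space_hit_mono: "half_space_hit D n m \<le> half_space_hit D (Suc n) m"
proof (induction n arbitrary: m)
  case 0
  then show ?case using half_space_hit_bounds[of "Suc 0" m] by auto
next
  case (Suc n)
  have "gf (1 - lazy_avg D (half_space_hit D (Suc n)) m) \<le> gf (1 - lazy_avg D (half_space_hit D n) m)"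
    using lazy_avg_mono[OF D, of "half_space_hit D n" "half_space_hit D (Suc n)" m] Suc lazy_avg_half_space_01[of n m] lazy_avg_half_space_01[of "Suc n" m]
    by (intro gf_mono) (auto simp del: half_space_hit.simps)
  then show ?case by (simp only: half_space_hit.simps) simp
qed

lemma half_space_hit_antimono: "half_space_hit D n (Suc m) \<le> half_space_hit D n m"
proof (induction n arbitrary: m)
  case (Suc n)
  show ?case
  proof (cases "m = 0")
    case True
    then show ?thesis using half_space_hit_bounds[of "Suc n" "Suc m"] half_space_hit_0[of "Suc n"] by simp
  next
    case False
    then have "lazy_avg D (half_space_hit D n) (Suc m) \<le> lazy_avg D (half_space_hit D n) m"
      unfolding lazy_avg_def using D Suc[of m] Suc[of "Suc m"] Suc[of "m - 1"]
      by (intro divide_right_mono add_mono mult_left_mono) auto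
    then have "gf (1 - lazy_avg D (half_space_hit D n) m) \<le> gf (1 - lazy_avg D (half_space_hit D n) (Suc m))"
      using lazy_avg_half_space_01 by (intro gf_mono) auto
    then show ?thesis using False by simp
  qed
qed auto

text \<open>
  For finite \<open>n\<close> the equation links generations \<open>n\<close> and \<open>n + 1\<close>; monotonicity in \<open>n\<close> turns it into an
  inequality for a single function, in the direction that \<open>quadratic_decay\<close> needs.
\<close>

lemma half_space_hit_convex:
  "half_space_hit D n (Suc (Suc m)) + half_space_hit D n m - 2 * half_space_hit D n (Suc m)
    \<ge> (2 * D * branch_prob) * (half_space_hit D n (Suc m))\<^sup>2"
proof -
  let ?v = "half_space_hit D n"
  define L where "L = lazy_avg D ?v (Suc m)"
  have L: "0 \<le> L" "L \<le> 1" using lazy_avg_half_space_01 by (auto simp: L_def)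
  have "?v (Suc m) \<le> 1 - gf (1 - L)"
    using half_space_hit_mono[of n "Suc m"] by (simp add: L_def)
  also have "\<dots> \<le> L - branch_prob * L\<^sup>2"
    using gf_excess[of L] L by simp
  finally have *: "?v (Suc m) \<le> L - branch_prob * L\<^sup>2" .
  moreover have "0 \<le> branch_prob * L\<^sup>2" using branch_prob_pos by simp
  ultimately have "?v (Suc m) \<le> L" by linarith
  then have "(?v (Suc m))\<^sup>2 \<le> L\<^sup>2" using half_space_hit_bounds by (intro power_mono) auto
  then have "branch_prob * (?v (Suc m))\<^sup>2 \<le> branch_prob * L\<^sup>2"
    using branch_prob_pos by simp
  with * have "branch_prob * (?v (Suc m))\<^sup>2 \<le> L - ?v (Suc m)" by simp
  also have "L - ?v (Suc m) = (?v (Suc (Suc m)) + ?v m - 2 * ?v (Suc m)) / (2 * D)"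
    using D by (simp add: L_def lazy_avg_def field_simps)
  finally show ?thesis using D by (simp add: field_simps)
qed

lemma half_space_hit_le:
  "half_space_hit D n m \<le> max 16 (256 / (2 * D * branch_prob)) / (real m + 1)\<^sup>2"
proof (rule quadratic_decay)
  show "2 * D * branch_prob > 0" using D branch_prob_pos by simp
qed (use half_space_hit_bounds half_space_hit_antimono half_space_hit_convex in auto)

end

text \<open>
  A set that is contained in a half-space is harder to hit than the half-space.
\<close>

lemma hit_le_half_space:
  fixes A :: "(int ^ 'd) set"
  assumes A: "\<And>x. x \<in> A \<Longrightarrow> \<sigma> * x $ i \<le> r" and \<sigma>: "\<sigma> = 1 \<or> \<sigma> = - 1"
  shows "(if z \<in> A then 1 else 1 - gf (avoid A n z)) \<le> half_space_hit (real CARD('d)) n (nat (\<sigma> * z $ i - r))"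
proof (induction n arbitrary: z)
  case 0
  then show ?case using A[of z] by auto
next
  case (Suc n)
  let ?D = "real CARD('d)"
  have D: "?D \<ge> 1" by (simp add: Suc_leI)
  let ?h = "\<lambda>y. if y \<in> A then 1 else 1 - gf (avoid A n y)"
  let ?u = "\<lambda>y::int ^ 'd. half_space_hit ?D n (nat (\<sigma> * y $ i - r))"
  define m where "m = nat (\<sigma> * z $ i - r)"
  show ?case
  proof (cases "z \<in> A \<or> m = 0")
    case True
    then have "m = 0" using A[of z] by (auto simp: m_def)
    then show ?thesis
      unfolding m_def[symmetric] using gf_nonneg[OF avoid_nonneg avoid_le_1, of A "Suc n" z]
      by (auto simp del: avoid.simps)
  next
    case False
    have "avg ?u z = lazy_avg ?D (half_space_hit ?D n) m"
    proof -
      define g where "g e = ?u (z + e)" for e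
      have pos: "\<sigma> * z $ i - r = int m" "m \<ge> 1" using False by (auto simp: m_def)
      have "g (axis j 1) + g (axis j (- 1)) =
        (if j = i then half_space_hit ?D n (Suc m) + half_space_hit ?D n (m - 1)
          else 2 * half_space_hit ?D n m)" for j
      proof (cases "j = i")
        case True
        have "nat (int m + 1) = Suc m" "nat (int m - 1) = m - 1" using pos by auto
        then show ?thesis using \<sigma> pos True
          unfolding g_def by (auto simp: axis_def algebra_simps)
      next
        case False
        then show ?thesis using pos by (simp add: g_def axis_def)
      qed
      then have "(\<Sum>e\<in>lattice_neighbors. g e) = (\<Sum>j\<in>UNIV.
         (if j = i then half_space_hit ?D n (Suc m) + half_space_hit ?D n (m - 1)
          else 2 * half_space_hit ?D n m))"
        by (simp add: sum_lattice_neighbors)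
      also have "\<dots> = half_space_hit ?D n (Suc m) + half_space_hit ?D n (m - 1)
          + (?D - 1) * (2 * half_space_hit ?D n m)"
        by (subst sum.remove[of _ i]) (simp_all add: of_nat_diff Suc_leI)
      finally have s: "(\<Sum>e\<in>lattice_neighbors. g e) = half_space_hit ?D n (Suc m) + half_space_hit ?D n (m - 1)
          + (?D - 1) * (2 * half_space_hit ?D n m)" .
      show ?thesis
        unfolding avg_eq_sum g_def[symmetric] s card_lattice_neighbors lazy_avg_def
        by (simp add: field_simps)
    qed
    moreover have "avg ?h z \<le> avg ?u z" by (rule avg_mono) (rule Suc.IH)
    moreover have "avoid A (Suc n) z = 1 - avg ?h z"
      unfolding avg_one_minus[symmetric] avoid.simps by (rule arg_cong2[of _ _ _ _ avg]) auto
    ultimately have "1 - lazy_avg ?D (half_space_hit ?D n) m \<le> avoid A (Suc n) z" by simp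
    then have "gf (1 - lazy_avg ?D (half_space_hit ?D n) m) \<le> gf (avoid A (Suc n) z)"
      using lazy_avg_half_space_01[OF D] avoid_le_1 by (intro gf_mono) (auto simp del: avoid.simps)
    then show ?thesis
      unfolding m_def[symmetric] using False by (simp del: avoid.simps)
  qed
qed

end

definition linf :: "int ^ 'd \<Rightarrow> int" where
  "linf z = Max (range (\<lambda>i. \<bar>z $ i\<bar>))"

lemma linf_ge: "\<bar>z $ i\<bar> \<le> linf z"
  unfolding linf_def by (rule Max_ge) auto

lemma linf_attained: "\<exists>i. linf z = \<bar>z $ i\<bar>"
proof -
  have "linf z \<in> range (\<lambda>i. \<bar>z $ i\<bar>)" unfolding linf_def by (rule Max_in) auto
  then show ?thesis by auto
qed

lemma linf_le_iff: "linf z \<le> r \<longleftrightarrow> (\<forall>i. \<bar>z $ i\<bar> \<le> r)"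
  unfolding linf_def by (subst Max_le_iff) auto

lemma linf_neighbor:
  assumes "e \<in> lattice_neighbors"
  shows "\<bar>linf (z + e) - linf z\<bar> \<le> 1"
proof -
  have *: "\<bar>e $ i\<bar> \<le> 1" for i
    using assms by (auto simp: lattice_neighbors_def axis_def)
  have a: "linf (z + e) \<le> linf z + 1"
    unfolding linf_le_iff
  proof
    fix i show "\<bar>(z + e) $ i\<bar> \<le> linf z + 1" using *[of i] linf_ge[of z i] by simp
  qed
  have b: "linf z \<le> linf (z + e) + 1"
    unfolding linf_le_iff
  proof
    fix i show "\<bar>z $ i\<bar> \<le> linf (z + e) + 1" using *[of i] linf_ge[of "z + e" i] by simp
  qed
  show ?thesis using a b by linarith
qed

lemma box_eq_image: "{z :: int ^ 'd. linf z \<le> r} = vec_lambda ` (PiE UNIV (\<lambda>_. {- r..r}))"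
proof (rule set_eqI)
  fix z :: "int ^ 'd"
  have "vec_nth (vec_lambda x) = x" for x :: "'d \<Rightarrow> int"
    by (rule ext) simp
  then have "z \<in> vec_lambda ` (PiE UNIV (\<lambda>_. {- r..r})) \<longleftrightarrow> vec_nth z \<in> PiE UNIV (\<lambda>_. {- r..r})"
    by (auto simp: image_iff intro!: bexI[of _ "vec_nth z"])
  also have "\<dots> \<longleftrightarrow> (\<forall>i. \<bar>z $ i\<bar> \<le> r)" by (auto simp: PiE_UNIV_domain abs_le_iff minus_le_iff)
  finally show "z \<in> {z. linf z \<le> r} \<longleftrightarrow> z \<in> vec_lambda ` (PiE UNIV (\<lambda>_. {- r..r}))"
    by (simp add: linf_le_iff)
qed

lemma finite_box: "finite {z :: int ^ 'd. linf z \<le> r}"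
  unfolding box_eq_image by (intro finite_imageI finite_PiE) auto

lemma card_box_le: "r \<ge> 0 \<Longrightarrow> real (card {z :: int ^ 'd. linf z \<le> r}) \<le> (2 * real_of_int r + 1) ^ CARD('d)"
proof -
  assume r: "r \<ge> 0"
  have "card {z :: int ^ 'd. linf z \<le> r} \<le> card (PiE (UNIV :: 'd set) (\<lambda>_. {- r..r}))"
    unfolding box_eq_image by (rule card_image_le) (auto intro!: finite_PiE)
  also have "\<dots> = nat (2 * r + 1) ^ CARD('d)"
    by (subst card_PiE) (auto simp: algebra_simps)
  finally have "card {z :: int ^ 'd. linf z \<le> r} \<le> nat (2 * r + 1) ^ CARD('d)" .
  then have "real (card {z :: int ^ 'd. linf z \<le> r}) \<le> real (nat (2 * r + 1)) ^ CARD('d)"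
    by (metis of_nat_le_iff of_nat_power)
  then show ?thesis using r by simp
qed

context offspring_law
begin

text \<open>
  The set lies in a half-space that is bounded by the coordinate in which \<open>z\<close> is farthest away, so a
  single half-space suffices when distances are measured in the maximum norm.
\<close>

lemma hit_le:
  fixes A :: "(int ^ 'd) set"
  assumes A: "\<And>x. x \<in> A \<Longrightarrow> linf x \<le> r" and z: "linf z \<ge> r"
  shows "hit A z \<le> max 16 (256 / (2 * real CARD('d) * branch_prob)) / (real_of_int (linf z - r) + 1)\<^sup>2"
    (is "_ \<le> ?K / _")
proof -
  obtain i where i: "linf z = \<bar>z $ i\<bar>" using linf_attained by blast
  define \<sigma> :: int where "\<sigma> = (if z $ i \<ge> 0 then 1 else - 1)"
  have \<sigma>: "\<sigma> = 1 \<or> \<sigma> = - 1" "\<sigma> * z $ i = linf z" by (auto simp: \<sigma>_def i)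
  have A': "\<sigma> * x $ i \<le> r" if "x \<in> A" for x
    using A[OF that] linf_ge[of x i] \<sigma>(1) by auto
  have "(if z \<in> A then 1 else 1 - gf (avoid A n z)) \<le> ?K / (real_of_int (linf z - r) + 1)\<^sup>2" for n
  proof -
    have "(if z \<in> A then 1 else 1 - gf (avoid A n z)) \<le> half_space_hit (real CARD('d)) n (nat (linf z - r))"
      using hit_le_half_space[of A \<sigma> i r z n] A' \<sigma> by auto
    also have "\<dots> \<le> ?K / (real (nat (linf z - r)) + 1)\<^sup>2"
      by (rule half_space_hit_le) (simp add: Suc_leI)
    finally show ?thesis using z by simp
  qed
  moreover have "(\<lambda>n. if z \<in> A then 1 else 1 - gf (avoid A n z)) \<longlonglongrightarrow> hit A z"
    unfolding hit_def by (auto intro!: tendsto_intros gf_avoid_tendsto)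
  ultimately show ?thesis by (intro LIMSEQ_le_const2) auto
qed

end

section \<open>Sums over edges\<close>

definition edge_sum :: "(int ^ 'd \<Rightarrow> int ^ 'd \<Rightarrow> real) \<Rightarrow> real" where
  "edge_sum F = (\<Sum>e\<in>lattice_neighbors. lsum (\<lambda>z. F z (z + e)))"

definition fin_edges :: "(int ^ 'd \<Rightarrow> int ^ 'd \<Rightarrow> real) \<Rightarrow> bool" where
  "fin_edges F \<longleftrightarrow> (\<forall>e\<in>lattice_neighbors. fin_supp (\<lambda>z. F z (z + e)))"

lemma fin_edges_left: "fin_supp f \<Longrightarrow> fin_edges (\<lambda>x y. f x * G x y)"
  unfolding fin_edges_def by (auto intro: fin_supp_mult1)

lemma fin_edges_right: "fin_supp f \<Longrightarrow> fin_edges (\<lambda>x y. f y * G x y)"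
  unfolding fin_edges_def by (auto intro: fin_supp_mult1 fin_supp_translate)

lemma fin_edges_mono:
  "fin_edges G \<Longrightarrow> (\<And>x y. F x y \<noteq> 0 \<Longrightarrow> G x y \<noteq> 0) \<Longrightarrow> fin_edges F"
  unfolding fin_edges_def by (auto elim!: fin_supp_mono)

lemma fin_edges_add: "fin_edges F \<Longrightarrow> fin_edges G \<Longrightarrow> fin_edges (\<lambda>x y. F x y + G x y)"
  unfolding fin_edges_def by (auto intro: fin_supp_add)

lemma fin_edges_cmult: "fin_edges F \<Longrightarrow> fin_edges (\<lambda>x y. c * F x y)"
  by (erule fin_edges_mono) auto

lemma edge_sum_swap: "edge_sum (\<lambda>x y. F y x) = edge_sum F"
proof -
  have "lsum (\<lambda>z. F (z + e) z) = lsum (\<lambda>z. F z (z + - e))" for e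
    using lsum_translate[of "\<lambda>z. F z (z + - e)" e] by simp
  then have "edge_sum (\<lambda>x y. F y x) = (\<Sum>e\<in>lattice_neighbors. lsum (\<lambda>z. F z (z + - e)))"
    by (simp add: edge_sum_def)
  also have "\<dots> = edge_sum F"
    unfolding edge_sum_def by (rule sum_neighbors_uminus)
  finally show ?thesis .
qed

lemma edge_sum_add: "fin_edges F \<Longrightarrow> fin_edges G \<Longrightarrow> edge_sum (\<lambda>x y. F x y + G x y) = edge_sum F + edge_sum G"
  unfolding edge_sum_def fin_edges_def by (simp add: lsum_add sum.distrib)

lemma edge_sum_diff: "fin_edges F \<Longrightarrow> fin_edges G \<Longrightarrow> edge_sum (\<lambda>x y. F x y - G x y) = edge_sum F - edge_sum G"
  unfolding edge_sum_def fin_edges_def by (simp add: lsum_diff sum_subtractf)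

lemma edge_sum_cmult: "edge_sum (\<lambda>x y. c * F x y) = c * edge_sum F"
  unfolding edge_sum_def by (simp add: lsum_cmult sum_distrib_left)

lemma edge_sum_mono:
  assumes "fin_edges F" "fin_edges G" "\<And>x e. e \<in> lattice_neighbors \<Longrightarrow> F x (x + e) \<le> G x (x + e)"
  shows "edge_sum F \<le> edge_sum G"
  unfolding edge_sum_def using assms unfolding fin_edges_def by (intro sum_mono lsum_mono) auto

lemma edge_sum_le_card:
  fixes B :: "(int ^ 'd) set"
  assumes "finite B" "fin_edges F" and c: "c \<ge> 0"
    and le: "\<And>x e. e \<in> lattice_neighbors \<Longrightarrow> F x (x + e) \<le> (if x \<in> B then c else 0)"
  shows "edge_sum F \<le> 2 * real CARD('d) * real (card B) * c"
proof -
  have fs: "fin_supp (\<lambda>z. if z \<in> B then c else 0)" by (rule fin_supp_on[OF assms(1)]) simp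
  have "edge_sum F \<le> (\<Sum>e\<in>(lattice_neighbors :: (int ^ 'd) set). lsum (\<lambda>z. if z \<in> B then c else 0))"
    unfolding edge_sum_def
  proof (intro sum_mono lsum_mono)
    fix e :: "int ^ 'd" assume "e \<in> lattice_neighbors"
    then show "fin_supp (\<lambda>z. F z (z + e))" using assms(2) by (auto simp: fin_edges_def)
  qed (use le fs in auto)
  also have "lsum (\<lambda>z. if z \<in> B then c else 0) = real (card B) * c"
    by (subst lsum_on[OF assms(1)]) auto
  finally show ?thesis by (simp add: card_lattice_neighbors)
qed

lemma edge_sum_laplacian:
  fixes f u :: "int ^ 'd \<Rightarrow> real"
  assumes "fin_supp f"
  shows "edge_sum (\<lambda>x y. f x * (u x - u y)) = 2 * real CARD('d) * lsum (\<lambda>z. f z * (u z - avg u z))"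
proof -
  have "edge_sum (\<lambda>x y. f x * (u x - u y)) = lsum (\<lambda>z. \<Sum>e\<in>lattice_neighbors. f z * (u z - u (z + e)))"
    unfolding edge_sum_def by (subst lsum_sum) (auto intro: fin_supp_mult1 assms)
  also have "\<dots> = lsum (\<lambda>z. (2 * real CARD('d)) * (f z * (u z - avg u z)))"
  proof (intro arg_cong[of _ _ lsum] ext)
    fix z
    have "(\<Sum>e\<in>lattice_neighbors. f z * (u z - u (z + e)))
        = f z * (\<Sum>e\<in>lattice_neighbors. u z - u (z + e))"
      by (simp add: sum_distrib_left)
    also have "(\<Sum>e\<in>lattice_neighbors. u z - u (z + e)) = 2 * real CARD('d) * (u z - avg u z)"
      by (simp add: sum_subtractf avg_eq_sum card_lattice_neighbors field_simps)
    finally show "(\<Sum>e\<in>lattice_neighbors. f z * (u z - u (z + e))) = (2 * real CARD('d)) * (f z * (u z - avg u z))"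
      by simp
  qed
  finally show ?thesis by (simp only: lsum_cmult)
qed

text \<open>
  The discrete Leibniz rule behind Caccioppoli's inequality; twice the difference of the two sides is a sum
  of two squares.
\<close>

lemma caccioppoli_edge:
  fixes a b \<alpha> \<beta> :: real
  shows "(\<alpha>\<^sup>2 + \<beta>\<^sup>2) * (b - a)\<^sup>2 \<le> 4 * ((\<alpha>\<^sup>2 * a - \<beta>\<^sup>2 * b) * (a - b)) + 2 * ((\<alpha> - \<beta>)\<^sup>2 * (a + b)\<^sup>2)"
proof -
  have "0 \<le> ((\<alpha> + \<beta>) * (a - b) + 2 * ((\<alpha> - \<beta>) * (a + b)))\<^sup>2 + (\<alpha> - \<beta>)\<^sup>2 * (a - b)\<^sup>2"
    by simp
  then show ?thesis
    by (simp add: power2_eq_square algebra_simps)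
qed

text \<open>
  Testing \<open>u \<le> avg u\<close> against \<open>\<zeta>\<^sup>2 u\<close> bounds the gradient of \<open>u\<close> by its size on the set where the cutoff
  \<open>\<zeta>\<close> varies.
\<close>

lemma caccioppoli:
  fixes u \<zeta> :: "int ^ 'd \<Rightarrow> real" and B :: "(int ^ 'd) set"
  assumes sub: "\<And>z. \<zeta> z \<noteq> 0 \<Longrightarrow> u z \<le> avg u z" and nonneg: "\<And>z. 0 \<le> u z"
    and lip: "\<And>z e. e \<in> lattice_neighbors \<Longrightarrow> \<bar>\<zeta> (z + e) - \<zeta> z\<bar> \<le> L"
    and bound: "\<And>z e. e \<in> lattice_neighbors \<Longrightarrow> \<zeta> (z + e) \<noteq> \<zeta> z \<Longrightarrow> z \<in> B \<and> u z \<le> K \<and> u (z + e) \<le> K"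
    and fin: "fin_supp \<zeta>" "finite B"
  shows "edge_sum (\<lambda>x y. ((\<zeta> x)\<^sup>2 + (\<zeta> y)\<^sup>2) * (u y - u x)\<^sup>2) \<le> 16 * real CARD('d) * real (card B) * L\<^sup>2 * K\<^sup>2"
proof -
  define f where "f x = (\<zeta> x)\<^sup>2 * u x" for x
  have fs: "fin_supp (\<lambda>x. (\<zeta> x)\<^sup>2)" using fin(1) by (rule fin_supp_mono) auto
  have ff: "fin_supp f" unfolding f_def by (rule fin_supp_mult1[OF fs])
  have e1: "fin_edges (\<lambda>x y. f x * (u x - u y))" by (rule fin_edges_left[OF ff])
  have e2: "fin_edges (\<lambda>x y. f y * (u y - u x))" by (rule fin_edges_right[OF ff])
  have e3: "fin_edges (\<lambda>x y. (\<zeta> x - \<zeta> y)\<^sup>2 * (u x + u y)\<^sup>2)"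
  proof (rule fin_edges_mono)
    show "fin_edges (\<lambda>x y. (\<zeta> x)\<^sup>2 * 1 + (\<zeta> y)\<^sup>2 * 1)"
      by (intro fin_edges_add fin_edges_left[OF fs] fin_edges_right[OF fs])
    fix x y assume "(\<zeta> x - \<zeta> y)\<^sup>2 * (u x + u y)\<^sup>2 \<noteq> 0"
    then show "(\<zeta> x)\<^sup>2 * 1 + (\<zeta> y)\<^sup>2 * 1 \<noteq> 0" by (auto simp: sum_power2_eq_zero_iff)
  qed
  have e4: "fin_edges (\<lambda>x y. ((\<zeta> x)\<^sup>2 + (\<zeta> y)\<^sup>2) * (u y - u x)\<^sup>2)"
    unfolding distrib_right by (intro fin_edges_add fin_edges_left[OF fs] fin_edges_right[OF fs])
  have e12: "fin_edges (\<lambda>x y. 4 * (f x * (u x - u y) + f y * (u y - u x)))"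
    by (intro fin_edges_cmult fin_edges_add e1 e2)
  have "edge_sum (\<lambda>x y. ((\<zeta> x)\<^sup>2 + (\<zeta> y)\<^sup>2) * (u y - u x)\<^sup>2)
      \<le> edge_sum (\<lambda>x y. 4 * (f x * (u x - u y) + f y * (u y - u x)) + 2 * ((\<zeta> x - \<zeta> y)\<^sup>2 * (u x + u y)\<^sup>2))"
  proof (rule edge_sum_mono[OF e4 fin_edges_add[OF e12 fin_edges_cmult[OF e3]]])
    fix x e
    show "((\<zeta> x)\<^sup>2 + (\<zeta> (x + e))\<^sup>2) * (u (x + e) - u x)\<^sup>2
       \<le> 4 * (f x * (u x - u (x + e)) + f (x + e) * (u (x + e) - u x)) + 2 * ((\<zeta> x - \<zeta> (x + e))\<^sup>2 * (u x + u (x + e))\<^sup>2)"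
      using caccioppoli_edge[of "\<zeta> x" "\<zeta> (x + e)" "u (x + e)" "u x"] by (simp add: f_def algebra_simps)
  qed
  also have "\<dots> = 4 * (edge_sum (\<lambda>x y. f x * (u x - u y)) + edge_sum (\<lambda>x y. f y * (u y - u x)))
      + 2 * edge_sum (\<lambda>x y. (\<zeta> x - \<zeta> y)\<^sup>2 * (u x + u y)\<^sup>2)"
    by (simp only: edge_sum_add[OF e12 fin_edges_cmult[OF e3]] edge_sum_cmult edge_sum_add[OF e1 e2])
  also have "edge_sum (\<lambda>x y. f y * (u y - u x)) = edge_sum (\<lambda>x y. f x * (u x - u y))"
    by (rule edge_sum_swap)
  also have "edge_sum (\<lambda>x y. f x * (u x - u y)) = - (2 * real CARD('d) * lsum (\<lambda>z. f z * (avg u z - u z)))"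
    unfolding edge_sum_laplacian[OF ff] using lsum_cmult[of "- 1" "\<lambda>z. f z * (avg u z - u z)"]
    by (simp add: algebra_simps)
  also have "lsum (\<lambda>z. f z * (avg u z - u z)) \<ge> 0"
  proof (rule lsum_nonneg)
    fix z show "0 \<le> f z * (avg u z - u z)"
      using sub[of z] nonneg[of z] by (cases "\<zeta> z = 0") (auto simp: f_def)
  qed
  then have "4 * (- (2 * real CARD('d) * lsum (\<lambda>z. f z * (avg u z - u z))) + - (2 * real CARD('d) * lsum (\<lambda>z. f z * (avg u z - u z))))
      + 2 * edge_sum (\<lambda>x y. (\<zeta> x - \<zeta> y)\<^sup>2 * (u x + u y)\<^sup>2)
      \<le> 2 * edge_sum (\<lambda>x y. (\<zeta> x - \<zeta> y)\<^sup>2 * (u x + u y)\<^sup>2)"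
    by simp
  also have "\<dots> \<le> 2 * (2 * real CARD('d) * real (card B) * (L\<^sup>2 * (2 * K)\<^sup>2))"
  proof (intro mult_left_mono edge_sum_le_card[OF fin(2) e3])
    fix x e :: "int ^ 'd" assume e: "e \<in> lattice_neighbors"
    show "(\<zeta> x - \<zeta> (x + e))\<^sup>2 * (u x + u (x + e))\<^sup>2 \<le> (if x \<in> B then L\<^sup>2 * (2 * K)\<^sup>2 else 0)"
    proof (cases "\<zeta> (x + e) = \<zeta> x")
      case False
      from bound[OF e False] have b: "x \<in> B" "u x \<le> K" "u (x + e) \<le> K" by auto
      have "(\<zeta> x - \<zeta> (x + e))\<^sup>2 = \<bar>\<zeta> (x + e) - \<zeta> x\<bar>\<^sup>2" by (simp add: power2_commute)
      also have "\<dots> \<le> L\<^sup>2" using lip[OF e, of x] by (intro power_mono) auto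
      finally have "(\<zeta> x - \<zeta> (x + e))\<^sup>2 \<le> L\<^sup>2" .
      moreover have "(u x + u (x + e))\<^sup>2 \<le> (2 * K)\<^sup>2" using b nonneg[of x] nonneg[of "x + e"]
        by (intro power_mono) auto
      ultimately have "(\<zeta> x - \<zeta> (x + e))\<^sup>2 * (u x + u (x + e))\<^sup>2 \<le> L\<^sup>2 * (2 * K)\<^sup>2"
        by (rule mult_mono) auto
      then show ?thesis using b by simp
    qed simp
  qed auto
  also have "\<dots> = 16 * real CARD('d) * real (card B) * L\<^sup>2 * K\<^sup>2" by (simp add: power_mult_distrib)
  finally show ?thesis by simp
qed

section \<open>The upper bound on the capacity\<close>

definition clamp01 :: "real \<Rightarrow> real" where
  "clamp01 t = max 0 (min 1 t)"

lemma clamp01_lipschitz: "\<bar>clamp01 s - clamp01 t\<bar> \<le> \<bar>s - t\<bar>"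
  by (auto simp: clamp01_def)

context offspring_law
begin

definition capacity :: "(int ^ 'd) set \<Rightarrow> real" where
  "capacity A = (\<Sum>x\<in>A. escape_lim A x)"

text \<open>
  Off \<open>A\<close> the two products cancel since both functions solve \<open>u = survive * avg u\<close>; on \<open>A\<close> the first
  function is 1 and the second one vanishes.
\<close>

lemma capacity_eq_pairing:
  fixes A :: "(int ^ 'd) set"
  assumes "finite A" "\<And>x. x \<in> A \<Longrightarrow> \<eta> x = 1"
  defines "w \<equiv> \<lambda>z. survive A z * escape_lim A z"
  shows "capacity A = lsum (\<lambda>z. \<eta> z * (hit A z * avg w z - w z * avg (hit A) z))"
proof -
  have w: "avg w = escape_lim A" unfolding w_def by (rule ext) (rule escape_lim_fixed[symmetric])
  have "lsum (\<lambda>z. \<eta> z * (hit A z * avg w z - w z * avg (hit A) z))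
      = (\<Sum>z\<in>A. \<eta> z * (hit A z * avg w z - w z * avg (hit A) z))"
  proof (rule lsum_on[OF assms(1)])
    fix z assume "z \<notin> A"
    then show "\<eta> z * (hit A z * avg w z - w z * avg (hit A) z) = 0"
      unfolding w by (simp add: hit_eq w_def)
  qed
  also have "\<dots> = capacity A"
    unfolding capacity_def
  proof (rule sum.cong[OF refl])
    fix x assume "x \<in> A"
    then have "hit A x = 1" "\<eta> x = 1" "w x = 0"
      using assms(2) by (simp_all add: hit_on w_def survive_def)
    then show "\<eta> x * (hit A x * avg w x - w x * avg (hit A) x) = escape_lim A x"
      unfolding w by simp
  qed
  finally show ?thesis ..
qed

text \<open>
  With \<open>R = 4 r\<close> the box has of the order of \<open>R ^ d\<close> points, so that the bound is of order \<open>r ^ (d - 4)\<close>.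
  Symmetrising \<open>capacity_eq_pairing\<close> over the two ends of an edge leaves
  \<open>(\<eta> x - \<eta> y) (h x (w y - w x) - w x (h y - h x))\<close>.
\<close>

lemma capacity_le_box:
  fixes A :: "(int ^ 'd) set"
  assumes A: "\<And>x. x \<in> A \<Longrightarrow> linf x \<le> int r" and r: "r \<ge> 1"
  defines "K \<equiv> max 16 (256 / (2 * real CARD('d) * branch_prob))"
  shows "capacity A \<le> 36 * K * real (card {z :: int ^ 'd. linf z \<le> 6 * int (4 * r)}) / real (4 * r) ^ 4"
proof -
  define R where "R = real (4 * r)"
  define H where "H = 4 * K / R\<^sup>2"
  define g where "g z = real_of_int (linf z) / R" for z :: "int ^ 'd"
  (* The cutoff eta varies where 2 <= g <= 3, and zeta is 1 in a neighbourhood of this annulus.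
     H bounds the hitting probability where zeta does not vanish and at all neighbours. *)
  define \<eta> where "\<eta> z = clamp01 (3 - g z)" for z
  define \<zeta> where "\<zeta> z = clamp01 (min (2 * g z - 2) (5 - g z))" for z
  define B where "B = {z :: int ^ 'd. linf z \<le> 6 * int (4 * r)}"
  define w where "w z = survive A z * escape_lim A z" for z
  define h where "h = hit A"
  define D where "D = real CARD('d)"
  have D: "D \<ge> 1" by (simp add: D_def Suc_leI)
  have R: "R \<ge> 4" "real r = R / 4" using r by (auto simp: R_def)
  have K: "K \<ge> 16" by (simp add: K_def)
  have H: "H > 0" using K R by (simp add: H_def)
  have finA: "finite A" by (rule finite_subset[OF _ finite_box[of "int r"]]) (use A in auto)
  have finB: "finite B" unfolding B_def by (rule finite_box)
  have lin: "real_of_int (linf z) = g z * R" for z using R by (simp add: g_def)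
  have inB: "z \<in> B" if "g z \<le> 6" for z
  proof -
    have "real_of_int (linf z) \<le> 6 * R" using that R by (simp add: lin)
    then have "real_of_int (linf z) \<le> real_of_int (6 * int (4 * r))" by (simp add: R_def)
    then show ?thesis unfolding B_def by (simp only: of_int_le_iff mem_Collect_eq)
  qed
  have g_lip: "\<bar>g (z + e) - g z\<bar> \<le> 1 / R" if "e \<in> lattice_neighbors" for z e
  proof -
    have "\<bar>real_of_int (linf (z + e)) - real_of_int (linf z)\<bar> \<le> 1"
      using linf_neighbor[OF that, of z] by linarith
    then show ?thesis using R by (simp add: g_def diff_divide_distrib[symmetric] abs_divide divide_right_mono)
  qed
  have R4: "1 / R \<le> 1 / 4" using R by (simp add: field_simps)
  have hH: "h z \<le> H" if "g z \<ge> 3 / 4" for z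
  proof -
    have *: "real_of_int (linf z) - real r \<ge> R / 2"
      using that R mult_right_mono[of "3 / 4" "g z" R] unfolding lin by linarith
    then have "real_of_int (linf z - int r) + 1 \<ge> R / 2" by simp
    then have "K / (real_of_int (linf z - int r) + 1)\<^sup>2 \<le> K / (R / 2)\<^sup>2"
      using K R by (intro divide_left_mono power_mono) auto
    moreover have "linf z \<ge> int r" using * R by linarith
    ultimately have "h z \<le> K / (R / 2)\<^sup>2"
      unfolding h_def K_def using hit_le[of A "int r" z] A by force
    then show ?thesis by (simp add: H_def power_divide mult.commute)
  qed
  have h0: "0 \<le> h z" "h z \<le> 1" for z by (auto simp: h_def hit_nonneg hit_le_1)
  have w0: "0 \<le> w z" "w z \<le> 1" for z
    by (auto simp: w_def survive_nonneg escape_lim_nonneg survive_le_1 escape_lim_le_1 mult_le_one)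
  have fs\<eta>: "fin_supp \<eta>"
  proof (rule fin_supp_on[OF finB])
    fix z assume "z \<notin> B"
    then have "g z > 6" using inB[of z] by linarith
    then show "\<eta> z = 0" by (simp add: \<eta>_def clamp01_def)
  qed
  have fs\<zeta>: "fin_supp \<zeta>"
  proof (rule fin_supp_on[OF finB])
    fix z assume "z \<notin> B"
    then have "g z > 6" using inB[of z] by linarith
    then show "\<zeta> z = 0" by (simp add: \<zeta>_def clamp01_def)
  qed
  have \<zeta>_pos: "1 < g z \<and> g z < 5" if "\<zeta> z \<noteq> 0" for z
    using that by (auto simp: \<zeta>_def clamp01_def split: if_splits)
  have \<zeta>_lip: "\<bar>\<zeta> (z + e) - \<zeta> z\<bar> \<le> 2 / R" if "e \<in> lattice_neighbors" for z e
  proof -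
    have "\<bar>\<zeta> (z + e) - \<zeta> z\<bar> \<le> \<bar>min (2 * g (z + e) - 2) (5 - g (z + e)) - min (2 * g z - 2) (5 - g z)\<bar>"
      unfolding \<zeta>_def by (rule clamp01_lipschitz)
    also have "\<dots> \<le> 2 * \<bar>g (z + e) - g z\<bar>" unfolding min_def abs_if by auto
    finally show ?thesis using g_lip[OF that, of z] by simp
  qed
  have \<zeta>_edge: "g z > 3 / 4 \<and> g (z + e) > 3 / 4 \<and> z \<in> B"
    if "e \<in> lattice_neighbors" "\<zeta> (z + e) \<noteq> \<zeta> z" for z e
  proof -
    have "\<zeta> z \<noteq> 0 \<or> \<zeta> (z + e) \<noteq> 0" using that by auto
    then have "(1 < g z \<and> g z < 5) \<or> (1 < g (z + e) \<and> g (z + e) < 5)" using \<zeta>_pos by blast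
    then have "g z > 3 / 4 \<and> g (z + e) > 3 / 4 \<and> g z \<le> 6"
      using g_lip[OF that(1), of z] R4 by linarith
    then show ?thesis using inB by blast
  qed
  have \<eta>_edge: "\<zeta> z = 1 \<and> \<zeta> (z + e) = 1 \<and> z \<in> B \<and> g z \<ge> 3 / 4"
    if "e \<in> lattice_neighbors" "\<eta> (z + e) \<noteq> \<eta> z" for z e
  proof -
    have "\<not> (g z \<le> 2 \<and> g (z + e) \<le> 2)" "\<not> (g z \<ge> 3 \<and> g (z + e) \<ge> 3)"
      using that(2) by (auto simp: \<eta>_def clamp01_def)
    then have "3 / 2 \<le> g z" "3 / 2 \<le> g (z + e)" "g z \<le> 4" "g (z + e) \<le> 4"
      using g_lip[OF that(1), of z] R4 by linarith+
    then show ?thesis using inB[of z] by (simp add: \<zeta>_def clamp01_def)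
  qed
  have \<eta>_lip: "\<bar>\<eta> x - \<eta> (x + e)\<bar> \<le> 1 / R" if "e \<in> lattice_neighbors" for x e
    using clamp01_lipschitz[of "3 - g x" "3 - g (x + e)"] g_lip[OF that, of x] by (simp add: \<eta>_def)
  have sub_w: "w z \<le> avg w z" for z
  proof -
    have "avg w z = escape_lim A z" unfolding w_def by (rule escape_lim_fixed[symmetric])
    then show ?thesis
      using survive_le_1[of A z] escape_lim_nonneg[of A z] by (simp add: w_def mult_left_le_one_le survive_nonneg)
  qed
  have sub_h: "h z \<le> avg h z" if "\<zeta> z \<noteq> 0" for z
  proof -
    have "g z * R > 1 * R" using \<zeta>_pos[OF that] R by (intro mult_strict_right_mono) auto
    then have "linf z > int r" using R by (simp add: lin[symmetric])
    then have "z \<notin> A" using A[of z] by auto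
    then show ?thesis unfolding h_def using hit_eq[of z A] survive_le_1[of A z] hit_nonneg[of A]
      by (simp add: mult_left_le_one_le survive_nonneg avg_nonneg)
  qed
  have cw: "edge_sum (\<lambda>x y. ((\<zeta> x)\<^sup>2 + (\<zeta> y)\<^sup>2) * (w y - w x)\<^sup>2) \<le> 16 * D * real (card B) * (2 / R)\<^sup>2 * 1\<^sup>2"
    unfolding D_def using sub_w w0 \<zeta>_lip \<zeta>_edge fs\<zeta> finB by (intro caccioppoli) auto
  have ch: "edge_sum (\<lambda>x y. ((\<zeta> x)\<^sup>2 + (\<zeta> y)\<^sup>2) * (h y - h x)\<^sup>2) \<le> 16 * D * real (card B) * (2 / R)\<^sup>2 * H\<^sup>2"
    unfolding D_def using sub_h h0 \<zeta>_lip \<zeta>_edge fs\<zeta> finB hH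
    by (intro caccioppoli) (auto intro!: hH dest: \<zeta>_edge)
  define F where "F x y = h x * w y - w x * h y" for x y
  have "capacity A = lsum (\<lambda>z. \<eta> z * (h z * avg w z - w z * avg h z))"
    unfolding h_def w_def
  proof (rule capacity_eq_pairing[OF finA])
    fix x assume "x \<in> A"
    then have "real_of_int (linf x) \<le> real r" using A[of x] by simp
    then have "g x \<le> 1 / 4" using R by (simp add: g_def field_simps)
    then show "\<eta> x = 1" by (simp add: \<eta>_def clamp01_def)
  qed
  also have "\<dots> = lsum (\<lambda>z. (\<eta> z * w z) * (h z - avg h z)) - lsum (\<lambda>z. (\<eta> z * h z) * (w z - avg w z))"
    by (subst lsum_diff[symmetric], (intro fin_supp_mult1 fs\<eta>)+) (simp add: algebra_simps)
  finally have "capacity A = lsum (\<lambda>z. (\<eta> z * w z) * (h z - avg h z)) - lsum (\<lambda>z. (\<eta> z * h z) * (w z - avg w z))" .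
  then have "2 * D * capacity A = edge_sum (\<lambda>x y. (\<eta> x * w x) * (h x - h y)) - edge_sum (\<lambda>x y. (\<eta> x * h x) * (w x - w y))"
    unfolding edge_sum_laplacian[OF fin_supp_mult1[OF fs\<eta>, of w]] edge_sum_laplacian[OF fin_supp_mult1[OF fs\<eta>, of h]]
      D_def by (simp only: right_diff_distrib)
  also have "\<dots> = edge_sum (\<lambda>x y. \<eta> x * F x y)"
    by (subst edge_sum_diff[symmetric], (intro fin_edges_left fin_supp_mult1 fs\<eta>)+)
       (simp add: F_def algebra_simps)
  finally have c1: "2 * D * capacity A = edge_sum (\<lambda>x y. \<eta> x * F x y)" .
  have "edge_sum (\<lambda>x y. \<eta> x * F x y) = edge_sum (\<lambda>x y. \<eta> y * F y x)"
    by (rule edge_sum_swap[symmetric])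
  with c1 have "4 * D * capacity A = edge_sum (\<lambda>x y. \<eta> x * F x y) + edge_sum (\<lambda>x y. \<eta> y * F y x)"
    by simp
  also have "\<dots> = edge_sum (\<lambda>x y. \<eta> x * F x y + \<eta> y * F y x)"
    by (rule edge_sum_add[symmetric]) (intro fin_edges_left fin_edges_right fs\<eta>)+
  finally have c2: "4 * D * capacity A = edge_sum (\<lambda>x y. \<eta> x * F x y + \<eta> y * F y x)" .
  define G where "G x y = (if \<eta> y = \<eta> x then 0 else H / R)" for x y
  have fe\<zeta>: "fin_edges (\<lambda>x y. ((\<zeta> x)\<^sup>2 + (\<zeta> y)\<^sup>2) * (u y - u x)\<^sup>2)" for u :: "int ^ 'd \<Rightarrow> real"
  proof -
    have fs: "fin_supp (\<lambda>x. (\<zeta> x)\<^sup>2)" using fs\<zeta> by (rule fin_supp_mono) auto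
    show ?thesis
      unfolding distrib_right by (intro fin_edges_add fin_edges_left[OF fs] fin_edges_right[OF fs])
  qed
  have feG: "fin_edges G"
  proof (rule fin_edges_mono)
    show "fin_edges (\<lambda>x y. \<bar>\<eta> x\<bar> * 1 + \<bar>\<eta> y\<bar> * 1)"
      by (intro fin_edges_add fin_edges_left fin_edges_right fin_supp_mono[OF fs\<eta>]) auto
  qed (auto simp: G_def split: if_splits)
  have le: "\<eta> x * F x (x + e) + \<eta> (x + e) * F (x + e) x \<le> 1 / R * (G x (x + e)
      + (H * R / 4) * (((\<zeta> x)\<^sup>2 + (\<zeta> (x + e))\<^sup>2) * (w (x + e) - w x)\<^sup>2)
      + (R / (4 * H)) * (((\<zeta> x)\<^sup>2 + (\<zeta> (x + e))\<^sup>2) * (h (x + e) - h x)\<^sup>2))"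
    if e: "e \<in> lattice_neighbors" for x e
  proof -
    let ?y = "x + e"
    have eq: "\<eta> x * F x ?y + \<eta> ?y * F ?y x = (\<eta> x - \<eta> ?y) * (h x * (w ?y - w x) - w x * (h ?y - h x))"
      by (simp add: F_def algebra_simps)
    show ?thesis
    proof (cases "\<eta> ?y = \<eta> x")
      case True
      have "\<eta> x * F x ?y + \<eta> ?y * F ?y x = 0" unfolding eq using True by simp
      also have "0 \<le> 1 / R * (G x (x + e)
      + (H * R / 4) * (((\<zeta> x)\<^sup>2 + (\<zeta> (x + e))\<^sup>2) * (w (x + e) - w x)\<^sup>2)
      + (R / (4 * H)) * (((\<zeta> x)\<^sup>2 + (\<zeta> (x + e))\<^sup>2) * (h (x + e) - h x)\<^sup>2))"
        using H R by (intro mult_nonneg_nonneg add_nonneg_nonneg) (auto simp: G_def)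
      finally show ?thesis .
    next
      case False
      from \<eta>_edge[OF e False] have z: "\<zeta> x = 1" "\<zeta> ?y = 1" "h x \<le> H" using hH by auto
      define a where "a = \<bar>w ?y - w x\<bar>"
      define b where "b = \<bar>h ?y - h x\<bar>"
      have "\<bar>h x * (w ?y - w x) - w x * (h ?y - h x)\<bar> \<le> h x * a + w x * b"
        using abs_triangle_ineq4[of "h x * (w ?y - w x)" "w x * (h ?y - h x)"] h0[of x] w0[of x]
        by (simp add: abs_mult a_def b_def)
      also have "\<dots> \<le> H * a + 1 * b"
        using z w0[of x] by (intro add_mono mult_right_mono) (auto simp: a_def b_def)
      (* Two inequalities between arithmetic and geometric means, with weights that balance the
         gradient bounds: a is typically of order 1 / R, and b of order H / R. *)
      also have "\<dots> \<le> H / R + (H * R / 2) * a\<^sup>2 + (R / (2 * H)) * b\<^sup>2"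
      proof -
        have "0 \<le> (H / (2 * R)) * (R * a - 1)\<^sup>2" using H R by simp
        then have 1: "H * a \<le> H / (2 * R) + (H * R / 2) * a\<^sup>2"
          using R by (simp add: power2_eq_square field_simps)
        have "0 \<le> (H / (2 * R)) * (R / H * b - 1)\<^sup>2" using H R by simp
        also have "\<dots> = (R / (2 * H)) * b\<^sup>2 - b + H / (2 * R)"
          using R H by (simp add: power2_eq_square field_simps)
        finally have 2: "b \<le> H / (2 * R) + (R / (2 * H)) * b\<^sup>2" by simp
        have "H / (2 * R) + H / (2 * R) = H / R" using R by simp
        with 1 2 show ?thesis by linarith
      qed
      finally have ab: "\<bar>h x * (w ?y - w x) - w x * (h ?y - h x)\<bar> \<le> H / R + (H * R / 2) * a\<^sup>2 + (R / (2 * H)) * b\<^sup>2" .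
      have "\<eta> x * F x ?y + \<eta> ?y * F ?y x \<le> \<bar>\<eta> x - \<eta> ?y\<bar> * \<bar>h x * (w ?y - w x) - w x * (h ?y - h x)\<bar>"
        unfolding eq abs_mult[symmetric] by simp
      also have "\<dots> \<le> 1 / R * (H / R + (H * R / 2) * a\<^sup>2 + (R / (2 * H)) * b\<^sup>2)"
        using \<eta>_lip[OF e, of x] ab R by (intro mult_mono) auto
      also have "\<dots> = 1 / R * (G x ?y
        + (H * R / 4) * (((\<zeta> x)\<^sup>2 + (\<zeta> ?y)\<^sup>2) * (w ?y - w x)\<^sup>2)
        + (R / (4 * H)) * (((\<zeta> x)\<^sup>2 + (\<zeta> ?y)\<^sup>2) * (h ?y - h x)\<^sup>2))"
        using False z by (simp add: G_def a_def b_def)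
      finally show ?thesis .
    qed
  qed
  have "4 * D * capacity A \<le> edge_sum (\<lambda>x y. 1 / R * (G x y
      + (H * R / 4) * (((\<zeta> x)\<^sup>2 + (\<zeta> y)\<^sup>2) * (w y - w x)\<^sup>2)
      + (R / (4 * H)) * (((\<zeta> x)\<^sup>2 + (\<zeta> y)\<^sup>2) * (h y - h x)\<^sup>2)))"
    unfolding c2
  proof (rule edge_sum_mono)
    show "fin_edges (\<lambda>x y. \<eta> x * F x y + \<eta> y * F y x)"
      by (intro fin_edges_add fin_edges_left fin_edges_right fs\<eta>)
    show "fin_edges (\<lambda>x y. 1 / R * (G x y
      + (H * R / 4) * (((\<zeta> x)\<^sup>2 + (\<zeta> y)\<^sup>2) * (w y - w x)\<^sup>2)
      + (R / (4 * H)) * (((\<zeta> x)\<^sup>2 + (\<zeta> y)\<^sup>2) * (h y - h x)\<^sup>2)))"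
      by (intro fin_edges_cmult fin_edges_add feG fe\<zeta>)
  qed (rule le)
  also have "\<dots> = 1 / R * (edge_sum G
      + (H * R / 4) * edge_sum (\<lambda>x y. ((\<zeta> x)\<^sup>2 + (\<zeta> y)\<^sup>2) * (w y - w x)\<^sup>2)
      + (R / (4 * H)) * edge_sum (\<lambda>x y. ((\<zeta> x)\<^sup>2 + (\<zeta> y)\<^sup>2) * (h y - h x)\<^sup>2))"
    unfolding edge_sum_cmult
    by (subst edge_sum_add, (intro fin_edges_add fin_edges_cmult feG fe\<zeta>)+,
        subst edge_sum_add, (intro fin_edges_add fin_edges_cmult feG fe\<zeta>)+)
       (simp only: edge_sum_cmult)
  also have "\<dots> \<le> 1 / R * (2 * D * real (card B) * (H / R)
      + (H * R / 4) * (16 * D * real (card B) * (2 / R)\<^sup>2 * 1\<^sup>2)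
      + (R / (4 * H)) * (16 * D * real (card B) * (2 / R)\<^sup>2 * H\<^sup>2))"
  proof (intro mult_left_mono add_mono cw ch)
    show "edge_sum G \<le> 2 * D * real (card B) * (H / R)"
      unfolding D_def
    proof (rule edge_sum_le_card[OF finB feG])
      fix x e :: "int ^ 'd" assume "e \<in> lattice_neighbors"
      then show "G x (x + e) \<le> (if x \<in> B then H / R else 0)"
        using \<eta>_edge[of e x] H R by (auto simp: G_def)
    qed (use H R in auto)
  qed (use H R in auto)
  also have "\<dots> = 34 * D * real (card B) * H / R\<^sup>2"
    using R H by (simp add: power2_eq_square field_simps)
  finally have "capacity A \<le> 34 * real (card B) * H / R\<^sup>2 / 4"
    using D R by (simp add: field_simps)
  also have "\<dots> \<le> 36 * K * real (card B) / R ^ 4"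
    using R K by (simp add: H_def power2_eq_square power4_eq_xxxx field_simps mult_right_mono)
  finally show ?thesis unfolding B_def R_def .
qed

end

section \<open>The lower bound on the capacity\<close>

text \<open>
  The Green potential of \<open>\<nu>\<close> for the walk up to time \<open>M\<close>.
\<close>

primrec green :: "(int ^ 'd \<Rightarrow> real) \<Rightarrow> nat \<Rightarrow> int ^ 'd \<Rightarrow> real" where
  "green \<nu> 0 = \<nu>"
| "green \<nu> (Suc M) = (\<lambda>z. \<nu> z + avg (green \<nu> M) z)"

lemma fin_supp_cmult: "fin_supp u \<Longrightarrow> fin_supp (\<lambda>z. c * u z)"
  by (erule fin_supp_mono) auto

context offspring_law
begin

lemma capacity_nonneg: "0 \<le> capacity A"
  unfolding capacity_def by (intro sum_nonneg escape_lim_nonneg)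

text \<open>
  The transition operator of the killed walk. Its iterates on the indicator of \<open>A\<close> give the law of the
  time of the first visit to \<open>A\<close>.
\<close>

definition step_avoiding :: "(int ^ 'd) set \<Rightarrow> (int ^ 'd \<Rightarrow> real) \<Rightarrow> int ^ 'd \<Rightarrow> real" where
  "step_avoiding A u z = survive A z * avg u z"

lemma fin_supp_step_avoiding_iter:
  assumes "finite A"
  shows "fin_supp ((step_avoiding A ^^ n) (indicator A))"
proof (induction n)
  case 0
  then show ?case using fin_supp_on[OF assms, of "indicator A"] by simp
next
  case (Suc n)
  then show ?case unfolding funpow.simps comp_def step_avoiding_def[abs_def]
    by (intro fin_supp_mult2 fin_supp_avg)
qed

text \<open>
  Time reversal: the operator \<open>avg\<close> is symmetric, so that the killed walk that starts anywhere and reaches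
  \<open>A\<close> after \<open>n\<close> steps becomes the one that leaves \<open>A\<close> and survives \<open>n\<close> steps. The induction moves the
  factors one by one from the iterate to \<open>escape\<close>, so \<open>k\<close> has to be general.
\<close>

lemma lsum_escape_step_avoiding:
  assumes "finite A"
  shows "lsum (\<lambda>z. escape A k z * (step_avoiding A ^^ n) (indicator A) z) = (\<Sum>x\<in>A. escape A (k + n) x)"
proof (induction n arbitrary: k)
  case 0
  then show ?case using lsum_on[OF assms, of "\<lambda>z. escape A k z * indicator A z"] by (simp add: indicator_def)
next
  case (Suc n)
  let ?u = "(step_avoiding A ^^ n) (indicator A)"
  have "lsum (\<lambda>z. escape A k z * (step_avoiding A ^^ Suc n) (indicator A) z)
      = lsum (\<lambda>z. (survive A z * escape A k z) * avg ?u z)"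
    by (simp add: step_avoiding_def mult_ac)
  also have "\<dots> = lsum (\<lambda>z. avg (\<lambda>y. survive A y * escape A k y) z * ?u z)"
    by (rule lsum_avg_swap) (use fin_supp_step_avoiding_iter[OF assms] in auto)
  also have "\<dots> = (\<Sum>x\<in>A. escape A (Suc k + n) x)"
    using Suc.IH[of "Suc k"] by simp
  finally show ?case by simp
qed

lemma capacity_tendsto: "finite A \<Longrightarrow> (\<lambda>n. \<Sum>x\<in>A. escape A n x) \<longlonglongrightarrow> capacity A"
  unfolding capacity_def by (intro tendsto_sum escape_tendsto)

text \<open>
  Iterating the inequality expresses \<open>p\<close> through the discounted first visit times, whose sum over the
  lattice is \<open>\<Sum>n. \<kappa> ^ n * (\<Sum>x\<in>A. escape A n x)\<close> by time reversal. All but \<open>N0\<close> summands are at most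
  \<open>\<kappa> ^ n * b\<close>.
\<close>

lemma sum_le_of_subsolution:
  fixes A :: "(int ^ 'd) set" and p :: "int ^ 'd \<Rightarrow> real"
  assumes finA: "finite A" and le: "\<And>z. p z \<le> indicator A z + \<kappa> * (survive A z * avg p z)"
    and p1: "\<And>z. p z \<le> 1" and \<kappa>: "0 \<le> \<kappa>" "\<kappa> < 1"
    and B: "finite B" and N0: "\<And>n. n \<ge> N0 \<Longrightarrow> (\<Sum>x\<in>A. escape A n x) \<le> b"
  shows "(\<Sum>z\<in>B. p z) \<le> real N0 * real (card A) + b / (1 - \<kappa>)"
proof -
  let ?T = "\<lambda>n. (step_avoiding A ^^ n) (indicator A)"
  have T0: "0 \<le> ?T n z" for n z
    by (induction n arbitrary: z) (auto simp: step_avoiding_def intro!: mult_nonneg_nonneg survive_nonneg avg_nonneg)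
  have b0: "0 \<le> b"
    by (rule order_trans[OF _ N0[OF order_refl]]) (intro sum_nonneg escape_nonneg)
  (* The remainder is at most kappa ^ N because p is at most 1. *)
  have Q: "p z \<le> (\<Sum>n<N. \<kappa> ^ n * ?T n z) + \<kappa> ^ N" for N z
  proof (induction N arbitrary: z)
    case 0
    then show ?case using p1 by simp
  next
    case (Suc N)
    have "avg p z \<le> avg (\<lambda>z. (\<Sum>n<N. \<kappa> ^ n * ?T n z) + \<kappa> ^ N) z"
      by (rule avg_mono) (rule Suc)
    also have "\<dots> = (\<Sum>n<N. \<kappa> ^ n * avg (?T n) z) + \<kappa> ^ N"
      by (simp add: avg_add avg_sum avg_cmult)
    finally have "survive A z * avg p z \<le> survive A z * ((\<Sum>n<N. \<kappa> ^ n * avg (?T n) z) + \<kappa> ^ N)"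
      by (rule mult_left_mono) (rule survive_nonneg)
    also have "\<dots> = (\<Sum>n<N. \<kappa> ^ n * ?T (Suc n) z) + survive A z * \<kappa> ^ N"
      by (simp add: step_avoiding_def distrib_left sum_distrib_left mult_ac)
    also have "survive A z * \<kappa> ^ N \<le> 1 * \<kappa> ^ N"
      using survive_le_1 \<kappa> by (intro mult_right_mono) auto
    finally have "\<kappa> * (survive A z * avg p z) \<le> \<kappa> * ((\<Sum>n<N. \<kappa> ^ n * ?T (Suc n) z) + \<kappa> ^ N)"
      using \<kappa> by (intro mult_left_mono) auto
    then have "p z \<le> indicator A z + (\<Sum>n<N. \<kappa> ^ Suc n * ?T (Suc n) z) + \<kappa> ^ Suc N"
      using le[of z] by (simp add: distrib_left sum_distrib_left mult_ac)
    then show ?case by (subst sum.lessThan_Suc_shift) simp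
  qed
  have bound: "(\<Sum>z\<in>B. p z) \<le> (real N0 * real (card A) + b / (1 - \<kappa>)) + \<kappa> ^ N * real (card B)" for N
  proof -
    have "(\<Sum>z\<in>B. p z) \<le> (\<Sum>z\<in>B. (\<Sum>n<N. \<kappa> ^ n * ?T n z) + \<kappa> ^ N)"
      by (intro sum_mono Q)
    also have "\<dots> = (\<Sum>n<N. \<kappa> ^ n * (\<Sum>z\<in>B. ?T n z)) + \<kappa> ^ N * real (card B)"
    proof -
      have "(\<Sum>z\<in>B. \<Sum>n<N. \<kappa> ^ n * ?T n z) = (\<Sum>n<N. \<Sum>z\<in>B. \<kappa> ^ n * ?T n z)"
        by (rule sum.swap)
      also have "\<dots> = (\<Sum>n<N. \<kappa> ^ n * (\<Sum>z\<in>B. ?T n z))"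
        by (intro sum.cong refl) (simp only: sum_distrib_left)
      finally show ?thesis by (simp add: sum.distrib mult.commute)
    qed
    also have "(\<Sum>n<N. \<kappa> ^ n * (\<Sum>z\<in>B. ?T n z)) \<le> (\<Sum>n<N. (if n < N0 then real (card A) else 0) + \<kappa> ^ n * b)"
    proof (rule sum_mono)
      fix n
      have "(\<Sum>z\<in>B. ?T n z) \<le> lsum (?T n)"
        unfolding lsum_def using B T0 fin_supp_summable[OF fin_supp_step_avoiding_iter[OF finA]]
        by (intro finite_sum_le_infsum) auto
      also have "\<dots> = (\<Sum>x\<in>A. escape A n x)"
        using lsum_escape_step_avoiding[OF finA, of 0 n] by simp
      finally have 1: "\<kappa> ^ n * (\<Sum>z\<in>B. ?T n z) \<le> \<kappa> ^ n * (\<Sum>x\<in>A. escape A n x)"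
        using \<kappa> by (intro mult_left_mono) auto
      show "\<kappa> ^ n * (\<Sum>z\<in>B. ?T n z) \<le> (if n < N0 then real (card A) else 0) + \<kappa> ^ n * b"
      proof (cases "n < N0")
        case True
        have "(\<Sum>x\<in>A. escape A n x) \<le> (\<Sum>x\<in>A. 1)" by (intro sum_mono escape_le_1)
        then have "\<kappa> ^ n * (\<Sum>x\<in>A. escape A n x) \<le> 1 * real (card A)"
          using \<kappa> by (intro mult_mono) (auto intro!: power_le_one sum_nonneg escape_nonneg)
        moreover have "0 \<le> \<kappa> ^ n * b" using \<kappa> b0 by simp
        ultimately show ?thesis using 1 True by simp
      next
        case False
        then have "\<kappa> ^ n * (\<Sum>x\<in>A. escape A n x) \<le> \<kappa> ^ n * b"
          using N0[of n] \<kappa> by (intro mult_left_mono) auto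
        then show ?thesis using 1 False by simp
      qed
    qed
    also have "\<dots> = real (card ({..<N} \<inter> {n. n < N0})) * real (card A) + b * (\<Sum>n<N. \<kappa> ^ n)"
    proof -
      have "(\<Sum>n<N. if n < N0 then real (card A) else 0) = real (card ({..<N} \<inter> {n. n < N0})) * real (card A)"
        by (simp add: sum.If_cases)
      moreover have "(\<Sum>n<N. \<kappa> ^ n * b) = b * (\<Sum>n<N. \<kappa> ^ n)"
        by (simp only: sum_distrib_left mult.commute)
      ultimately show ?thesis by (simp only: sum.distrib)
    qed
    also have "\<dots> \<le> real N0 * real (card A) + b * (1 / (1 - \<kappa>))"
    proof (intro add_mono mult_right_mono mult_left_mono)
      have "card ({..<N} \<inter> {n. n < N0}) \<le> card {..<N0}" by (rule card_mono) auto
      then show "real (card ({..<N} \<inter> {n. n < N0})) \<le> real N0" by simp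
      have "(\<Sum>n<N. \<kappa> ^ n) = (1 - \<kappa> ^ N) / (1 - \<kappa>)" using \<kappa> by (simp add: sum_gp_strict)
      also have "\<dots> \<le> 1 / (1 - \<kappa>)" using \<kappa> by (intro divide_right_mono) auto
      finally show "(\<Sum>n<N. \<kappa> ^ n) \<le> 1 / (1 - \<kappa>)" .
    qed (use b0 in auto)
    finally show ?thesis by simp
  qed
  have "(\<lambda>N. (real N0 * real (card A) + b / (1 - \<kappa>)) + \<kappa> ^ N * real (card B))
      \<longlonglongrightarrow> (real N0 * real (card A) + b / (1 - \<kappa>)) + 0 * real (card B)"
    using \<kappa> by (intro tendsto_intros LIMSEQ_realpow_zero) auto
  then show ?thesis
    by (intro LIMSEQ_le_const[where a = "\<Sum>z\<in>B. p z"]) (use bound in auto)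
qed

subsection \<open>Killed trees\<close>

text \<open>
  Keep each vertex with probability \<open>s / gf s\<close>. Then \<open>s\<close> is the probability that a whole tree is kept,
  and the event that it is kept and hits \<open>A\<close> has a probability which solves
  \<open>p = killed_step (avg p)\<close> off \<open>A\<close>. The offspring mean of a kept tree is \<open>1 - O(1 - s)\<close>, and by
  \<open>slope_gap\<close> the function \<open>p\<close> is a subsolution for the walk with additional killing of the same order
  \<open>1 - s\<close>. That these two orders agree is what makes the lower bound sharp up to a constant.
\<close>

context
  fixes s :: real
  assumes s: "1 / 2 \<le> s" "s < 1"
begin

definition killed_step :: "real \<Rightarrow> real" where
  "killed_step y = s / gf s * (gf s - gf (s - y))"

lemma gf_s: "s \<le> gf s" "0 < gf s" "s / gf s \<le> 1" "0 < s / gf s"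
  using gf_ge_self[of s] s by auto

lemma killed_step_mono: "0 \<le> x \<Longrightarrow> x \<le> y \<Longrightarrow> y \<le> s \<Longrightarrow> killed_step x \<le> killed_step y"
  unfolding killed_step_def using gf_s(4) s by (intro mult_left_mono diff_left_mono gf_mono) auto

lemma killed_step_0 [simp]: "killed_step 0 = 0"
  by (simp add: killed_step_def)

lemma killed_step_eq: "killed_step y = s - s / gf s * gf (s - y)"
  using gf_s by (simp add: killed_step_def right_diff_distrib)

lemma killed_step_le: "0 \<le> y \<Longrightarrow> y \<le> s \<Longrightarrow> killed_step y \<le> s"
  using gf_s gf_nonneg[of "s - y"] s unfolding killed_step_eq by simp

text \<open>
  Second order expansion at 0; the factor 3 collects twice \<open>1 - s\<close> from the slope and once \<open>1 - s\<close> from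
  the probability to keep the root.
\<close>

lemma killed_step_lower:
  assumes y: "0 \<le> y" "y \<le> s"
  shows "(1 - 3 * second_moment * (1 - s)) * y - second_moment * y\<^sup>2 \<le> killed_step y"
proof -
  let ?C = second_moment and ?e = "1 - s"
  have e: "0 < ?e" "?e \<le> 1 / 2" using s by auto
  have C: "?C > 0" by (rule second_moment_pos)
  have sl: "1 - ?C * (2 * ?e + y) \<le> slope (s - y) s"
    using slope_lower[of "s - y" s] y s by (simp add: algebra_simps)
  have sl1: "slope (s - y) s \<le> 1" "0 \<le> slope (s - y) s"
    using y s by (auto intro!: slope_le_1 slope_nonneg)
  have "gf s - s = ?e * (1 - slope s 1)"
    using gf_diff[of s 1] s by (simp add: algebra_simps)
  also have "\<dots> \<le> ?e * (?C * ?e)"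
    using slope_lower[of s 1] s by (intro mult_left_mono) (auto simp: algebra_simps)
  finally have gs: "gf s - s \<le> ?C * ?e * ?e" by (simp only: mult_ac)
  have "1 - s / gf s = (gf s - s) / gf s" using gf_s by (simp add: field_simps)
  also have "\<dots> \<le> (gf s - s) / (1 / 2)"
    using gf_s(1,2) s by (intro divide_left_mono) auto
  also have "\<dots> \<le> 2 * (?C * ?e * ?e)" using gs by simp
  also have "\<dots> \<le> ?C * ?e"
    using e C mult_left_mono[of ?e "1 / 2" "2 * (?C * ?e)"] by simp
  finally have k: "1 - s / gf s \<le> ?C * ?e" .
  have "(1 - s / gf s) * slope (s - y) s \<le> (?C * ?e) * 1"
    using k sl1 gf_s(3) C e by (intro mult_mono) auto
  then have "s / gf s * slope (s - y) s \<ge> 1 - ?C * (2 * ?e + y) - ?C * ?e"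
    using sl by (simp add: algebra_simps)
  then have "y * (s / gf s * slope (s - y) s) \<ge> y * (1 - 3 * ?C * ?e - ?C * y)"
    using y by (intro mult_left_mono) (auto simp: algebra_simps)
  moreover have "killed_step y = y * (s / gf s * slope (s - y) s)"
    unfolding killed_step_def using gf_diff[of "s - y" s] y s by simp
  ultimately show ?thesis by (simp add: power2_eq_square algebra_simps)
qed

context
  fixes A :: "(int ^ 'd) set"
  assumes finA: "finite A"
begin

primrec killed_hit :: "nat \<Rightarrow> int ^ 'd \<Rightarrow> real" where
  "killed_hit 0 = (\<lambda>z. if z \<in> A then s else 0)"
| "killed_hit (Suc M) = (\<lambda>z. if z \<in> A then s else killed_step (avg (killed_hit M) z))"

definition killed_hit_lim :: "int ^ 'd \<Rightarrow> real" where
  "killed_hit_lim z = lim (\<lambda>M. killed_hit M z)"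

lemma killed_hit_bounds: "0 \<le> killed_hit M z \<and> killed_hit M z \<le> s"
proof (induction M arbitrary: z)
  case 0
  then show ?case using s by auto
next
  case (Suc M)
  then have "0 \<le> avg (killed_hit M) z" "avg (killed_hit M) z \<le> s"
    by (auto intro!: avg_nonneg avg_le)
  then show ?case
    using killed_step_mono[of 0 "avg (killed_hit M) z"] killed_step_le s by auto
qed

lemma avg_killed_hit_bounds: "0 \<le> avg (killed_hit M) z" "avg (killed_hit M) z \<le> s"
  using killed_hit_bounds by (auto intro!: avg_nonneg avg_le)

lemma killed_hit_mono: "killed_hit M z \<le> killed_hit (Suc M) z"
proof (induction M arbitrary: z)
  case 0
  then show ?case using killed_step_mono[of 0 "avg (killed_hit 0) z"] avg_killed_hit_bounds[of 0 z] by auto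
next
  case (Suc M)
  have "avg (killed_hit M) z \<le> avg (killed_hit (Suc M)) z" by (rule avg_mono) (rule Suc)
  then have "killed_step (avg (killed_hit M) z) \<le> killed_step (avg (killed_hit (Suc M)) z)"
    using avg_killed_hit_bounds[of M z] avg_killed_hit_bounds[of "Suc M" z] by (intro killed_step_mono)
  then show ?case by (simp only: killed_hit.simps) simp
qed

lemma killed_hit_tendsto: "(\<lambda>M. killed_hit M z) \<longlonglongrightarrow> killed_hit_lim z"
proof -
  have "incseq (\<lambda>M. killed_hit M z)" by (intro incseq_SucI killed_hit_mono)
  then have "convergent (\<lambda>M. killed_hit M z)"
    using incseq_bounded[of _ s] killed_hit_bounds by (intro Bseq_monoseq_convergent)
      (auto simp: incseq_imp_monoseq)
  then show ?thesis unfolding killed_hit_lim_def by (simp add: convergent_LIMSEQ_iff)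
qed

lemma killed_hit_le_lim: "killed_hit M z \<le> killed_hit_lim z"
  by (rule incseq_le[OF _ killed_hit_tendsto]) (intro incseq_SucI killed_hit_mono)

lemma killed_hit_lim_bounds: "0 \<le> killed_hit_lim z" "killed_hit_lim z \<le> s"
proof -
  show "0 \<le> killed_hit_lim z" using killed_hit_le_lim[of 0 z] killed_hit_bounds[of 0 z] by linarith
  show "killed_hit_lim z \<le> s"
    by (rule LIMSEQ_le_const2[OF killed_hit_tendsto]) (use killed_hit_bounds in auto)
qed

lemma avg_killed_hit_lim_bounds: "0 \<le> avg killed_hit_lim z" "avg killed_hit_lim z \<le> s"
  using killed_hit_lim_bounds by (auto intro!: avg_nonneg avg_le)

lemma killed_hit_lim_on: "z \<in> A \<Longrightarrow> killed_hit_lim z = s"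
proof -
  assume "z \<in> A"
  then have "(\<lambda>M. killed_hit M z) = (\<lambda>M. s)"
  proof (intro ext)
    fix M show "killed_hit M z = s" using \<open>z \<in> A\<close> by (cases M) auto
  qed
  then show ?thesis using killed_hit_tendsto[of z] by (simp add: LIMSEQ_const_iff)
qed

lemma killed_hit_lim_off:
  assumes "z \<notin> A"
  shows "killed_hit_lim z = killed_step (avg killed_hit_lim z)"
proof (rule LIMSEQ_unique)
  show "(\<lambda>M. killed_hit (Suc M) z) \<longlonglongrightarrow> killed_hit_lim z"
    by (rule LIMSEQ_Suc[OF killed_hit_tendsto])
  have "(\<lambda>M. gf (s - avg (killed_hit M) z)) \<longlonglongrightarrow> gf (s - avg killed_hit_lim z)"
  proof (rule continuous_on_tendsto_compose[OF continuous_on_gf])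
    show "(\<lambda>M. s - avg (killed_hit M) z) \<longlonglongrightarrow> s - avg killed_hit_lim z"
      by (intro tendsto_intros tendsto_avg killed_hit_tendsto)
    have *: "0 \<le> s - x \<and> s - x \<le> 1" if "0 \<le> x" "x \<le> s" for x using s that by auto
    show "s - avg killed_hit_lim z \<in> {0..1}"
      using *[OF avg_killed_hit_lim_bounds, of z] by auto
    show "\<forall>\<^sub>F M in sequentially. s - avg (killed_hit M) z \<in> {0..1}"
      using *[OF avg_killed_hit_bounds, of _ z] by auto
  qed
  then have "(\<lambda>M. killed_step (avg (killed_hit M) z)) \<longlonglongrightarrow> killed_step (avg killed_hit_lim z)"
    unfolding killed_step_def by (intro tendsto_intros)
  then show "(\<lambda>M. killed_hit (Suc M) z) \<longlonglongrightarrow> killed_step (avg killed_hit_lim z)"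
    using assms by simp
qed

text \<open>
  The event that a tree is kept and misses \<open>A\<close> is contained in the event that it misses \<open>A\<close>.
\<close>

lemma killed_avoid_le: "s - killed_hit_lim z \<le> 1 - hit A z"
proof -
  have "s - killed_hit_lim z \<le> (if z \<in> A then 0 else gf (avoid A n z))" for n
  proof (induction n arbitrary: z)
    case 0
    then show ?case using killed_hit_lim_on killed_hit_lim_bounds[of z] s by auto
  next
    case (Suc n)
    show ?case
    proof (cases "z \<in> A")
      case False
      have "avg (\<lambda>y. s - killed_hit_lim y) z \<le> avg (\<lambda>y. if y \<in> A then 0 else gf (avoid A n y)) z"
        by (rule avg_mono) (rule Suc)
      then have le: "s - avg killed_hit_lim z \<le> avoid A (Suc n) z" by (simp add: avg_diff)
      have "s - killed_hit_lim z = s / gf s * gf (s - avg killed_hit_lim z)"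
        unfolding killed_hit_lim_off[OF False] killed_step_eq by simp
      also have "\<dots> \<le> 1 * gf (s - avg killed_hit_lim z)"
        using avg_killed_hit_lim_bounds[of z] s by (intro mult_right_mono gf_s gf_nonneg) auto
      also have "\<dots> \<le> gf (avoid A (Suc n) z)"
        using le avg_killed_hit_lim_bounds[of z] avoid_le_1[of A "Suc n" z] by (simp add: gf_mono del: avoid.simps)
      finally show ?thesis using False by (simp del: avoid.simps)
    qed (use killed_hit_lim_on in auto)
  qed
  moreover have "(\<lambda>n. if z \<in> A then 0 else gf (avoid A n z)) \<longlonglongrightarrow> 1 - hit A z"
    unfolding hit_def by (auto intro!: tendsto_intros gf_avoid_tendsto)
  ultimately show ?thesis by (intro LIMSEQ_le_const) auto
qed

text \<open>
  The slope of the generating function at the kept trees that miss \<open>A\<close> is compared with the slope that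
  defines \<open>survive\<close>: the left end point is smaller by \<open>killed_avoid_le\<close>, and the right end point \<open>s\<close>
  instead of 1 gains \<open>branch_prob * (1 - s)\<close>.
\<close>

lemma killed_hit_subsolution:
  "killed_hit_lim z \<le> indicator A z + (1 - branch_prob * (1 - s)) * (survive A z * avg killed_hit_lim z)"
proof (cases "z \<in> A")
  case True
  then show ?thesis using killed_hit_lim_on s by (simp add: survive_def)
next
  case False
  define y where "y = avg killed_hit_lim z"
  have y: "0 \<le> y" "y \<le> s" using avg_killed_hit_lim_bounds by (auto simp: y_def)
  have "avg (\<lambda>y. s - killed_hit_lim y) z \<le> avg (\<lambda>y. 1 - hit A y) z"
    by (rule avg_mono) (rule killed_avoid_le)
  then have sy: "s - y \<le> avoid_lim A z" by (simp add: avg_diff avg_hit y_def)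
  have bs: "0 \<le> branch_prob * (1 - s)" using branch_prob_pos s by simp
  have "killed_step y \<le> 1 * (gf s - gf (s - y))"
    unfolding killed_step_def using y s by (intro mult_right_mono gf_s) (auto intro!: gf_mono)
  also have "\<dots> = y * slope (s - y) s"
    using gf_diff[of "s - y" s] y s by simp
  also have "\<dots> \<le> y * ((1 - branch_prob * (1 - s)) * survive A z)"
  proof (rule mult_left_mono[OF _ y(1)])
    have "slope (s - y) s \<le> slope (s - y) 1 - branch_prob * (1 - s)"
      using y s by (intro slope_gap) auto
    also have "slope (s - y) 1 \<le> survive A z"
      using False y s sy by (auto simp: survive_def intro!: slope_mono)
    also have "survive A z - branch_prob * (1 - s) \<le> (1 - branch_prob * (1 - s)) * survive A z"
      using bs survive_le_1[of A z] mult_left_le[of "survive A z" "branch_prob * (1 - s)"]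
      by (simp add: left_diff_distrib)
    finally show "slope (s - y) s \<le> (1 - branch_prob * (1 - s)) * survive A z" by simp
  qed
  finally show ?thesis
    using False killed_hit_lim_off[OF False] by (simp add: y_def mult_ac)
qed

context
  fixes \<nu> :: "int ^ 'd \<Rightarrow> real" and m :: real
  assumes \<nu>: "\<And>z. 0 \<le> \<nu> z" "\<And>z. z \<notin> A \<Longrightarrow> \<nu> z = 0"
    and m: "m = 1 - 3 * second_moment * (1 - s)" "0 \<le> m"
begin

text \<open>
  These play the role of the first two moments of the number of visits in the first \<open>M\<close> generations of a
  kept tree, where points are counted with weight \<open>\<nu>\<close>. The offspring law enters only through \<open>m\<close> and
  \<open>second_moment\<close>.
\<close>

primrec first_moment_bound :: "nat \<Rightarrow> int ^ 'd \<Rightarrow> real" where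
  "first_moment_bound 0 = \<nu>"
| "first_moment_bound (Suc M) = (\<lambda>z. \<nu> z + m * avg (first_moment_bound M) z)"

primrec second_moment_bound :: "nat \<Rightarrow> int ^ 'd \<Rightarrow> real" where
  "second_moment_bound 0 = (\<lambda>z. \<nu> z * first_moment_bound 0 z)"
| "second_moment_bound (Suc M) = (\<lambda>z. \<nu> z * first_moment_bound (Suc M) z
     + second_moment * (avg (first_moment_bound M) z)\<^sup>2 + m * avg (second_moment_bound M) z)"

lemma m_le_1: "m \<le> 1"
  using m s second_moment_pos by simp

lemma first_moment_nonneg: "0 \<le> first_moment_bound M z"
  by (induction M arbitrary: z) (auto intro!: add_nonneg_nonneg mult_nonneg_nonneg avg_nonneg \<nu> m)

lemma first_moment_le_green: "first_moment_bound M z \<le> green \<nu> M z"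
proof (induction M arbitrary: z)
  case (Suc M)
  have "m * avg (first_moment_bound M) z \<le> 1 * avg (first_moment_bound M) z"
    using m_le_1 by (intro mult_right_mono avg_nonneg first_moment_nonneg)
  also have "\<dots> \<le> avg (green \<nu> M) z" using avg_mono[OF Suc] by simp
  finally show ?case by simp
qed simp

lemma second_moment_bound_nonneg: "0 \<le> second_moment_bound M z"
  using second_moment_pos
  by (induction M arbitrary: z)
     (auto intro!: add_nonneg_nonneg mult_nonneg_nonneg avg_nonneg first_moment_nonneg \<nu> m
       simp del: first_moment_bound.simps)

text \<open>
  For the first moment \<open>U\<close> and the second moment \<open>V\<close> it follows that \<open>\<alpha> U - \<alpha>\<^sup>2 V \<le> 1 / 2 \<le> s\<close>, which is
  the boundary condition on \<open>A\<close> in the comparison below.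
\<close>

lemma first_moment_square_le: "(first_moment_bound M z)\<^sup>2 \<le> 2 * second_moment_bound M z"
proof (induction M arbitrary: z)
  case 0
  then show ?case by (simp add: power2_eq_square)
next
  case (Suc M)
  let ?U = "first_moment_bound M" and ?n = "\<nu> z" and ?a = "avg (first_moment_bound M) z"
  have a: "0 \<le> ?a" by (intro avg_nonneg first_moment_nonneg)
  have "m\<^sup>2 * ?a\<^sup>2 \<le> m * avg (\<lambda>y. (?U y)\<^sup>2) z"
    using avg_square_le[of ?U z] m m_le_1 by (intro mult_mono) (auto simp: power2_eq_square mult_left_le)
  also have "avg (\<lambda>y. (?U y)\<^sup>2) z \<le> avg (\<lambda>y. 2 * second_moment_bound M y) z"
    by (rule avg_mono) (rule Suc)
  then have "m * avg (\<lambda>y. (?U y)\<^sup>2) z \<le> m * (2 * avg (second_moment_bound M) z)"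
    using m(2) unfolding avg_cmult by (rule mult_left_mono)
  finally have 1: "m\<^sup>2 * ?a\<^sup>2 \<le> 2 * (m * avg (second_moment_bound M) z)" by simp
  have "(?n + m * ?a)\<^sup>2 = m\<^sup>2 * ?a\<^sup>2 + 2 * (?n * (?n + m * ?a)) - ?n\<^sup>2"
    by (simp add: power2_eq_square algebra_simps)
  also have "\<dots> \<le> 2 * (m * avg (second_moment_bound M) z) + 2 * (?n * (?n + m * ?a)) + 2 * (second_moment * ?a\<^sup>2)"
  proof -
    have "0 \<le> second_moment * ?a\<^sup>2" using second_moment_pos by simp
    moreover have "0 \<le> ?n\<^sup>2" by simp
    ultimately show ?thesis using 1 by linarith
  qed
  finally show ?case by simp
qed

lemma fin_supp_\<nu>: "fin_supp \<nu>"
  by (rule fin_supp_on[OF finA]) (rule \<nu>)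

lemma fin_supp_first_moment: "fin_supp (first_moment_bound M)"
proof (induction M)
  case (Suc M)
  show ?case
    unfolding first_moment_bound.simps
    by (rule fin_supp_add[OF fin_supp_\<nu> fin_supp_cmult[OF fin_supp_avg[OF Suc]]])
qed (simp add: fin_supp_\<nu>)

lemma fin_supp_avg_square: "fin_supp (\<lambda>z. (avg (first_moment_bound M) z)\<^sup>2)"
  unfolding power2_eq_square by (intro fin_supp_mult1 fin_supp_avg fin_supp_first_moment)

lemma fin_supp_second_moment: "fin_supp (second_moment_bound M)"
proof (induction M)
  case 0
  show ?case unfolding second_moment_bound.simps by (rule fin_supp_mult1[OF fin_supp_\<nu>])
next
  case (Suc M)
  have "fin_supp (\<lambda>z. \<nu> z * first_moment_bound (Suc M) z)" by (rule fin_supp_mult1[OF fin_supp_\<nu>])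
  moreover have "fin_supp (\<lambda>z. second_moment * (avg (first_moment_bound M) z)\<^sup>2)"
    by (rule fin_supp_cmult[OF fin_supp_avg_square])
  moreover have "fin_supp (\<lambda>z. m * avg (second_moment_bound M) z)"
    by (rule fin_supp_cmult[OF fin_supp_avg[OF Suc]])
  ultimately show ?case
    unfolding second_moment_bound.simps by (intro fin_supp_add)
qed

text \<open>
  The second moment method as a comparison principle: the left-hand side is a subsolution of the equation
  for \<open>killed_hit\<close>. Its negative part is cut off before \<open>killed_step\<close> is applied, because the quadratic
  lower bound is used for arguments between 0 and \<open>\<alpha> U\<close>.
\<close>

lemma moment_bound_le_killed_hit:
  assumes \<alpha>: "0 \<le> \<alpha>"
  shows "\<alpha> * first_moment_bound M z - \<alpha>\<^sup>2 * second_moment_bound M z \<le> killed_hit M z"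
proof (induction M arbitrary: z)
  have on: "\<alpha> * first_moment_bound M z - \<alpha>\<^sup>2 * second_moment_bound M z \<le> s" for M z
  proof -
    have "\<alpha>\<^sup>2 * (first_moment_bound M z)\<^sup>2 \<le> \<alpha>\<^sup>2 * (2 * second_moment_bound M z)"
      by (intro mult_left_mono first_moment_square_le) simp
    moreover have "0 \<le> (\<alpha> * first_moment_bound M z - 1)\<^sup>2" by simp
    ultimately show ?thesis using s(1) by (simp add: power2_eq_square algebra_simps)
  qed
  {
    case 0
    then show ?case using on[of 0 z] by (auto simp: \<nu>(2))
  next
    case (Suc M)
    show ?case
    proof (cases "z \<in> A")
      case True
      then show ?thesis using on[of "Suc M" z] by simp
    next
      case False
      define t where "t y = \<alpha> * first_moment_bound M y - \<alpha>\<^sup>2 * second_moment_bound M y" for y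
      define y where "y = avg (\<lambda>y. max 0 (t y)) z"
      define a where "a = avg (first_moment_bound M) z"
      have "y \<le> avg (\<lambda>y. \<alpha> * first_moment_bound M y) z"
        unfolding y_def using \<alpha> second_moment_bound_nonneg first_moment_nonneg
        by (intro avg_mono) (auto simp: t_def)
      then have ya: "y \<le> \<alpha> * a" by (simp add: avg_cmult a_def)
      have y0: "0 \<le> y" unfolding y_def by (intro avg_nonneg) simp
      have yp: "y \<le> avg (killed_hit M) z"
        unfolding y_def using Suc.IH killed_hit_bounds by (intro avg_mono) (auto simp: t_def)
      have ys: "y \<le> s" using yp avg_killed_hit_bounds[of M z] by linarith
      have "avg t z \<le> y" unfolding y_def by (intro avg_mono) auto
      then have "m * avg t z \<le> m * y" using m by (intro mult_left_mono)
      moreover have "second_moment * y\<^sup>2 \<le> second_moment * (\<alpha> * a)\<^sup>2"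
        using ya y0 second_moment_pos by (intro mult_left_mono power_mono) auto
      ultimately have "m * avg t z - second_moment * (\<alpha> * a)\<^sup>2 \<le> m * y - second_moment * y\<^sup>2" by linarith
      also have "\<dots> \<le> killed_step y" using killed_step_lower[OF y0 ys] m by simp
      also have "\<dots> \<le> killed_step (avg (killed_hit M) z)"
        using y0 yp avg_killed_hit_bounds by (intro killed_step_mono)
      also have "m * avg t z - second_moment * (\<alpha> * a)\<^sup>2
          = \<alpha> * first_moment_bound (Suc M) z - \<alpha>\<^sup>2 * second_moment_bound (Suc M) z"
        using False by (simp add: \<nu>(2) t_def[abs_def] a_def avg_diff avg_cmult power2_eq_square algebra_simps)
      finally show ?thesis using False by simp
    qed
  }
qed

lemma lsum_first_moment: "lsum (first_moment_bound M) = lsum \<nu> * (\<Sum>j\<le>M. m ^ j)"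
proof (induction M)
  case (Suc M)
  have "lsum (first_moment_bound (Suc M)) = lsum \<nu> + m * lsum (first_moment_bound M)"
    unfolding first_moment_bound.simps
    by (subst lsum_add[OF fin_supp_\<nu> fin_supp_cmult[OF fin_supp_avg[OF fin_supp_first_moment]]])
       (simp only: lsum_cmult lsum_avg[OF fin_supp_first_moment])
  also have "\<dots> = lsum \<nu> * (1 + m * (\<Sum>j\<le>M. m ^ j))" using Suc by (simp add: algebra_simps)
  also have "1 + m * (\<Sum>j\<le>M. m ^ j) = (\<Sum>j\<le>Suc M. m ^ j)"
    by (subst sum.atMost_Suc_shift) (simp add: sum_distrib_left)
  finally show ?case .
qed simp

lemma lsum_second_moment:
  assumes E: "\<And>M. lsum (\<lambda>z. \<nu> z * green \<nu> M z) + second_moment * lsum (\<lambda>z. (avg (green \<nu> M) z)\<^sup>2) \<le> E"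
    and fg: "\<And>M. fin_supp (green \<nu> M)"
  shows "lsum (second_moment_bound M) \<le> E * (\<Sum>j\<le>M. m ^ j)"
proof (induction M)
  case 0
  have "0 \<le> second_moment * lsum (\<lambda>z. (avg (green \<nu> 0) z)\<^sup>2)"
    using second_moment_pos by (intro mult_nonneg_nonneg lsum_nonneg) auto
  then show ?case using E[of 0] by simp
next
  case (Suc M)
  have f1: "fin_supp (\<lambda>z. \<nu> z * first_moment_bound (Suc M) z)" by (rule fin_supp_mult1[OF fin_supp_\<nu>])
  have f2: "fin_supp (\<lambda>z. second_moment * (avg (first_moment_bound M) z)\<^sup>2)"
    by (rule fin_supp_cmult[OF fin_supp_avg_square])
  have f3: "fin_supp (\<lambda>z. m * avg (second_moment_bound M) z)"
    by (rule fin_supp_cmult[OF fin_supp_avg[OF fin_supp_second_moment]])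
  have "lsum (second_moment_bound (Suc M)) = lsum (\<lambda>z. \<nu> z * first_moment_bound (Suc M) z)
      + second_moment * lsum (\<lambda>z. (avg (first_moment_bound M) z)\<^sup>2) + m * lsum (second_moment_bound M)"
    unfolding second_moment_bound.simps
    by (subst lsum_add[OF fin_supp_add[OF f1 f2] f3], subst lsum_add[OF f1 f2])
       (simp only: lsum_cmult lsum_avg[OF fin_supp_second_moment])
  also have "\<dots> \<le> E + m * lsum (second_moment_bound M)"
  proof -
    have 1: "lsum (\<lambda>z. \<nu> z * first_moment_bound (Suc M) z) \<le> lsum (\<lambda>z. \<nu> z * green \<nu> (Suc M) z)"
      using \<nu>(1) first_moment_le_green
      by (intro lsum_mono fin_supp_mult1[OF fin_supp_\<nu>] mult_left_mono)
    have 2: "lsum (\<lambda>z. (avg (first_moment_bound M) z)\<^sup>2) \<le> lsum (\<lambda>z. (avg (green \<nu> (Suc M)) z)\<^sup>2)"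
    proof (rule lsum_mono[OF fin_supp_avg_square])
      show "fin_supp (\<lambda>z. (avg (green \<nu> (Suc M)) z)\<^sup>2)"
        unfolding power2_eq_square by (intro fin_supp_mult1 fin_supp_avg fg)
      have gm: "green \<nu> M z \<le> green \<nu> (Suc M) z" for M z
      proof (induction M arbitrary: z)
        case 0
        have "0 \<le> avg \<nu> z" by (intro avg_nonneg \<nu>)
        then show ?case by simp
      next
        case (Suc M)
        have "avg (green \<nu> M) z \<le> avg (green \<nu> (Suc M)) z" by (rule avg_mono) (rule Suc)
        then show ?case by simp
      qed
      fix z
      show "(avg (first_moment_bound M) z)\<^sup>2 \<le> (avg (green \<nu> (Suc M)) z)\<^sup>2"
        by (intro power_mono avg_mono avg_nonneg first_moment_nonneg order_trans[OF first_moment_le_green gm])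
    qed
    have "second_moment * lsum (\<lambda>z. (avg (first_moment_bound M) z)\<^sup>2)
        \<le> second_moment * lsum (\<lambda>z. (avg (green \<nu> (Suc M)) z)\<^sup>2)"
      using 2 second_moment_pos by (intro mult_left_mono) auto
    then show ?thesis using 1 E[of "Suc M"] by linarith
  qed
  also have "\<dots> \<le> E + m * (E * (\<Sum>j\<le>M. m ^ j))"
    using Suc m by (intro add_left_mono mult_left_mono) auto
  also have "\<dots> = E * (1 + m * (\<Sum>j\<le>M. m ^ j))" by (simp add: algebra_simps)
  also have "1 + m * (\<Sum>j\<le>M. m ^ j) = (\<Sum>j\<le>Suc M. m ^ j)"
    by (subst sum.atMost_Suc_shift) (simp add: sum_distrib_left)
  finally show ?case by simp
qed

lemma fin_supp_killed_hit: "fin_supp (killed_hit M)"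
proof (induction M)
  case 0
  show ?case by (rule fin_supp_on[OF finA]) simp
next
  case (Suc M)
  have "fin_supp (\<lambda>z. indicator A z + avg (killed_hit M) z)"
    by (rule fin_supp_add[OF fin_supp_on[OF finA] fin_supp_avg[OF Suc]]) simp
  then show ?case
  proof (rule fin_supp_mono)
    fix z assume "killed_hit (Suc M) z \<noteq> 0"
    then have "z \<in> A \<or> avg (killed_hit M) z \<noteq> 0" by (auto split: if_splits)
    then show "indicator A z + avg (killed_hit M) z \<noteq> 0"
      using avg_killed_hit_bounds[of M z] by (cases "z \<in> A") auto
  qed
qed

lemma moments_le_escape:
  assumes \<alpha>: "0 \<le> \<alpha>"
    and E: "\<And>M. lsum (\<lambda>z. \<nu> z * green \<nu> M z) + second_moment * lsum (\<lambda>z. (avg (green \<nu> M) z)\<^sup>2) \<le> E"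
    and fg: "\<And>M. fin_supp (green \<nu> M)"
    and N0: "\<And>n. n \<ge> N0 \<Longrightarrow> (\<Sum>x\<in>A. escape A n x) \<le> b"
  shows "(\<alpha> * lsum \<nu> - \<alpha>\<^sup>2 * E) * (\<Sum>j\<le>M. m ^ j)
    \<le> real N0 * real (card A) + b / (branch_prob * (1 - s))"
proof -
  let ?S = "\<Sum>j\<le>M. m ^ j"
  define B where "B = {z. killed_hit M z \<noteq> 0}"
  have B: "finite B" using fin_supp_killed_hit[of M] by (simp add: B_def fin_supp_def)
  have k: "0 < branch_prob * (1 - s)" "branch_prob * (1 - s) \<le> 1"
    using branch_prob_pos branch_prob_le_1 s by (auto intro!: mult_le_one)
  have "(\<alpha> * lsum \<nu> - \<alpha>\<^sup>2 * E) * ?S = \<alpha> * lsum (first_moment_bound M) - \<alpha>\<^sup>2 * (E * ?S)"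
    unfolding lsum_first_moment by (simp add: algebra_simps)
  also have "\<dots> \<le> \<alpha> * lsum (first_moment_bound M) - \<alpha>\<^sup>2 * lsum (second_moment_bound M)"
    using lsum_second_moment[OF E fg, of M] by (intro diff_left_mono mult_left_mono) auto
  also have "\<dots> = lsum (\<lambda>z. \<alpha> * first_moment_bound M z - \<alpha>\<^sup>2 * second_moment_bound M z)"
    by (subst lsum_diff[OF fin_supp_cmult[OF fin_supp_first_moment] fin_supp_cmult[OF fin_supp_second_moment]])
       (simp only: lsum_cmult)
  also have "\<dots> \<le> lsum (killed_hit M)"
    by (rule lsum_mono[OF fin_supp_diff[OF fin_supp_cmult[OF fin_supp_first_moment]
          fin_supp_cmult[OF fin_supp_second_moment]] fin_supp_killed_hit moment_bound_le_killed_hit[OF \<alpha>]])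
  also have "\<dots> = (\<Sum>z\<in>B. killed_hit M z)"
    by (rule lsum_on[OF B]) (simp add: B_def)
  also have "\<dots> \<le> (\<Sum>z\<in>B. killed_hit_lim z)"
    by (intro sum_mono killed_hit_le_lim)
  also have "\<dots> \<le> real N0 * real (card A) + b / (1 - (1 - branch_prob * (1 - s)))"
  proof (rule sum_le_of_subsolution[OF finA killed_hit_subsolution _ _ _ B N0])
    fix z show "killed_hit_lim z \<le> 1" using killed_hit_lim_bounds(2)[of z] s by linarith
  qed (use k in auto)
  finally show ?thesis by simp
qed

end
end
end

text \<open>
  The sum over the lattice of the first moments is \<open>lsum \<nu> / (3 * second_moment * \<epsilon>)\<close> up to a term that
  vanishes as \<open>M\<close> grows, whereas \<open>moments_le_escape\<close> contains the capacity with the factor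
  \<open>1 / (branch_prob * \<epsilon>)\<close>. Multiply by \<open>\<epsilon>\<close> and let it tend to 0.
\<close>

lemma capacity_lower:
  fixes A :: "(int ^ 'd) set" and \<nu> :: "int ^ 'd \<Rightarrow> real"
  assumes finA: "finite A" and \<nu>: "\<And>z. 0 \<le> \<nu> z" "\<And>z. z \<notin> A \<Longrightarrow> \<nu> z = 0" and \<alpha>: "0 \<le> \<alpha>"
    and E: "\<And>M. lsum (\<lambda>z. \<nu> z * green \<nu> M z) + second_moment * lsum (\<lambda>z. (avg (green \<nu> M) z)\<^sup>2) \<le> E"
  shows "branch_prob / (3 * second_moment) * (\<alpha> * lsum \<nu> - \<alpha>\<^sup>2 * E) \<le> capacity A"
proof (rule ccontr)
  define X where "X = \<alpha> * lsum \<nu> - \<alpha>\<^sup>2 * E"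
  define Y where "Y = branch_prob / (3 * second_moment) * X"
  define \<delta> where "\<delta> = (Y - capacity A) / 3"
  note C = second_moment_pos and c = branch_prob_pos
  assume "\<not> ?thesis"
  then have \<delta>: "\<delta> > 0" by (simp add: \<delta>_def Y_def X_def)
  have fg: "fin_supp (green \<nu> M)" for M
  proof (induction M)
    case 0
    show ?case using fin_supp_on[OF finA, of \<nu>] \<nu>(2) by simp
  next
    case (Suc M)
    have "fin_supp \<nu>" using \<nu>(2) by (rule fin_supp_on[OF finA])
    then show ?case unfolding green.simps using fin_supp_avg[OF Suc] by (rule fin_supp_add)
  qed
  have "\<forall>\<^sub>F n in sequentially. (\<Sum>x\<in>A. escape A n x) < capacity A + \<delta>"
    using capacity_tendsto[OF finA] by (rule order_tendstoD(2)) (use \<delta> in simp)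
  then obtain N0 where N0: "\<And>n. n \<ge> N0 \<Longrightarrow> (\<Sum>x\<in>A. escape A n x) \<le> capacity A + \<delta>"
    unfolding eventually_sequentially by (auto intro: less_imp_le)
  define K where "K = real N0 * real (card A)"
  (* The first bound makes s at least 1 / 2, the second one makes m nonnegative, and the third one
     makes the contribution of the first N0 steps at most delta. *)
  define \<epsilon> where "\<epsilon> = min (1 / 2) (min (1 / (3 * second_moment)) (\<delta> / (branch_prob * K + 1)))"
  have K: "0 \<le> K" by (simp add: K_def)
  then have bK: "0 < branch_prob * K + 1" using c by (simp add: add_nonneg_pos)
  have \<epsilon>: "0 < \<epsilon>" "\<epsilon> \<le> 1 / 2" "\<epsilon> \<le> 1 / (3 * second_moment)" "\<epsilon> \<le> \<delta> / (branch_prob * K + 1)"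
  proof -
    have "0 < 1 / (3 * second_moment)" "0 < \<delta> / (branch_prob * K + 1)" using C \<delta> bK by simp_all
    then show "0 < \<epsilon>" "\<epsilon> \<le> 1 / 2" "\<epsilon> \<le> 1 / (3 * second_moment)" "\<epsilon> \<le> \<delta> / (branch_prob * K + 1)"
      unfolding \<epsilon>_def by linarith+
  qed
  define m where "m = 1 - 3 * second_moment * \<epsilon>"
  have m: "0 \<le> m" "m < 1" using \<epsilon>(1,3) C by (auto simp: m_def field_simps)
  have bound: "X * (\<Sum>j\<le>M. m ^ j) \<le> K + (capacity A + \<delta>) / (branch_prob * \<epsilon>)" for M
    using moments_le_escape[of "1 - \<epsilon>" A \<nu> m \<alpha> E N0 "capacity A + \<delta>" M] \<epsilon> m finA \<nu> \<alpha> E fg N0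
    by (simp add: X_def K_def m_def)
  have "(\<lambda>M. \<Sum>j\<le>M. m ^ j) \<longlonglongrightarrow> 1 / (1 - m)"
    using geometric_sums[of m] m unfolding sums_def_le by simp
  then have "(\<lambda>M. X * (\<Sum>j\<le>M. m ^ j)) \<longlonglongrightarrow> X * (1 / (1 - m))"
    by (rule tendsto_mult_left)
  then have "X * (1 / (1 - m)) \<le> K + (capacity A + \<delta>) / (branch_prob * \<epsilon>)"
    by (rule LIMSEQ_le_const2) (use bound in auto)
  then have "X / (3 * second_moment * \<epsilon>) * (branch_prob * \<epsilon>) \<le> (K + (capacity A + \<delta>) / (branch_prob * \<epsilon>)) * (branch_prob * \<epsilon>)"
    using c \<epsilon> by (intro mult_right_mono) (auto simp: m_def)
  also have "(K + (capacity A + \<delta>) / (branch_prob * \<epsilon>)) * (branch_prob * \<epsilon>) = branch_prob * K * \<epsilon> + (capacity A + \<delta>)"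
    using c \<epsilon> by (simp add: field_simps)
  also have "X / (3 * second_moment * \<epsilon>) * (branch_prob * \<epsilon>) = Y"
    using C \<epsilon> by (simp add: Y_def field_simps)
  finally have "Y \<le> branch_prob * K * \<epsilon> + (capacity A + \<delta>)" .
  moreover have "branch_prob * K * \<epsilon> \<le> \<delta>"
  proof -
    have "branch_prob * K * \<epsilon> \<le> (branch_prob * K + 1) * \<epsilon>" using \<epsilon> by (intro mult_right_mono) auto
    also have "\<dots> \<le> \<delta>" using \<epsilon>(4) bK by (simp add: field_simps)
    finally show ?thesis .
  qed
  ultimately have "Y - capacity A \<le> 2 * \<delta>" by simp
  then show False using \<delta> by (simp add: \<delta>_def)
qed

end

section \<open>Independent labels on words\<close>

text \<open>
  Seeds and increments are both families of independent labels on the Ulam--Harris words.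
\<close>

definition field_measure :: "'a pmf \<Rightarrow> (vertex \<Rightarrow> 'a) measure" where
  "field_measure N = (\<Pi>\<^sub>M u\<in>UNIV. measure_pmf N)"

lemma space_field_measure [simp]: "space (field_measure N) = UNIV"
  by (simp add: field_measure_def space_PiM)

lemma prob_space_field_measure: "prob_space (field_measure N)"
  unfolding field_measure_def by (intro prob_space_PiM measure_pmf.prob_space_axioms)

lemma product_prob_space_pmf: "product_prob_space (\<lambda>_. measure_pmf N)"
  by unfold_locales

lemma measurable_field_component [measurable]:
  "(\<lambda>w. w u) \<in> measurable (field_measure N) (count_space UNIV)"
proof -
  have "(\<lambda>w. w u) \<in> measurable (field_measure N) (measure_pmf N)"
    unfolding field_measure_def by (rule measurable_component_singleton) simp
  then show ?thesis by simp
qed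

lemma sets_field_Collect: "finite J \<Longrightarrow> {w. \<forall>u\<in>J. w (g u) \<in> F u} \<in> sets (field_measure N)"
proof -
  have "{w \<in> space (field_measure N). w (g u) \<in> F u} \<in> sets (field_measure N)" for u
    using measurable_sets[OF measurable_field_component, of "F u" "g u" N]
    by (simp add: vimage_def Collect_conj_eq[symmetric] Int_def)
  then have "finite J \<Longrightarrow> {w \<in> space (field_measure N). \<forall>u\<in>J. w (g u) \<in> F u} \<in> sets (field_measure N)"
    by (rule sets.sets_Collect_finite_All)
  then show "finite J \<Longrightarrow> {w. \<forall>u\<in>J. w (g u) \<in> F u} \<in> sets (field_measure N)" by simp
qed

lemma measurable_into_field:
  assumes "\<And>u. (\<lambda>x. f x u) \<in> measurable M (count_space UNIV)"
  shows "f \<in> measurable M (field_measure N)"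
  unfolding field_measure_def
  by (rule measurable_PiM_single') (use assms in auto)

lemma emeasure_field_Collect:
  assumes "finite J"
  shows "emeasure (field_measure N) {w. \<forall>u\<in>J. w u \<in> F u} = (\<Prod>u\<in>J. emeasure (measure_pmf N) (F u))"
proof -
  interpret product_prob_space "\<lambda>_. measure_pmf N" UNIV by (rule product_prob_space_pmf)
  show ?thesis
    using emeasure_PiM_Collect[of J F] assms by (simp add: field_measure_def space_PiM)
qed

lemma field_measure_eqI:
  assumes "sets M' = sets (field_measure N)"
    and "\<And>J F. finite J \<Longrightarrow> emeasure M' {w. \<forall>u\<in>J. w u \<in> F u} = (\<Prod>u\<in>J. emeasure (measure_pmf N) (F u))"
  shows "M' = field_measure N"
proof -
  interpret product_prob_space "\<lambda>_. measure_pmf N" UNIV by (rule product_prob_space_pmf)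
  have "prod_emb UNIV (\<lambda>_. measure_pmf N) J (Pi\<^sub>E J F) = {w. \<forall>u\<in>J. w u \<in> F u}" for J and F :: "vertex \<Rightarrow> 'a set"
    by (auto simp: prod_emb_def)
  then show ?thesis
    unfolding field_measure_def using assms by (intro PiM_eq) (auto simp: field_measure_def)
qed

lemma nn_integral_field_prod:
  assumes J: "finite J"
  shows "(\<integral>\<^sup>+w. (\<Prod>u\<in>J. f u (w u)) \<partial>field_measure N) = (\<Prod>u\<in>J. \<integral>\<^sup>+a. f u a \<partial>measure_pmf N)"
proof -
  interpret product_prob_space "\<lambda>_. measure_pmf N" UNIV by (rule product_prob_space_pmf)
  have T: "(\<lambda>w. restrict w J) \<in> measurable (field_measure N) (\<Pi>\<^sub>M u\<in>J. measure_pmf N)"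
    unfolding field_measure_def by (rule measurable_restrict_subset) simp
  have F: "(\<lambda>w. \<Prod>u\<in>J. f u (w u)) \<in> borel_measurable (\<Pi>\<^sub>M u\<in>J. measure_pmf N)"
    by (intro borel_measurable_prod_ennreal measurable_compose[OF measurable_component_singleton]) auto
  have "(\<Prod>u\<in>J. \<integral>\<^sup>+a. f u a \<partial>measure_pmf N) = (\<integral>\<^sup>+w. (\<Prod>u\<in>J. f u (w u)) \<partial>(\<Pi>\<^sub>M u\<in>J. measure_pmf N))"
    by (rule product_nn_integral_prod[symmetric]) (use J in auto)
  also have "(\<Pi>\<^sub>M u\<in>J. measure_pmf N) = distr (field_measure N) (\<Pi>\<^sub>M u\<in>J. measure_pmf N) (\<lambda>w. restrict w J)"
    unfolding field_measure_def by (rule distr_PiM_restrict_finite[symmetric]) (use J in auto)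
  also have "(\<integral>\<^sup>+w. (\<Prod>u\<in>J. f u (w u)) \<partial>\<dots>) = (\<integral>\<^sup>+w. (\<Prod>u\<in>J. f u (restrict w J u)) \<partial>field_measure N)"
    by (rule nn_integral_distr[OF T]) (use F in simp)
  also have "\<dots> = (\<integral>\<^sup>+w. (\<Prod>u\<in>J. f u (w u)) \<partial>field_measure N)"
    by (intro nn_integral_cong prod.cong) auto
  finally show ?thesis ..
qed

text \<open>
  Two independent families form one family of independent pairs. This lets a subtree carry its offspring
  numbers and its increments together. On a finite set of words, integrate first over the first family.
\<close>

lemma field_measure_pair:
  "distr (field_measure A \<Otimes>\<^sub>M field_measure B) (field_measure (pair_pmf A B)) (\<lambda>(t, x) u. (t u, x u))
    = field_measure (pair_pmf A B)" (is "distr ?M ?N ?f = _")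
  if "countable (UNIV :: 'a set)" "countable (UNIV :: 'b set)" for A :: "'a pmf" and B :: "'b pmf"
proof (rule field_measure_eqI)
  interpret A: prob_space "field_measure A" by (rule prob_space_field_measure)
  interpret B: prob_space "field_measure B" by (rule prob_space_field_measure)
  interpret AB: pair_prob_space "field_measure A" "field_measure B" by unfold_locales
  have comp: "(\<lambda>w. (fst w u, snd w u)) \<in> measurable ?M (count_space UNIV)" for u
  proof -
    have "(\<lambda>w. (fst w u, snd w u)) \<in> measurable ?M (count_space UNIV \<Otimes>\<^sub>M count_space UNIV)"
      by measurable
    then show ?thesis using that by (simp add: pair_measure_countable)
  qed
  have f: "?f \<in> measurable ?M ?N"
    by (rule measurable_into_field) (use comp in \<open>simp add: case_prod_beta\<close>)
  fix J :: "vertex set" and F :: "vertex \<Rightarrow> ('a \<times> 'b) set" assume J: "finite J"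
  have "{w. \<forall>u\<in>J. w u \<in> F u} \<in> sets ?N"
    by (rule sets_field_Collect[OF J])
  note ev = this
  let ?E = "{w \<in> space ?M. \<forall>u\<in>J. (fst w u, snd w u) \<in> F u}"
  have E: "?E \<in> sets ?M"
    by (intro sets.sets_Collect_finite_All J) (rule measurable_sets_Collect[OF comp], simp)
  have "emeasure (distr ?M ?N ?f) {w. \<forall>u\<in>J. w u \<in> F u} = emeasure ?M ?E"
    using f ev by (subst emeasure_distr) (auto intro!: arg_cong2[of _ _ _ _ emeasure] simp: space_pair_measure)
  also have "\<dots> = (\<integral>\<^sup>+x. emeasure (field_measure A) ((\<lambda>t. (t, x)) -` ?E) \<partial>field_measure B)"
    by (rule AB.emeasure_pair_measure_alt2[OF E])
  also have "\<dots> = (\<integral>\<^sup>+x. (\<Prod>u\<in>J. emeasure (measure_pmf A) {a. (a, x u) \<in> F u}) \<partial>field_measure B)"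
  proof (intro nn_integral_cong)
    fix x
    have "(\<lambda>t. (t, x)) -` ?E = {t. \<forall>u\<in>J. t u \<in> {a. (a, x u) \<in> F u}}"
      by (auto simp: space_pair_measure)
    then show "emeasure (field_measure A) ((\<lambda>t. (t, x)) -` ?E) = (\<Prod>u\<in>J. emeasure (measure_pmf A) {a. (a, x u) \<in> F u})"
      by (simp only: emeasure_field_Collect[OF J])
  qed
  also have "\<dots> = (\<Prod>u\<in>J. \<integral>\<^sup>+b. emeasure (measure_pmf A) {a. (a, b) \<in> F u} \<partial>measure_pmf B)"
    by (rule nn_integral_field_prod[OF J])
  also have "\<dots> = (\<Prod>u\<in>J. emeasure (measure_pmf (pair_pmf A B)) (F u))"
  proof (intro prod.cong refl)
    fix u
    have "emeasure (measure_pmf (pair_pmf A B)) (F u) = (\<integral>\<^sup>+p. indicator (F u) p \<partial>pair_pmf A B)"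
      by simp
    also have "\<dots> = (\<integral>\<^sup>+p. indicator (F u) p \<partial>map_pmf (\<lambda>(b, a). (a, b)) (pair_pmf B A))"
      by (subst pair_commute_pmf) (rule refl)
    also have "\<dots> = (\<integral>\<^sup>+b. \<integral>\<^sup>+a. indicator (F u) (a, b) \<partial>A \<partial>B)"
      by (simp add: nn_integral_pair_pmf')
    also have "\<dots> = (\<integral>\<^sup>+b. emeasure (measure_pmf A) {a. (a, b) \<in> F u} \<partial>B)"
    proof (intro nn_integral_cong)
      fix b
      have "indicator (F u) (a, b) = (indicator {a. (a, b) \<in> F u} a :: ennreal)" for a
        by (simp add: indicator_def)
      then show "(\<integral>\<^sup>+a. indicator (F u) (a, b) \<partial>A) = emeasure (measure_pmf A) {a. (a, b) \<in> F u}"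
        by simp
    qed
    finally show "(\<integral>\<^sup>+b. emeasure (measure_pmf A) {a. (a, b) \<in> F u} \<partial>measure_pmf B)
        = emeasure (measure_pmf (pair_pmf A B)) (F u)" ..
  qed
  finally show "emeasure (distr ?M ?N ?f) {w. \<forall>u\<in>J. w u \<in> F u} = (\<Prod>u\<in>J. emeasure (measure_pmf (pair_pmf A B)) (F u))" .
qed simp

definition subfield :: "nat \<Rightarrow> (vertex \<Rightarrow> 'a) \<Rightarrow> vertex \<Rightarrow> 'a" where
  "subfield i w u = w (i # u)"

definition graft :: "'a \<Rightarrow> (nat \<Rightarrow> vertex \<Rightarrow> 'a) \<Rightarrow> vertex \<Rightarrow> 'a" where
  "graft a f u = (case u of [] \<Rightarrow> a | i # v \<Rightarrow> f i v)"

lemma subfield_graft [simp]: "subfield i (graft a f) = f i"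
  by (simp add: fun_eq_iff subfield_def graft_def)

lemma graft_Nil [simp]: "graft a f [] = a"
  by (simp add: graft_def)

lemma measurable_subfield [measurable]: "subfield i \<in> measurable (field_measure N) (field_measure N)"
  by (rule measurable_into_field) (simp add: subfield_def measurable_field_component)

definition forest_measure :: "'a pmf \<Rightarrow> (nat \<Rightarrow> vertex \<Rightarrow> 'a) measure" where
  "forest_measure N = (\<Pi>\<^sub>M i\<in>UNIV. field_measure N)"

lemma space_forest_measure [simp]: "space (forest_measure N) = UNIV"
  by (simp add: forest_measure_def space_PiM)

lemma prob_space_forest_measure: "prob_space (forest_measure N)"
  unfolding forest_measure_def by (intro prob_space_PiM prob_space_field_measure)

lemma emeasure_forest_Collect:
  assumes "finite I" "\<And>i. i \<in> I \<Longrightarrow> E i \<in> sets (field_measure N)"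
  shows "emeasure (forest_measure N) {f. \<forall>i\<in>I. f i \<in> E i} = (\<Prod>i\<in>I. emeasure (field_measure N) (E i))"
proof -
  interpret F: prob_space "field_measure N" by (rule prob_space_field_measure)
  interpret product_prob_space "\<lambda>_. field_measure N" UNIV by unfold_locales
  show ?thesis
    using emeasure_PiM_Collect[of I E] assms by (simp add: forest_measure_def space_PiM)
qed

lemma measurable_forest_component [measurable]:
  "(\<lambda>f. f i) \<in> measurable (forest_measure N) (field_measure N)"
  unfolding forest_measure_def by (rule measurable_component_singleton) simp

lemma measurable_graft:
  "(\<lambda>(a, f). graft a f) \<in> measurable (measure_pmf N \<Otimes>\<^sub>M forest_measure N) (field_measure N)"
proof (rule measurable_into_field)
  fix u
  show "(\<lambda>x. (case x of (a, f) \<Rightarrow> graft a f) u) \<in> measurable (measure_pmf N \<Otimes>\<^sub>M forest_measure N) (count_space UNIV)"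
  proof (cases u)
    case Nil
    have "fst \<in> measurable (measure_pmf N \<Otimes>\<^sub>M forest_measure N) (measure_pmf N)" by measurable
    then show ?thesis using Nil by (simp add: case_prod_beta)
  next
    case (Cons i v)
    have "(\<lambda>x. snd x i v) \<in> measurable (measure_pmf N \<Otimes>\<^sub>M forest_measure N) (count_space UNIV)"
      by measurable
    then show ?thesis using Cons by (simp add: case_prod_beta graft_def)
  qed
qed

text \<open>
  The branching property: a root label and independent copies of the whole family, one for each
  offspring of the root, have the law of the family itself.
\<close>

lemma distr_graft:
  "distr (measure_pmf N \<Otimes>\<^sub>M forest_measure N) (field_measure N) (\<lambda>(a, f). graft a f) = field_measure N"
  (is "distr ?M _ ?g = _")
proof (rule field_measure_eqI)
  interpret F: prob_space "forest_measure N" by (rule prob_space_forest_measure)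
  fix J :: "vertex set" and F :: "vertex \<Rightarrow> 'a set" assume J: "finite J"
  define F' where "F' u = (if u \<in> J then F u else UNIV)" for u
  define I where "I = hd ` (J - {[]})"
  define V where "V i = {v. i # v \<in> J}" for i
  have fin: "finite I" "finite (V i)" for i
  proof -
    have "V i \<subseteq> tl ` J" by (force simp: V_def)
    then show "finite (V i)" using J by (auto intro: finite_subset)
  qed (use J in \<open>simp add: I_def\<close>)
  have Jeq: "J - {[]} = (\<lambda>(i, v). i # v) ` Sigma I V"
  proof (intro set_eqI iffI)
    fix u assume "u \<in> J - {[]}"
    then show "u \<in> (\<lambda>(i, v). i # v) ` Sigma I V"
      by (intro image_eqI[of _ _ "(hd u, tl u)"]) (auto simp: I_def V_def)
  qed (auto simp: V_def)
  define E where "E i = {t. \<forall>v\<in>V i. t v \<in> F' (i # v)}" for i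
  have E: "E i \<in> sets (field_measure N)" for i
    unfolding E_def by (rule sets_field_Collect[OF fin(2)])
  have ev: "{w. \<forall>u\<in>J. w u \<in> F u} \<in> sets (field_measure N)"
    by (rule sets_field_Collect[OF J])
  have Fs: "{f. \<forall>i\<in>I. f i \<in> E i} \<in> sets (forest_measure N)"
  proof -
    have "{f \<in> space (forest_measure N). \<forall>i\<in>I. f i \<in> E i} \<in> sets (forest_measure N)"
    proof (intro sets.sets_Collect_finite_All fin)
      fix i
      show "{f \<in> space (forest_measure N). f i \<in> E i} \<in> sets (forest_measure N)"
        using measurable_sets[OF measurable_forest_component E, of i i] by (simp add: vimage_def)
    qed
    then show ?thesis by simp
  qed
  have "?g -` {w. \<forall>u\<in>J. w u \<in> F u} \<inter> space ?M = F' [] \<times> {f. \<forall>i\<in>I. f i \<in> E i}"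
  proof (intro set_eqI iffI)
    fix p assume p: "p \<in> ?g -` {w. \<forall>u\<in>J. w u \<in> F u} \<inter> space ?M"
    obtain a f where af: "p = (a, f)" by (cases p)
    from p af have *: "\<forall>u\<in>J. graft a f u \<in> F u" by simp
    have "a \<in> F' []" using * by (force simp: F'_def graft_def)
    moreover have "f i \<in> E i" for i using * by (force simp: E_def V_def F'_def graft_def)
    ultimately show "p \<in> F' [] \<times> {f. \<forall>i\<in>I. f i \<in> E i}" using af by simp
  next
    fix p assume p: "p \<in> F' [] \<times> {f. \<forall>i\<in>I. f i \<in> E i}"
    obtain a f where af: "p = (a, f)" by (cases p)
    have "graft a f u \<in> F u" if "u \<in> J" for u
    proof (cases u)
      case Nil
      then show ?thesis using p af that by (simp add: F'_def)
    next
      case (Cons i v)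
      then have "i \<in> I" "v \<in> V i" using that by (auto simp: I_def V_def intro!: image_eqI[of _ _ "i # v"])
      then have "f i v \<in> F' (i # v)" using p af by (auto simp: E_def)
      then show ?thesis using that Cons by (simp add: F'_def graft_def)
    qed
    then show "p \<in> ?g -` {w. \<forall>u\<in>J. w u \<in> F u} \<inter> space ?M"
      using af by (simp add: space_pair_measure)
  qed
  then have "emeasure (distr ?M (field_measure N) ?g) {w. \<forall>u\<in>J. w u \<in> F u}
      = emeasure ?M (F' [] \<times> {f. \<forall>i\<in>I. f i \<in> E i})"
    using ev by (simp add: emeasure_distr measurable_graft)
  also have "\<dots> = emeasure (measure_pmf N) (F' []) * emeasure (forest_measure N) {f. \<forall>i\<in>I. f i \<in> E i}"
    using Fs by (intro F.emeasure_pair_measure_Times) auto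
  also have "emeasure (forest_measure N) {f. \<forall>i\<in>I. f i \<in> E i} = (\<Prod>i\<in>I. emeasure (field_measure N) (E i))"
    by (rule emeasure_forest_Collect[OF fin(1) E])
  also have "\<dots> = (\<Prod>i\<in>I. \<Prod>v\<in>V i. emeasure (measure_pmf N) (F' (i # v)))"
    unfolding E_def by (intro prod.cong refl emeasure_field_Collect fin)
  also have "\<dots> = (\<Prod>(i, v)\<in>Sigma I V. emeasure (measure_pmf N) (F' (i # v)))"
    by (rule prod.Sigma) (use fin in auto)
  also have "\<dots> = (\<Prod>u\<in>J - {[]}. emeasure (measure_pmf N) (F' u))"
    unfolding Jeq by (subst prod.reindex) (auto simp: inj_on_def case_prod_beta)
  also have "emeasure (measure_pmf N) (F' []) * \<dots> = (\<Prod>u\<in>insert [] J. emeasure (measure_pmf N) (F' u))"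
    using J by (subst prod.insert_remove) auto
  also have "\<dots> = (\<Prod>u\<in>J. emeasure (measure_pmf N) (F' u))"
    using J by (intro prod.mono_neutral_right) (auto simp: F'_def)
  also have "\<dots> = (\<Prod>u\<in>J. emeasure (measure_pmf N) (F u))"
    by (intro prod.cong) (auto simp: F'_def)
  finally show "emeasure (distr ?M (field_measure N) ?g) {w. \<forall>u\<in>J. w u \<in> F u}
     = (\<Prod>u\<in>J. emeasure (measure_pmf N) (F u))" .
qed simp

text \<open>
  Given the label of the root, the subtrees are independent. The number of subtrees that matter and the
  events may depend on the label of the root.
\<close>

lemma emeasure_branching:
  assumes E: "\<And>a i. E a i \<in> sets (field_measure N)"
    and meas: "{w. P (w []) \<and> (\<forall>i<k (w []). subfield i w \<in> E (w []) i)} \<in> sets (field_measure N)"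
  shows "emeasure (field_measure N) {w. P (w []) \<and> (\<forall>i<k (w []). subfield i w \<in> E (w []) i)}
    = (\<integral>\<^sup>+a. indicator {a. P a} a * (\<Prod>i<k a. emeasure (field_measure N) (E a i)) \<partial>measure_pmf N)"
proof -
  interpret F: prob_space "forest_measure N" by (rule prob_space_forest_measure)
  let ?S = "{w. P (w []) \<and> (\<forall>i<k (w []). subfield i w \<in> E (w []) i)}"
  let ?M = "measure_pmf N \<Otimes>\<^sub>M forest_measure N" and ?g = "\<lambda>(a, f). graft a f"
  have "emeasure (field_measure N) ?S = emeasure (distr ?M (field_measure N) ?g) ?S"
    by (simp add: distr_graft)
  also have "\<dots> = emeasure ?M (?g -` ?S \<inter> space ?M)"
    by (rule emeasure_distr[OF measurable_graft meas])
  also have "\<dots> = (\<integral>\<^sup>+a. emeasure (forest_measure N) (Pair a -` (?g -` ?S \<inter> space ?M)) \<partial>measure_pmf N)"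
    by (rule F.emeasure_pair_measure_alt) (rule measurable_sets[OF measurable_graft meas])
  also have "\<dots> = (\<integral>\<^sup>+a. indicator {a. P a} a * (\<Prod>i<k a. emeasure (field_measure N) (E a i)) \<partial>measure_pmf N)"
  proof (intro nn_integral_cong)
    fix a
    have "Pair a -` (?g -` ?S \<inter> space ?M) = (if P a then {f. \<forall>i\<in>{..<k a}. f i \<in> E a i} else {})"
      by (auto simp: space_pair_measure)
    then show "emeasure (forest_measure N) (Pair a -` (?g -` ?S \<inter> space ?M))
        = indicator {a. P a} a * (\<Prod>i<k a. emeasure (field_measure N) (E a i))"
      using emeasure_forest_Collect[of "{..<k a}" "E a" N] E by simp
  qed
  finally show ?thesis .
qed

lemma distr_subfield: "distr (field_measure N) (field_measure N) (subfield i) = field_measure N"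
proof (rule measure_eqI)
  fix S assume "S \<in> sets (distr (field_measure N) (field_measure N) (subfield i))"
  then have S: "S \<in> sets (field_measure N)" by simp
  interpret W: prob_space "field_measure N" by (rule prob_space_field_measure)
  have eq: "subfield i -` S \<inter> space (field_measure N)
      = {w. True \<and> (\<forall>j<Suc i. subfield j w \<in> (if j = i then S else UNIV))}"
    by (auto simp: less_Suc_eq)
  have "emeasure (field_measure N) (subfield i -` S \<inter> space (field_measure N))
      = (\<integral>\<^sup>+a. indicator {a. True} a * (\<Prod>j<Suc i. emeasure (field_measure N) (if j = i then S else UNIV)) \<partial>measure_pmf N)"
    unfolding eq
  proof (rule emeasure_branching)
    show "(if j = i then S else UNIV) \<in> sets (field_measure N)" for j
      using S sets.top[of "field_measure N"] by simp
    show "{w. True \<and> (\<forall>j<Suc i. subfield j w \<in> (if j = i then S else UNIV))} \<in> sets (field_measure N)"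
      unfolding eq[symmetric] using S by (intro measurable_sets[OF measurable_subfield])
  qed
  also have "(\<Prod>j<Suc i. emeasure (field_measure N) (if j = i then S else UNIV)) = emeasure (field_measure N) S"
    using W.emeasure_space_1 by (subst prod.lessThan_Suc) simp
  finally show "emeasure (distr (field_measure N) (field_measure N) (subfield i)) S = emeasure (field_measure N) S"
    using S by (simp add: emeasure_distr)
qed simp

section \<open>The probability that the past avoids a set\<close>

lemma sets_dependent_on_root:
  fixes E :: "'a :: countable \<Rightarrow> (vertex \<Rightarrow> 'a) set"
  assumes "\<And>a. E a \<in> sets (field_measure N)"
  shows "{w. w \<in> E (w [])} \<in> sets (field_measure N)"
proof -
  have root: "{w. w [] = a} \<in> sets (field_measure N)" for a
    using sets_field_Collect[of "{[]}" "\<lambda>u. u" "\<lambda>_. {a}" N] by simp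
  have "(\<Union>a. {w. w [] = a} \<inter> E a) \<in> sets (field_measure N)"
    using root assms by (intro sets.countable_UN') auto
  also have "(\<Union>a. {w. w [] = a} \<inter> E a) = {w. w \<in> E (w [])}" by auto
  finally show ?thesis .
qed

lemma sets_subfield:
  assumes "S \<in> sets (field_measure N)"
  shows "{w. subfield i w \<in> S} \<in> sets (field_measure N)"
  using measurable_sets[OF measurable_subfield assms, of i] by (simp add: vimage_def)

lemma sets_branching:
  fixes E :: "'a :: countable \<Rightarrow> nat \<Rightarrow> (vertex \<Rightarrow> 'a) set"
  assumes E: "\<And>a i. E a i \<in> sets (field_measure N)"
  shows "{w. P (w []) \<and> (\<forall>i<k (w []). subfield i w \<in> E (w []) i)} \<in> sets (field_measure N)"
proof -
  have "{w \<in> space (field_measure N). \<forall>i\<in>{..<k a}. subfield i w \<in> E a i} \<in> sets (field_measure N)" for a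
    by (intro sets.sets_Collect_finite_All) (use sets_subfield[OF E] in auto)
  then have "(if P a then {w. \<forall>i\<in>{..<k a}. subfield i w \<in> E a i} else {}) \<in> sets (field_measure N)" for a
    by simp
  from sets_dependent_on_root[OF this] show ?thesis
    by (rule back_subst[of "\<lambda>S. S \<in> sets (field_measure N)"]) (auto split: if_splits)
qed

text \<open>
  The label of a vertex together with the increment along the edge to its parent. Since this edge belongs
  to the vertex, a subtree depends on the rest of the tree only through the position of the parent of its
  root.
\<close>

type_synonym 'd node = "(nat \<times> nat \<times> nat) \<times> (int ^ 'd)"

definition normal_number :: "('d::finite) node \<Rightarrow> nat" where
  "normal_number a = fst (fst a)"

definition special_pos :: "('d::finite) node \<Rightarrow> nat" where
  "special_pos a = snd (snd (fst a))"

definition edge :: "('d::finite) node \<Rightarrow> int ^ 'd" where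
  "edge a = snd a"

primrec normal_avoids :: "(int ^ 'd) set \<Rightarrow> nat \<Rightarrow> (vertex \<Rightarrow> ('d::finite) node) \<Rightarrow> int ^ 'd \<Rightarrow> bool" where
  "normal_avoids A 0 = (\<lambda>w z. True)"
| "normal_avoids A (Suc n) = (\<lambda>w z. z + edge (w []) \<notin> A \<and>
     (\<forall>i<normal_number (w []). normal_avoids A n (subfield i w) (z + edge (w []))))"

text \<open>
  The trees to the left of the spine are explored entirely, the spine only up to \<open>n\<close> vertices.
\<close>

primrec special_avoids :: "(int ^ 'd) set \<Rightarrow> nat \<Rightarrow> (vertex \<Rightarrow> ('d::finite) node) \<Rightarrow> int ^ 'd \<Rightarrow> bool" where
  "special_avoids A 0 = (\<lambda>w z. True)"
| "special_avoids A (Suc n) = (\<lambda>w z. z + edge (w []) \<notin> A \<and>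
     (\<forall>i<special_pos (w []). \<forall>m. normal_avoids A m (subfield i w) (z + edge (w []))) \<and>
     special_avoids A n (subfield (special_pos (w [])) w) (z + edge (w [])))"

lemma sets_normal_avoids: "{w. normal_avoids A n w z} \<in> sets (field_measure N)"
proof (induction n arbitrary: z)
  case 0
  then show ?case using sets.top[of "field_measure N"] by simp
next
  case (Suc n)
  then show ?case
    using sets_branching[of "\<lambda>a i. {w. normal_avoids A n w (z + edge a)}" N "\<lambda>a. z + edge a \<notin> A" normal_number]
    by simp
qed

lemma normal_avoids_Suc: "normal_avoids A (Suc n) w z \<Longrightarrow> normal_avoids A n w z"
  by (induction n arbitrary: w z) auto

lemma sets_normal_avoids_all: "{w. \<forall>n. normal_avoids A n w z} \<in> sets (field_measure N)"
proof -
  have "(\<Inter>n. {w. normal_avoids A n w z}) \<in> sets (field_measure N)"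
    by (intro sets.countable_INT' sets_normal_avoids) (auto simp: sets_normal_avoids)
  then show ?thesis by (simp add: Collect_all_eq)
qed

text \<open>
  The special offspring is treated as one more subtree, so that \<open>emeasure_branching\<close> applies.
\<close>

lemma special_avoids_eq:
  "{w. special_avoids A (Suc n) w z} = {w. z + edge (w []) \<notin> A \<and> (\<forall>i<Suc (special_pos (w [])).
     subfield i w \<in> (if i < special_pos (w []) then {w'. \<forall>m. normal_avoids A m w' (z + edge (w []))}
        else {w'. special_avoids A n w' (z + edge (w []))}))}"
  by (auto simp: less_Suc_eq)

lemma sets_special_avoids: "{w. special_avoids A n w z} \<in> sets (field_measure N)"
proof (induction n arbitrary: z)
  case 0
  then show ?case using sets.top[of "field_measure N"] by simp
next
  case (Suc n)
  show ?case
    unfolding special_avoids_eq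
    by (rule sets_branching) (simp add: Suc sets_normal_avoids_all)
qed

lemma special_avoids_Suc: "special_avoids A (Suc n) w z \<Longrightarrow> special_avoids A n w z"
proof (induction n arbitrary: w z)
  case (Suc n)
  have "special_avoids A (Suc n) (subfield (special_pos (w [])) w) (z + edge (w []))"
    using Suc.prems unfolding special_avoids.simps(2)[of A "Suc n"] by (elim conjE)
  then have "special_avoids A n (subfield (special_pos (w [])) w) (z + edge (w []))"
    by (rule Suc.IH)
  then show ?case
    using Suc.prems unfolding special_avoids.simps(2)[of A "Suc n"] special_avoids.simps(2)[of A n]
    by (elim conjE) (intro conjI)
qed simp

lemma nn_integral_pair_pmf_swap:
  "(\<integral>\<^sup>+p. f p \<partial>measure_pmf (pair_pmf A B)) = (\<integral>\<^sup>+b. \<integral>\<^sup>+a. f (a, b) \<partial>measure_pmf A \<partial>measure_pmf B)"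
  by (subst pair_commute_pmf) (simp add: nn_integral_pair_pmf')

lemma nn_integral_step:
  assumes "\<And>y. 0 \<le> u y"
  shows "(\<integral>\<^sup>+e. ennreal (u (z + e)) \<partial>measure_pmf step_pmf) = ennreal (avg u z)"
  unfolding avg_def
  by (rule nn_integral_eq_integral)
     (auto intro!: integrable_measure_pmf_finite assms
       simp: step_pmf_def finite_lattice_neighbors lattice_neighbors_nonempty)

context offspring_law
begin

lemma pmf_size_biased: "pmf (size_biased \<mu>) k = real k * pmf \<mu> k"
  unfolding size_biased_def
proof (rule pmf_embed_pmf)
  have "(\<integral>\<^sup>+k. ennreal (real k * pmf \<mu> k) \<partial>count_space UNIV) = (\<Sum>k. ennreal (real k * pmf \<mu> k))"
    by (rule nn_integral_count_space_nat)
  also have "\<dots> = ennreal 1"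
    using critical by (subst suminf_ennreal2) (auto simp: sums_iff)
  finally show "(\<integral>\<^sup>+k. ennreal (real k * pmf \<mu> k) \<partial>count_space UNIV) = 1" by simp
qed simp

text \<open>
  The weight \<open>k\<close> of the size-biased law cancels the probability \<open>1 / k\<close> of each position.
\<close>

lemma nn_integral_special_offspring:
  assumes x: "0 \<le> x" "x \<le> 1"
  shows "(\<integral>\<^sup>+l. ennreal (x ^ snd l) \<partial>measure_pmf (special_offspring \<mu>)) = ennreal (slope x 1)"
proof -
  have inner: "ennreal (pmf (size_biased \<mu>) k) * (\<integral>\<^sup>+j. ennreal (x ^ j) \<partial>measure_pmf (pmf_of_set {..<k}))
      = ennreal (pmf \<mu> k) * ennreal (\<Sum>j<k. x ^ j)" for k
  proof (cases "k = 0")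
    case False
    have "(\<integral>\<^sup>+j. ennreal (x ^ j) \<partial>measure_pmf (pmf_of_set {..<k})) = (\<Sum>j<k. ennreal (x ^ j)) / ennreal (real k)"
      using False by (subst nn_integral_pmf_of_set) (auto simp: ennreal_of_nat_eq_real_of_nat lessThan_empty_iff)
    also have "\<dots> = ennreal ((\<Sum>j<k. x ^ j) / real k)"
      using x False by (subst sum_ennreal) (auto simp: divide_ennreal sum_nonneg)
    finally show ?thesis
      using x False by (simp add: pmf_size_biased ennreal_mult[symmetric] sum_nonneg)
  qed (simp add: pmf_size_biased)
  have "(\<integral>\<^sup>+l. ennreal (x ^ snd l) \<partial>measure_pmf (special_offspring \<mu>))
      = (\<integral>\<^sup>+k. \<integral>\<^sup>+j. ennreal (x ^ j) \<partial>measure_pmf (pmf_of_set {..<k}) \<partial>measure_pmf (size_biased \<mu>))"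
    by (simp add: special_offspring_def)
  also have "\<dots> = (\<integral>\<^sup>+k. ennreal (pmf \<mu> k) * ennreal (\<Sum>j<k. x ^ j) \<partial>count_space UNIV)"
    by (subst nn_integral_measure_pmf) (simp only: inner)
  also have "\<dots> = (\<integral>\<^sup>+k. ennreal (\<Sum>j<k. x ^ j) \<partial>measure_pmf \<mu>)"
    by (subst nn_integral_measure_pmf) (rule refl)
  also have "\<dots> = ennreal (slope x 1)"
    unfolding slope_def using integrable_slope[of x 1] x
    by (subst nn_integral_eq_integral) (auto intro!: sum_nonneg)
  finally show ?thesis .
qed

definition node_law :: "('d::finite) node pmf" where
  "node_law = pair_pmf (pair_pmf \<mu> (special_offspring \<mu>)) step_pmf"

lemma emeasure_normal_avoids:
  "emeasure (field_measure node_law) {w. normal_avoids A n w z} = ennreal (avoid A n z)"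
proof (induction n arbitrary: z)
  case 0
  interpret W: prob_space "field_measure node_law" by (rule prob_space_field_measure)
  show ?case using W.emeasure_space_1 by simp
next
  case (Suc n)
  let ?u = "\<lambda>y. if y \<in> A then 0 else gf (avoid A n y)"
  have "emeasure (field_measure node_law) {w. normal_avoids A (Suc n) w z}
      = (\<integral>\<^sup>+a. indicator {a. z + edge a \<notin> A} a * (\<Prod>i<normal_number a.
            emeasure (field_measure node_law) {w. normal_avoids A n w (z + edge a)}) \<partial>measure_pmf node_law)"
    using emeasure_branching[of "\<lambda>a i. {w. normal_avoids A n w (z + edge a)}" node_law "\<lambda>a. z + edge a \<notin> A" normal_number]
      sets_branching[of "\<lambda>a i. {w. normal_avoids A n w (z + edge a)}" node_law "\<lambda>a. z + edge a \<notin> A" normal_number]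
    by (simp add: sets_normal_avoids)
  also have "\<dots> = (\<integral>\<^sup>+e. \<integral>\<^sup>+k. indicator (- A) (z + e) * ennreal (avoid A n (z + e) ^ k) \<partial>measure_pmf \<mu> \<partial>measure_pmf step_pmf)"
    unfolding node_law_def[symmetric] Suc
    unfolding node_law_def nn_integral_pair_pmf_swap nn_integral_pair_pmf'
    by (simp add: edge_def normal_number_def ennreal_power avoid_nonneg indicator_def)
  also have "\<dots> = (\<integral>\<^sup>+e. ennreal (?u (z + e)) \<partial>measure_pmf step_pmf)"
  proof (intro nn_integral_cong)
    fix e
    have "(\<integral>\<^sup>+k. ennreal (avoid A n (z + e) ^ k) \<partial>measure_pmf \<mu>) = ennreal (gf (avoid A n (z + e)))"
      unfolding gf_def using integrable_power_gf[OF avoid_nonneg avoid_le_1]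
      by (subst nn_integral_eq_integral) (auto simp: avoid_nonneg)
    then show "(\<integral>\<^sup>+k. indicator (- A) (z + e) * ennreal (avoid A n (z + e) ^ k) \<partial>measure_pmf \<mu>) = ennreal (?u (z + e))"
      by (simp add: indicator_def)
  qed
  also have "\<dots> = ennreal (avg ?u z)"
    by (rule nn_integral_step) (auto intro: gf_nonneg avoid_nonneg avoid_le_1)
  finally show ?case by simp
qed

lemma emeasure_normal_avoids_all:
  "emeasure (field_measure node_law) {w. \<forall>n. normal_avoids A n w z} = ennreal (avoid_lim A z)"
proof -
  interpret W: prob_space "field_measure node_law" by (rule prob_space_field_measure)
  have dec: "decseq (\<lambda>n. {w. normal_avoids A n w z})"
    by (intro decseq_SucI) (auto dest: normal_avoids_Suc simp del: normal_avoids.simps)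
  have "(\<lambda>n. emeasure (field_measure node_law) {w. normal_avoids A n w z})
      \<longlonglongrightarrow> emeasure (field_measure node_law) (\<Inter>n. {w. normal_avoids A n w z})"
    by (rule Lim_emeasure_decseq[OF _ dec]) (auto simp: sets_normal_avoids)
  moreover have "(\<lambda>n. emeasure (field_measure node_law) {w. normal_avoids A n w z}) \<longlonglongrightarrow> ennreal (avoid_lim A z)"
    unfolding emeasure_normal_avoids by (intro tendsto_ennrealI avoid_tendsto)
  ultimately have "emeasure (field_measure node_law) (\<Inter>n. {w. normal_avoids A n w z}) = ennreal (avoid_lim A z)"
    by (rule LIMSEQ_unique)
  then show ?thesis by (simp add: Collect_all_eq)
qed

lemma emeasure_special_avoids:
  "emeasure (field_measure node_law) {w. special_avoids A n w z} = ennreal (escape A n z)"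
proof (induction n arbitrary: z)
  case 0
  interpret W: prob_space "field_measure node_law" by (rule prob_space_field_measure)
  show ?case using W.emeasure_space_1 by simp
next
  case (Suc n)
  let ?E = "\<lambda>a i. if i < special_pos a then {w'. \<forall>m. normal_avoids A m w' (z + edge a)}
        else {w'. special_avoids A n w' (z + edge a)}"
  have E: "?E a i \<in> sets (field_measure node_law)" for a i
    by (simp add: sets_special_avoids sets_normal_avoids_all)
  have prod: "(\<Prod>i<Suc (special_pos a). emeasure (field_measure node_law) (?E a i))
      = ennreal (avoid_lim A (z + edge a) ^ special_pos a * escape A n (z + edge a))" for a
    by (simp add: emeasure_normal_avoids_all Suc ennreal_power ennreal_mult' escape_nonneg)
  have "emeasure (field_measure node_law) {w. special_avoids A (Suc n) w z}
      = (\<integral>\<^sup>+a. indicator {a. z + edge a \<notin> A} a * (\<Prod>i<Suc (special_pos a). emeasure (field_measure node_law) (?E a i)) \<partial>measure_pmf node_law)"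
    unfolding special_avoids_eq by (rule emeasure_branching[OF E sets_branching[OF E]])
  also have "\<dots> = (\<integral>\<^sup>+e. \<integral>\<^sup>+l. indicator (- A) (z + e) * ennreal (avoid_lim A (z + e) ^ snd l * escape A n (z + e))
        \<partial>measure_pmf (special_offspring \<mu>) \<partial>measure_pmf step_pmf)"
    unfolding prod unfolding node_law_def nn_integral_pair_pmf_swap
    by (simp add: edge_def special_pos_def indicator_def)
  also have "\<dots> = (\<integral>\<^sup>+e. ennreal (survive A (z + e) * escape A n (z + e)) \<partial>measure_pmf step_pmf)"
  proof (intro nn_integral_cong)
    fix e
    have "(\<integral>\<^sup>+l. ennreal (avoid_lim A (z + e) ^ snd l * escape A n (z + e)) \<partial>measure_pmf (special_offspring \<mu>))
        = (\<integral>\<^sup>+l. ennreal (avoid_lim A (z + e) ^ snd l) \<partial>measure_pmf (special_offspring \<mu>)) * ennreal (escape A n (z + e))"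
      by (subst nn_integral_multc[symmetric]) (auto simp: ennreal_mult' escape_nonneg)
    also have "\<dots> = ennreal (slope (avoid_lim A (z + e)) 1 * escape A n (z + e))"
      by (simp add: nn_integral_special_offspring ennreal_mult slope_nonneg escape_nonneg)
    finally show "(\<integral>\<^sup>+l. indicator (- A) (z + e) * ennreal (avoid_lim A (z + e) ^ snd l * escape A n (z + e)) \<partial>measure_pmf (special_offspring \<mu>))
        = ennreal (survive A (z + e) * escape A n (z + e))"
      by (simp add: indicator_def survive_def)
  qed
  also have "\<dots> = ennreal (avg (\<lambda>y. survive A y * escape A n y) z)"
    using nn_integral_step[of "\<lambda>y. survive A y * escape A n y" z] by (simp add: survive_nonneg escape_nonneg)
  finally show ?case by simp
qed

lemma measure_special_avoids_all:
  "measure (field_measure node_law) {w. \<forall>n. special_avoids A n w z} = escape_lim A z"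
proof -
  interpret W: prob_space "field_measure node_law" by (rule prob_space_field_measure)
  have dec: "decseq (\<lambda>n. {w. special_avoids A n w z})"
    by (intro decseq_SucI) (auto dest: special_avoids_Suc simp del: special_avoids.simps)
  have "(\<lambda>n. measure (field_measure node_law) {w. special_avoids A n w z})
      \<longlonglongrightarrow> measure (field_measure node_law) (\<Inter>n. {w. special_avoids A n w z})"
    by (rule W.finite_Lim_measure_decseq[OF _ dec]) (auto simp: sets_special_avoids)
  moreover have "measure (field_measure node_law) {w. special_avoids A n w z} = escape A n z" for n
    by (simp add: measure_def emeasure_special_avoids escape_nonneg)
  ultimately have "measure (field_measure node_law) (\<Inter>n. {w. special_avoids A n w z}) = escape_lim A z"
    using escape_tendsto[of A z] by (simp add: LIMSEQ_unique)
  then show ?thesis by (simp add: Collect_all_eq)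
qed

end

section \<open>The past of the tree\<close>

text \<open>
  The tree in which every vertex uses its normal offspring number.
\<close>

definition normal_tree :: "(vertex \<Rightarrow> ('d::finite) node) \<Rightarrow> vertex set" where
  "normal_tree w = {u. \<forall>p i q. u = p @ i # q \<longrightarrow> i < normal_number (w p)}"

definition position :: "int ^ 'd \<Rightarrow> (vertex \<Rightarrow> ('d::finite) node) \<Rightarrow> vertex \<Rightarrow> int ^ 'd" where
  "position z w u = z + (\<Sum>k\<le>length u. edge (w (take k u)))"

text \<open>
  The spine below a special root. Unlike \<open>spine\<close>, it is defined from the root downwards through subtrees,
  as in the recursion for \<open>special_avoids\<close>.
\<close>

primrec special_line :: "nat \<Rightarrow> (vertex \<Rightarrow> ('d::finite) node) \<Rightarrow> vertex" where
  "special_line 0 w = []"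
| "special_line (Suc k) w = special_pos (w []) # special_line k (subfield (special_pos (w [])) w)"

lemma normal_tree_Nil [simp]: "[] \<in> normal_tree w"
  by (simp add: normal_tree_def)

lemma normal_tree_Cons [simp]:
  "i # u \<in> normal_tree w \<longleftrightarrow> i < normal_number (w []) \<and> u \<in> normal_tree (subfield i w)"
  unfolding normal_tree_def subfield_def by (auto simp: Cons_eq_append_conv)

lemma position_Nil [simp]: "position z w [] = z + edge (w [])"
  by (simp add: position_def)

lemma position_Cons [simp]: "position z w (i # u) = position (z + edge (w [])) (subfield i w) u"
  unfolding position_def subfield_def by (simp add: sum.atMost_Suc_shift add.assoc del: sum.atMost_Suc)

lemma normal_avoids_iff:
  "normal_avoids A n w z \<longleftrightarrow> (\<forall>u\<in>normal_tree w. length u < n \<longrightarrow> position z w u \<notin> A)"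
proof (induction n arbitrary: w z)
  case (Suc n)
  have "(\<forall>u\<in>normal_tree w. length u < Suc n \<longrightarrow> position z w u \<notin> A) \<longleftrightarrow>
     z + edge (w []) \<notin> A \<and> (\<forall>i<normal_number (w []). \<forall>u\<in>normal_tree (subfield i w).
        length u < n \<longrightarrow> position (z + edge (w [])) (subfield i w) u \<notin> A)" (is "?l \<longleftrightarrow> ?r")
  proof
    assume l: ?l
    have "z + edge (w []) \<notin> A" using bspec[OF l, of "[]"] by simp
    moreover have "position (z + edge (w [])) (subfield i w) u \<notin> A"
      if "i < normal_number (w [])" "u \<in> normal_tree (subfield i w)" "length u < n" for i u
      using bspec[OF l, of "i # u"] that by simp
    ultimately show ?r by blast
  next
    assume r: ?r
    show ?l
    proof (intro ballI impI)
      fix u assume "u \<in> normal_tree w" "length u < Suc n"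
      then show "position z w u \<notin> A" using r by (cases u) auto
    qed
  qed
  then show ?case using Suc by simp
qed simp

lemma normal_avoids_all_iff:
  "(\<forall>n. normal_avoids A n w z) \<longleftrightarrow> (\<forall>u\<in>normal_tree w. position z w u \<notin> A)"
  unfolding normal_avoids_iff by blast

lemma special_avoids_iff:
  "special_avoids A n w z \<longleftrightarrow> (\<forall>k<n. position z w (special_line k w) \<notin> A \<and>
     (\<forall>i<special_pos (w (special_line k w)). \<forall>v\<in>normal_tree (\<lambda>u. w (special_line k w @ i # u)).
        position z w (special_line k w @ i # v) \<notin> A))"
proof (induction n arbitrary: w z)
  case (Suc n)
  show ?case
    unfolding All_less_Suc2 special_avoids.simps Suc normal_avoids_all_iff
    by (simp add: subfield_def[abs_def])
qed simp

lemma special_line_Suc: "special_line (Suc k) w = special_line k w @ [special_pos (w (special_line k w))]"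
proof (induction k arbitrary: w)
  case (Suc k)
  define w' where "w' = subfield (special_pos (w [])) w"
  have "special_line (Suc (Suc k)) w = special_pos (w []) # special_line (Suc k) w'"
    unfolding w'_def by (rule special_line.simps)
  also have "special_line (Suc k) w' = special_line k w' @ [special_pos (w' (special_line k w'))]"
    by (rule Suc)
  also have "special_pos (w []) # \<dots> = special_line (Suc k) w @ [special_pos (w (special_line (Suc k) w))]"
    by (simp add: w'_def subfield_def)
  finally show ?case .
qed simp

lemma tree_iff: "u \<in> tree t \<longleftrightarrow> (\<forall>p i q. u = p @ i # q \<longrightarrow> i < offspring_number t p)"
proof
  assume "u \<in> tree t"
  then show "\<forall>p i q. u = p @ i # q \<longrightarrow> i < offspring_number t p"
  proof (induction rule: tree.induct)
    case (child u i)
    show ?case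
    proof (intro allI impI)
      fix p j q assume "u @ [i] = p @ j # q"
      then show "j < offspring_number t p"
        using child by (cases q rule: rev_cases) auto
    qed
  qed simp
next
  assume "\<forall>p i q. u = p @ i # q \<longrightarrow> i < offspring_number t p"
  then show "u \<in> tree t"
  proof (induction u rule: rev_induct)
    case Nil
    show ?case by (rule tree.root)
  next
    case (snoc i u)
    have "i < offspring_number t u" using snoc.prems by simp
    moreover have "u \<in> tree t"
    proof (rule snoc.IH, intro allI impI)
      fix p j q assume "u = p @ j # q"
      then show "j < offspring_number t p" using snoc.prems by simp
    qed
    ultimately show ?case by (rule tree.child[rotated])
  qed
qed

lemma length_spine [simp]: "length (spine t k) = k"
  by (induction k) auto

lemma take_spine: "k \<le> l \<Longrightarrow> take k (spine t l) = spine t k"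
  by (induction l) (auto simp: le_Suc_eq)

lemma spine_prefix:
  assumes "spine t k @ i # v = spine t l"
  shows "i = special_position t (spine t k)"
proof -
  have "length (spine t k @ i # v) = length (spine t l)" using assms by simp
  then have "Suc k \<le> l" by simp
  then have "take (Suc k) (spine t k @ i # v) = spine t (Suc k)"
    unfolding assms by (rule take_spine)
  then show ?thesis by simp
qed

lemma spine_eq_special_line:
  assumes "\<And>u. fst (w u) = t (0 # u)"
  shows "spine t (Suc k) = 0 # special_line k w"
proof (induction k)
  case 0
  then show ?case by (simp add: special_position_def)
next
  case (Suc k)
  have "spine t (Suc (Suc k)) = spine t (Suc k) @ [special_position t (spine t (Suc k))]"
    by (rule spine.simps)
  also have "\<dots> = 0 # special_line (Suc k) w"
    unfolding Suc special_line_Suc using assms by (simp add: special_position_def special_pos_def)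
  finally show ?case .
qed

text \<open>
  To the left of the spine no vertex is special, and along the spine the tree contains the next vertex
  because the special position is smaller than the offspring number.
\<close>

lemma left_tree_iff:
  assumes good: "\<And>u. snd (snd (t u)) < fst (snd (t u))"
    and i: "i < special_position t (spine t k)"
  shows "spine t k @ i # v \<in> tree t \<longleftrightarrow>
    (\<forall>p j q. v = p @ j # q \<longrightarrow> j < fst (t (spine t k @ i # p)))"
proof -
  have off: "spine t k @ i # p \<notin> range (spine t)" for p
    using spine_prefix[of t k i p] i by auto
  have num: "offspring_number t (spine t k @ i # p) = fst (t (spine t k @ i # p))" for p
    using off[of p] by (simp add: offspring_number_def)
  have on: "special_position t (spine t l) < offspring_number t (spine t l)" for l
    using good by (auto simp: offspring_number_def special_position_def)
  show ?thesis
  proof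
    assume "spine t k @ i # v \<in> tree t"
    then have *: "\<And>p j q. spine t k @ i # v = p @ j # q \<Longrightarrow> j < offspring_number t p"
      by (simp add: tree_iff)
    show "\<forall>p j q. v = p @ j # q \<longrightarrow> j < fst (t (spine t k @ i # p))"
    proof (intro allI impI)
      fix p j q assume "v = p @ j # q"
      then show "j < fst (t (spine t k @ i # p))" using *[of "spine t k @ i # p" j q] num by simp
    qed
  next
    assume r: "\<forall>p j q. v = p @ j # q \<longrightarrow> j < fst (t (spine t k @ i # p))"
    show "spine t k @ i # v \<in> tree t"
      unfolding tree_iff
    proof (intro allI impI)
      fix p j q assume eq: "spine t k @ i # v = p @ j # q"
      (* The branching vertex p lies on the spine above level k, is the vertex of level k, or is to the
         left of the spine. *)
      consider "length p < k" | "length p = k" | "length p > k" by linarith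
      then show "j < offspring_number t p"
      proof cases
        case 1
        have "take (length p) (spine t k @ i # v) = p" unfolding eq by simp
        then have p: "p = spine t (length p)" using 1 take_spine[of "length p" k t] by simp
        have "take (Suc (length p)) (spine t k @ i # v) = p @ [j]" unfolding eq by simp
        then have "p @ [j] = spine t (Suc (length p))"
          using 1 take_spine[of "Suc (length p)" k t] by (simp del: spine.simps)
        then have "last (p @ [j]) = last (spine t (Suc (length p)))" by (rule arg_cong)
        then have "j = special_position t (spine t (length p))" by (simp only: spine.simps last_snoc)
        then show ?thesis using on[of "length p"] p by simp
      next
        case 2
        then have "spine t k = p" "i = j" using eq by (auto simp: append_eq_append_conv)
        then show ?thesis using i on[of k] by simp
      next
        case 3
        obtain r where r': "p = spine t k @ r" "r \<noteq> []"
        proof -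
          have "take k (spine t k @ i # v) = take k p" unfolding eq using 3 by simp
          then have "spine t k = take k p" by simp
          then have "p = spine t k @ drop k p" by simp
          moreover have "drop k p \<noteq> []" using 3 by simp
          ultimately show ?thesis using that by blast
        qed
        then obtain p' where "r = i # p'" "v = p' @ j # q" using eq by (cases r) auto
        then show ?thesis using r r' num by simp
      qed
    qed
  qed
qed

text \<open>
  The root has no offspring to the left of its special one, which is the word \<open>[0]\<close>. So the past is the
  spine of the subtree at \<open>[0]\<close> together with everything to its left in this subtree.
\<close>

lemma past_avoids_iff:
  assumes good: "\<And>u. snd (snd (t u)) < fst (snd (t u))"
  shows "past_range x t \<xi> \<inter> A = {} \<longleftrightarrow> (\<forall>n. special_avoids A n (subfield 0 (\<lambda>u. (t u, \<xi> u))) x)"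
proof -
  define w where "w = subfield 0 (\<lambda>u. (t u, \<xi> u))"
  have fw: "fst (w u) = t (0 # u)" for u by (simp add: w_def subfield_def)
  have sw: "edge (w u) = \<xi> (0 # u)" for u by (simp add: w_def subfield_def edge_def)
  have sp: "spine t (Suc k) = 0 # special_line k w" for k by (rule spine_eq_special_line) (rule fw)
  have spos: "special_position t (0 # special_line k w) = special_pos (w (special_line k w))" for k
    using fw by (simp add: special_position_def special_pos_def)
  have walk: "tree_walk x \<xi> (0 # u) = position x w u" for u
  proof -
    have "(\<Sum>k = 1..length (0 # u). \<xi> (take k (0 # u))) = (\<Sum>k\<le>length u. \<xi> (take (Suc k) (0 # u)))"
      by (rule sum.reindex_bij_witness[of _ Suc "\<lambda>k. k - 1"]) auto
    then show ?thesis by (simp add: tree_walk_def position_def sw)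
  qed
  have left: "0 # special_line k w @ i # v \<in> tree t \<longleftrightarrow> v \<in> normal_tree (\<lambda>u. w (special_line k w @ i # u))"
    if "i < special_pos (w (special_line k w))" for k i v
    using left_tree_iff[of t i "Suc k" v] good that
    unfolding sp spos by (simp add: normal_tree_def normal_number_def fw)
  have past: "past t = (\<Union>k. {0 # special_line k w}) \<union>
     (\<Union>k. {0 # special_line k w @ i # v | i v. i < special_pos (w (special_line k w)) \<and>
         v \<in> normal_tree (\<lambda>u. w (special_line k w @ i # u))})" (is "_ = ?S \<union> ?L")
  proof -
    have "range (spine t) - {[]} = ?S"
    proof (intro set_eqI iffI)
      fix u assume "u \<in> range (spine t) - {[]}"
      then obtain k where k: "u = spine t k" "u \<noteq> []" by auto
      then obtain k' where "k = Suc k'" by (cases k) auto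
      then show "u \<in> ?S" using k sp by auto
    next
      fix u assume "u \<in> ?S"
      then obtain k where k: "u = spine t (Suc k)" using sp by auto
      have "u \<in> range (spine t)" unfolding k by (rule rangeI)
      moreover have "u \<noteq> []" unfolding k sp by simp
      ultimately show "u \<in> range (spine t) - {[]}" by simp
    qed
    moreover have "left_of_spine t = ?L"
    proof (intro set_eqI iffI)
      fix u assume "u \<in> left_of_spine t"
      then obtain k i v where u: "u \<in> tree t" "u = spine t k @ i # v" "i < special_position t (spine t k)"
        by (auto simp: left_of_spine_def)
      then obtain k' where k: "k = Suc k'" by (cases k) (auto simp: special_position_def)
      have i: "i < special_pos (w (special_line k' w))" using u(3) unfolding k sp spos .
      have "u = 0 # special_line k' w @ i # v" using u(2) unfolding k sp by simp
      then show "u \<in> ?L" using left[OF i, of v] u(1) i by blast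
    next
      fix u assume "u \<in> ?L"
      then obtain k i v where u: "u = 0 # special_line k w @ i # v" "i < special_pos (w (special_line k w))"
         "v \<in> normal_tree (\<lambda>u. w (special_line k w @ i # u))" by blast
      have "u \<in> tree t" using left[OF u(2), of v] u by simp
      moreover have "u = spine t (Suc k) @ i # v" "i < special_position t (spine t (Suc k))"
        unfolding sp spos using u by simp_all
      ultimately show "u \<in> left_of_spine t" unfolding left_of_spine_def by blast
    qed
    ultimately show ?thesis unfolding past_def by simp
  qed
  have "past_range x t \<xi> \<inter> A = {} \<longleftrightarrow> (\<forall>u\<in>past t. tree_walk x \<xi> u \<notin> A)"
    unfolding past_range_def by blast
  also have "\<dots> \<longleftrightarrow> (\<forall>k. tree_walk x \<xi> (0 # special_line k w) \<notin> A \<and>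
     (\<forall>i<special_pos (w (special_line k w)). \<forall>v\<in>normal_tree (\<lambda>u. w (special_line k w @ i # u)).
        tree_walk x \<xi> (0 # special_line k w @ i # v) \<notin> A))"
    unfolding past by blast
  also have "\<dots> \<longleftrightarrow> (\<forall>n. special_avoids A n w x)"
    unfolding walk special_avoids_iff by blast
  finally show ?thesis by (simp only: w_def)
qed

lemma pred_field_component: "Measurable.pred (field_measure N) (\<lambda>t. Q (t u))"
  by (rule measurable_compose[OF measurable_field_component]) simp

lemma pred_special_position: "Measurable.pred (field_measure N) (\<lambda>t. Q (special_position t u))"
  unfolding special_position_def by (cases "u = []") (simp_all add: pred_field_component[where Q = "\<lambda>a. Q (snd (snd a))"])

lemma pred_spine_eq: "Measurable.pred (field_measure N) (\<lambda>t. spine t k = v)"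
proof (induction k arbitrary: v)
  case 0
  then show ?case by simp
next
  case (Suc k)
  have "spine t (Suc k) = v \<longleftrightarrow> v \<noteq> [] \<and> spine t k = butlast v \<and> special_position t (butlast v) = last v" for t
    by (cases v rule: rev_cases) auto
  then show ?case
    using Suc[of "butlast v"] pred_special_position[where Q = "\<lambda>i. i = last v" and u = "butlast v"]
    by (simp only:) (intro pred_intros_logic; simp)
qed

lemma pred_on_spine: "Measurable.pred (field_measure N) (\<lambda>t. u \<in> range (spine t))"
proof -
  have "u \<in> range (spine t) \<longleftrightarrow> (\<exists>k. spine t k = u)" for t by auto
  then show ?thesis by (simp only:) (intro pred_intros_countable pred_spine_eq)
qed

lemma pred_tree: "Measurable.pred (field_measure N) (\<lambda>t. u \<in> tree t)"
proof -
  have num: "Measurable.pred (field_measure N) (\<lambda>t. i < offspring_number t p)" for i p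
  proof (cases "p = []")
    case True
    then show ?thesis using pred_field_component[where Q = "\<lambda>a. i < Suc (fst a)" and u = p] by (simp add: offspring_number_def)
  next
    case False
    have "i < offspring_number t p \<longleftrightarrow> (p \<in> range (spine t) \<and> i < fst (snd (t p)))
        \<or> (\<not> p \<in> range (spine t) \<and> i < fst (t p))" for t
      using False by (simp add: offspring_number_def)
    then show ?thesis
      by (simp only:) (intro pred_intros_logic pred_on_spine pred_field_component)
  qed
  show ?thesis
    unfolding tree_iff by (intro pred_intros_countable pred_intros_logic num) simp
qed

lemma pred_past: "Measurable.pred (field_measure N) (\<lambda>t. u \<in> past t)"
proof -
  have "u \<in> past t \<longleftrightarrow> (u \<in> range (spine t) \<and> u \<noteq> []) \<or> (u \<in> tree t \<and>
      (\<exists>k p i v. spine t k = p \<and> u = p @ i # v \<and> i < special_position t p))" for t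
    unfolding past_def left_of_spine_def by blast
  then show ?thesis
    by (simp only:) (intro pred_intros_logic pred_intros_countable pred_on_spine pred_tree pred_spine_eq pred_special_position)
qed

lemma measurable_sum_field:
  fixes N :: "('a :: {countable, ab_group_add}) pmf"
  assumes "finite I"
  shows "(\<lambda>x. \<Sum>i\<in>I. x (g i)) \<in> measurable (field_measure N) (count_space UNIV)"
  using assms
proof (induction I)
  case empty
  then show ?case by simp
next
  case (insert i I)
  show ?case
  proof (subst measurable_count_space_eq_countable; (intro conjI ballI)?)
    fix c
    have "{x. x (g i) = y} \<in> sets (field_measure N)" for y
      using sets_field_Collect[of "{i}" g "\<lambda>_. {y}" N] by simp
    moreover have "{x. (\<Sum>j\<in>I. x (g j)) = y} \<in> sets (field_measure N)" for y
      using measurable_sets[OF insert.IH, of "{y}"] by (simp add: vimage_def)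
    ultimately have "(\<Union>y. {x. x (g i) = c - y} \<inter> {x. (\<Sum>j\<in>I. x (g j)) = y}) \<in> sets (field_measure N)"
      by (intro sets.countable_UN') auto
    also have "(\<Union>y. {x. x (g i) = c - y} \<inter> {x. (\<Sum>j\<in>I. x (g j)) = y})
        = (\<lambda>x. \<Sum>j\<in>insert i I. x (g j)) -` {c} \<inter> space (field_measure N)"
      using insert by (auto simp: algebra_simps)
    finally show "(\<lambda>x. \<Sum>j\<in>insert i I. x (g j)) -` {c} \<inter> space (field_measure N) \<in> sets (field_measure N)" .
  qed auto
qed

lemma pred_tree_walk: "Measurable.pred (field_measure N) (\<lambda>x. Q (tree_walk z x u))"
  unfolding tree_walk_def
  by (rule measurable_compose[OF measurable_sum_field[of "{1..length u}" "\<lambda>k. take k u"]]) simp_all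

context offspring_law
begin

lemma special_position_less_offspring: "AE a in measure_pmf node_law. snd (snd (fst a)) < fst (snd (fst a))"
proof -
  have *: "k \<noteq> 0" if "k \<in> set_pmf (size_biased \<mu>)" for k
    using that by (auto simp: set_pmf_iff pmf_size_biased)
  have "snd l < fst l" if "l \<in> set_pmf (special_offspring \<mu>)" for l
    using that by (auto simp: special_offspring_def set_pmf_of_set lessThan_empty_iff dest!: *)
  then show ?thesis
    by (auto simp: AE_measure_pmf_iff node_law_def)
qed

text \<open>
  The subtree at the first offspring of the root has the law of the whole family of labels, and the set
  on which special positions are too large is null. Measurability of the event in the definition of the
  capacity has to be checked, as \<open>measure\<close> is 0 on other sets.
\<close>

lemma prob_past_avoids:
  fixes A :: "(int ^ 'd) set"
  shows "measure (tree_walk_measure \<mu>)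
     {\<omega> \<in> space (tree_walk_measure \<mu>). past_range x (fst \<omega>) (snd \<omega>) \<inter> A = {}} = escape_lim A x"
proof -
  let ?S = "field_measure (pair_pmf \<mu> (special_offspring \<mu>))"
  let ?X = "field_measure (step_pmf :: (int ^ 'd) pmf)"
  let ?M = "tree_walk_measure \<mu> :: (seed \<times> (vertex \<Rightarrow> int ^ 'd)) measure"
  let ?W = "field_measure (node_law :: 'd node pmf)"
  let ?f = "\<lambda>(t, x) u. (t u, x u)"
  have M: "?M = ?S \<Otimes>\<^sub>M ?X"
    by (simp add: tree_walk_measure_def seed_measure_def increment_measure_def field_measure_def)
  interpret S: prob_space ?S by (rule prob_space_field_measure)
  interpret X: prob_space ?X by (rule prob_space_field_measure)
  interpret SX: pair_prob_space ?S ?X by unfold_locales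
  interpret M: prob_space ?M unfolding M by (rule SX.prob_space_axioms)
  have spM: "space ?M = UNIV" unfolding M by (simp add: space_pair_measure)
  have law: "distr ?M ?W ?f = ?W"
    unfolding M node_law_def by (rule field_measure_pair) auto
  have f: "?f \<in> measurable ?M ?W"
  proof (rule measurable_into_field)
    fix u
    have "(\<lambda>w. (fst w u, snd w u)) \<in> measurable ?M (count_space UNIV \<Otimes>\<^sub>M count_space UNIV)"
      unfolding M by measurable
    then show "(\<lambda>w. ?f w u) \<in> measurable ?M (count_space UNIV)"
      by (simp add: pair_measure_countable case_prod_beta)
  qed
  define E where "E = {w :: vertex \<Rightarrow> 'd node. \<forall>n. special_avoids A n w x}"
  have E: "E \<in> sets ?W"
  proof -
    have "(\<Inter>n. {w. special_avoids A n w x}) \<in> sets ?W"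
      by (intro sets.countable_INT' sets_special_avoids) (auto simp: sets_special_avoids)
    then show ?thesis by (simp add: Collect_all_eq E_def)
  qed
  have E0: "{w. subfield 0 w \<in> E} \<in> sets ?W" by (rule sets_subfield[OF E])
  have "measure ?M (?f -` {w. subfield 0 w \<in> E} \<inter> space ?M) = measure ?W {w. subfield 0 w \<in> E}"
    using measure_distr[OF f E0] unfolding law by simp
  also have "\<dots> = measure ?W E"
    using measure_distr[OF measurable_subfield E, of 0] unfolding distr_subfield by (simp add: vimage_def)
  also have "\<dots> = escape_lim A x"
    unfolding E_def by (rule measure_special_avoids_all)
  finally have 1: "measure ?M (?f -` {w. subfield 0 w \<in> E} \<inter> space ?M) = escape_lim A x" .
  have "AE w in ?W. \<forall>u. snd (snd (fst (w u))) < fst (snd (fst (w u)))"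
    unfolding AE_all_countable
  proof
    fix u
    show "AE w in ?W. snd (snd (fst (w u))) < fst (snd (fst (w u)))"
      unfolding field_measure_def
      by (rule AE_PiM_component[where P = "\<lambda>a. snd (snd (fst a)) < fst (snd (fst a))"])
         (simp_all add: special_position_less_offspring measure_pmf.prob_space_axioms)
  qed
  then have "AE w in distr ?M ?W ?f. \<forall>u. snd (snd (fst (w u))) < fst (snd (fst (w u)))"
    unfolding law .
  then have good: "AE \<omega> in ?M. \<forall>u. snd (snd (fst \<omega> u)) < fst (snd (fst \<omega> u))"
    by (drule_tac AE_distrD[OF f]) (simp add: case_prod_beta)
  have "measure ?M {\<omega> \<in> space ?M. past_range x (fst \<omega>) (snd \<omega>) \<inter> A = {}}
      = measure ?M (?f -` {w. subfield 0 w \<in> E} \<inter> space ?M)"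
  proof (rule M.finite_measure_eq_AE)
    show "AE \<omega> in ?M. \<omega> \<in> {\<omega> \<in> space ?M. past_range x (fst \<omega>) (snd \<omega>) \<inter> A = {}}
        \<longleftrightarrow> \<omega> \<in> ?f -` {w. subfield 0 w \<in> E} \<inter> space ?M"
      using good
    proof eventually_elim
      case (elim \<omega>)
      then show ?case
        using past_avoids_iff[of "fst \<omega>" x "snd \<omega>" A] by (simp add: spM E_def case_prod_beta)
    qed
    show "?f -` {w. subfield 0 w \<in> E} \<inter> space ?M \<in> sets ?M"
      by (rule measurable_sets[OF f E0])
    have "Measurable.pred ?M (\<lambda>\<omega>. \<forall>u. u \<in> past (fst \<omega>) \<longrightarrow> tree_walk x (snd \<omega>) u \<notin> A)"
      unfolding M
      by (intro pred_intros_countable pred_intros_logic measurable_compose[OF measurable_fst pred_past]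
          measurable_compose[OF measurable_snd pred_tree_walk])
    then have "{\<omega> \<in> space ?M. \<forall>u. u \<in> past (fst \<omega>) \<longrightarrow> tree_walk x (snd \<omega>) u \<notin> A} \<in> sets ?M"
      by (rule predE)
    also have "{\<omega> \<in> space ?M. \<forall>u. u \<in> past (fst \<omega>) \<longrightarrow> tree_walk x (snd \<omega>) u \<notin> A}
        = {\<omega> \<in> space ?M. past_range x (fst \<omega>) (snd \<omega>) \<inter> A = {}}"
      unfolding past_range_def by blast
    finally show "{\<omega> \<in> space ?M. past_range x (fst \<omega>) (snd \<omega>) \<inter> A = {}} \<in> sets ?M" .
  qed
  then show ?thesis using 1 by simp
qed

lemma BCap_eq_capacity: "BCap \<mu> A = capacity A"
  unfolding BCap_def capacity_def prob_past_avoids ..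

end

section \<open>Return probabilities\<close>

primrec walk_kernel :: "nat \<Rightarrow> int ^ 'd \<Rightarrow> real" where
  "walk_kernel 0 = (\<lambda>x. if x = 0 then 1 else 0)"
| "walk_kernel (Suc n) = avg (walk_kernel n)"

primrec line_kernel :: "nat \<Rightarrow> int \<Rightarrow> real" where
  "line_kernel 0 a = (if a = 0 then 1 else 0)"
| "line_kernel (Suc k) a = (line_kernel k (a - 1) + line_kernel k (a + 1)) / 2"

text \<open>
  After \<open>k\<close> steps the position is \<open>2 j - k\<close> if \<open>j\<close> of them go up.
\<close>

lemma line_kernel_even:
  "line_kernel k (2 * j - int k) = (if j < 0 then 0 else real (k choose nat j) / 2 ^ k)"
proof (induction k arbitrary: j)
  case 0
  then show ?case by (auto simp: binomial_eq_0 not_less)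
next
  case (Suc k)
  have "line_kernel (Suc k) (2 * j - int (Suc k))
      = (line_kernel k (2 * (j - 1) - int k) + line_kernel k (2 * j - int k)) / 2"
    by (simp add: algebra_simps)
  also have "\<dots> = (if j < 0 then 0 else real (Suc k choose nat j) / 2 ^ Suc k)"
  proof (cases "j \<le> 0")
    case True
    then show ?thesis unfolding Suc by auto
  next
    case False
    define i where "i = nat (j - 1)"
    have "nat (j - 1) = i" "nat j = Suc i" "\<not> j - 1 < 0" "\<not> j < 0"
      using False by (auto simp: i_def)
    then show ?thesis unfolding Suc by (simp add: add_divide_distrib)
  qed
  finally show ?case .
qed

lemma line_kernel_odd: "line_kernel k (2 * j + 1 - int k) = 0"
proof (induction k arbitrary: j)
  case 0
  have "2 * j + 1 \<noteq> 0" by presburger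
  then show ?case by simp
next
  case (Suc k)
  show ?case using Suc[of "j - 1"] Suc[of j] by (simp add: algebra_simps)
qed

text \<open>
  The ratio of consecutive central terms is \<open>(2 m + 1) / (2 m + 2)\<close>, and its square times \<open>2 m + 3\<close> is at
  most \<open>2 m + 1\<close>.
\<close>

lemma central_binomial_bound: "(real (2 * m choose m) / 4 ^ m)\<^sup>2 * (2 * real m + 1) \<le> 1"
  and odd_binomial_bound: "(real (2 * m + 1 choose m) / 2 ^ (2 * m + 1))\<^sup>2 * (2 * real m + 3) \<le> 1"
proof -
  have odd_eq: "2 * m + 1 choose Suc m = 2 * m + 1 choose m" for m
    using central_binomial_odd[of "2 * m + 1"] by simp
  have step: "(real m + 1) * real (2 * m + 1 choose m) = (2 * real m + 1) * real (2 * m choose m)" for m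
  proof -
    have "Suc m * (Suc (2 * m) choose Suc m) = Suc (2 * m) * (2 * m choose m)" by (rule Suc_times_binomial)
    then have "Suc m * (2 * m + 1 choose m) = Suc (2 * m) * (2 * m choose m)" using odd_eq[of m] by simp
    then have "real (Suc m * (2 * m + 1 choose m)) = real (Suc (2 * m) * (2 * m choose m))" by (rule arg_cong)
    then show ?thesis by (simp only: of_nat_mult of_nat_Suc) (simp add: algebra_simps)
  qed
  have two: "real (2 * Suc m choose Suc m) = 2 * real (2 * m + 1 choose m)" for m
    using odd_eq[of m] by (simp add: binomial_Suc_Suc)
  have half: "real (2 * Suc m choose Suc m) / 4 ^ Suc m = real (2 * m choose m) / 4 ^ m * ((2 * real m + 1) / (2 * real m + 2))" for m
  proof -
    have "real m + 1 \<noteq> 0" by linarith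
    then have X: "real (2 * m + 1 choose m) = (2 * real m + 1) * real (2 * m choose m) / (real m + 1)"
      using step[of m] by (simp add: eq_divide_eq mult.commute del: binomial_Suc_Suc)
    have eq: "2 * real m + 2 = 2 * (real m + 1)" by simp
    have "2 * (a * Q / R) / 4 ^ Suc m = Q / 4 ^ m * (a / (2 * R))" for a Q R :: real by simp
    then show ?thesis unfolding two X eq .
  qed
  have main: "(real (2 * m choose m) / 4 ^ m)\<^sup>2 * (2 * real m + 1) \<le> 1" for m
  proof (induction m)
    case (Suc m)
    define r where "r = real m"
    have r: "r \<ge> 0" by (simp add: r_def)
    have "((2 * r + 1) / (2 * r + 2))\<^sup>2 * (2 * r + 3) \<le> 2 * r + 1"
    proof -
      have "(2 * r + 1) * ((2 * r + 1) * (2 * r + 3)) \<le> (2 * r + 1) * (2 * r + 2)\<^sup>2"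
        using r by (intro mult_left_mono) (auto simp: power2_eq_square algebra_simps)
      then have "((2 * r + 1) * ((2 * r + 1) * (2 * r + 3))) / (2 * r + 2)\<^sup>2 \<le> 2 * r + 1"
        using r by (subst pos_divide_le_eq) auto
      then show ?thesis by (simp add: power_divide power2_eq_square mult_ac)
    qed
    then have "(real (2 * m choose m) / 4 ^ m)\<^sup>2 * (((2 * r + 1) / (2 * r + 2))\<^sup>2 * (2 * r + 3))
        \<le> (real (2 * m choose m) / 4 ^ m)\<^sup>2 * (2 * r + 1)"
      by (rule mult_left_mono) simp
    also have "\<dots> \<le> 1" using Suc by (simp add: r_def)
    finally have "(real (2 * m choose m) / 4 ^ m)\<^sup>2 * (((2 * r + 1) / (2 * r + 2))\<^sup>2 * (2 * r + 3)) \<le> 1" .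
    moreover have "2 * real (Suc m) + 1 = 2 * r + 3" by (simp add: r_def)
    ultimately show ?case unfolding half power_mult_distrib by (simp only: r_def mult.assoc)
  qed simp
  show "(real (2 * m choose m) / 4 ^ m)\<^sup>2 * (2 * real m + 1) \<le> 1" by (rule main)
  have "real (2 * m + 1 choose m) / 2 ^ (2 * m + 1) = real (2 * Suc m choose Suc m) / 4 ^ Suc m"
    unfolding two by (simp add: power_mult)
  then show "(real (2 * m + 1 choose m) / 2 ^ (2 * m + 1))\<^sup>2 * (2 * real m + 3) \<le> 1"
    using main[of "Suc m"] by (simp add: algebra_simps)
qed

lemma line_kernel_nonneg: "0 \<le> line_kernel k a"
  by (induction k arbitrary: a) auto

lemma line_kernel_le: "line_kernel k a \<le> 1 / sqrt (real k + 1)"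
proof -
  have central: "real (k choose j) / 2 ^ k \<le> 1 / sqrt (real k + 1)" for j
  proof -
    define c where "c = real (k choose (k div 2)) / 2 ^ k"
    have "c\<^sup>2 * (real k + 1) \<le> 1"
    proof (cases "even k")
      case True
      then obtain m where k: "k = 2 * m" by (rule evenE)
      show ?thesis using central_binomial_bound[of m] by (simp add: c_def k power_mult)
    next
      case False
      then obtain m where k: "k = 2 * m + 1" by (rule oddE)
      have "c\<^sup>2 * (real k + 1) \<le> c\<^sup>2 * (2 * real m + 3)" by (intro mult_left_mono) (auto simp: k)
      also have "\<dots> \<le> 1" using odd_binomial_bound[of m] by (simp add: c_def k)
      finally show ?thesis .
    qed
    then have "(c * sqrt (real k + 1))\<^sup>2 \<le> 1\<^sup>2" by (simp add: power_mult_distrib)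
    then have "c * sqrt (real k + 1) \<le> 1" by (rule power2_le_imp_le) simp
    then have "c \<le> 1 / sqrt (real k + 1)" by (simp add: pos_le_divide_eq)
    moreover have "real (k choose j) / 2 ^ k \<le> c"
      unfolding c_def by (intro divide_right_mono) (auto intro: binomial_maximum)
    ultimately show ?thesis by linarith
  qed
  have "even (a + int k) \<or> odd (a + int k)" by blast
  then show ?thesis
  proof
    assume "even (a + int k)"
    then obtain j where "a + int k = 2 * j" by (rule evenE)
    then have "a = 2 * j - int k" by simp
    then show ?thesis using central[of "nat j"] by (simp add: line_kernel_even)
  next
    assume "odd (a + int k)"
    then obtain j where "a + int k = 2 * j + 1" by (rule oddE)
    then have "a = 2 * j + 1 - int k" by simp
    then show ?thesis by (simp add: line_kernel_odd)
  qed
qed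

text \<open>
  The expectation of \<open>F\<close> at the multinomial vector that counts how many of \<open>n\<close> steps go in each
  direction.
\<close>

primrec count_avg :: "nat \<Rightarrow> (('d :: finite \<Rightarrow> nat) \<Rightarrow> real) \<Rightarrow> real" where
  "count_avg 0 F = F (\<lambda>_. 0)"
| "count_avg (Suc n) F = (\<Sum>i\<in>UNIV. count_avg n (\<lambda>c. F (c(i := Suc (c i))))) / real CARD('d)"

lemma count_avg_mono: "(\<And>c. F c \<le> G c) \<Longrightarrow> count_avg n F \<le> count_avg n G"
  by (induction n arbitrary: F G) (auto intro!: divide_right_mono sum_mono)

lemma count_avg_add: "count_avg n (\<lambda>c. F c + G c) = count_avg n F + count_avg n G"
  by (induction n arbitrary: F G) (simp_all add: sum.distrib add_divide_distrib)

lemma count_avg_cmult: "count_avg n (\<lambda>c. a * F c) = a * count_avg n F"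
  by (induction n arbitrary: F) (simp_all add: sum_distrib_left[symmetric])

lemma count_avg_const: "count_avg n (\<lambda>_. a) = a"
  by (induction n) simp_all

lemma count_avg_square_le:
  fixes F :: "('d :: finite \<Rightarrow> nat) \<Rightarrow> real"
  shows "(count_avg n F)\<^sup>2 \<le> count_avg n (\<lambda>c. (F c)\<^sup>2)"
proof -
  define m where "m = count_avg n F"
  have "count_avg n (\<lambda>c :: 'd \<Rightarrow> nat. 0) \<le> count_avg n (\<lambda>c. (F c - m)\<^sup>2)"
    by (intro count_avg_mono) simp
  also have "(\<lambda>c. (F c - m)\<^sup>2) = (\<lambda>c. ((F c)\<^sup>2 + (- (2 * m)) * F c) + m\<^sup>2)"
    by (simp add: power2_diff fun_eq_iff)
  also have "count_avg n \<dots> = count_avg n (\<lambda>c. (F c)\<^sup>2) + (- (2 * m)) * count_avg n F + m\<^sup>2"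
    by (simp only: count_avg_add count_avg_cmult count_avg_const)
  also have "\<dots> = count_avg n (\<lambda>c. (F c)\<^sup>2) - m\<^sup>2" by (simp add: m_def[symmetric] power2_eq_square)
  finally show ?thesis by (simp add: count_avg_const m_def)
qed

text \<open>
  Given the directions of the steps, the coordinates are independent one-dimensional walks.
\<close>

lemma walk_kernel_eq_count_avg:
  fixes x :: "int ^ 'd"
  shows "walk_kernel n x = count_avg n (\<lambda>c. \<Prod>i\<in>UNIV. line_kernel (c i) (x $ i))"
proof (induction n arbitrary: x)
  case 0
  have "(\<Prod>i\<in>UNIV. line_kernel 0 (x $ i)) = (if x = 0 then 1 else 0)"
    by (auto simp: vec_eq_iff prod_zero_iff)
  then show ?case by simp
next
  case (Suc n)
  let ?D = "real CARD('d)"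
  let ?K = "\<lambda>x c. \<Prod>i\<in>UNIV. line_kernel (c i) (x $ i)"
  have half: "?K (x + axis i 1) c + ?K (x + axis i (- 1)) c = 2 * ?K x (c(i := Suc (c i)))" for i and c :: "'d \<Rightarrow> nat"
  proof -
    have *: "?K y c = line_kernel (c i) (y $ i) * (\<Prod>j\<in>UNIV - {i}. line_kernel (c j) (y $ j))" for y c
      by (rule prod.remove) auto
    have r: "(\<Prod>j\<in>UNIV - {i}. line_kernel (c j) ((x + axis i a) $ j)) = (\<Prod>j\<in>UNIV - {i}. line_kernel (c j) (x $ j))" for a
      by (intro prod.cong) (auto simp: axis_def)
    have r': "(\<Prod>j\<in>UNIV - {i}. line_kernel ((c(i := Suc (c i))) j) (x $ j)) = (\<Prod>j\<in>UNIV - {i}. line_kernel (c j) (x $ j))"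
      by (intro prod.cong) auto
    show ?thesis
      unfolding * r r' by (simp add: axis_def algebra_simps)
  qed
  have "walk_kernel (Suc n) x = (\<Sum>i\<in>UNIV. walk_kernel n (x + axis i 1) + walk_kernel n (x + axis i (- 1))) / (2 * ?D)"
    by (simp add: avg_eq_sum sum_lattice_neighbors card_lattice_neighbors)
  also have "\<dots> = (\<Sum>i\<in>UNIV. count_avg n (\<lambda>c. 2 * ?K x (c(i := Suc (c i))))) / (2 * ?D)"
    unfolding Suc count_avg_add[symmetric] half ..
  also have "\<dots> = (\<Sum>i\<in>UNIV. count_avg n (\<lambda>c. ?K x (c(i := Suc (c i))))) / ?D"
    unfolding count_avg_cmult sum_distrib_left[symmetric] by simp
  finally show ?case by simp
qed

text \<open>
  The factor \<open>c i\<close> marks one of the \<open>n + 1\<close> steps that go in direction \<open>i\<close>; the other \<open>n\<close> steps are free.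
\<close>

lemma count_avg_size_bias:
  fixes F :: "('d :: finite \<Rightarrow> nat) \<Rightarrow> real"
  shows "count_avg (Suc n) (\<lambda>c. real (c i) * F c) = (real n + 1) / real CARD('d) * count_avg n (\<lambda>c. F (c(i := Suc (c i))))"
proof (induction n arbitrary: F)
  case 0
  have "(\<Sum>j\<in>(UNIV :: 'd set). real (((\<lambda>_. 0)(j := Suc 0)) i) * F ((\<lambda>_. 0)(j := Suc 0)))
      = (\<Sum>j\<in>UNIV. if j = i then F ((\<lambda>_. 0)(i := Suc 0)) else 0)"
    by (intro sum.cong) auto
  also have "\<dots> = F ((\<lambda>_. 0)(i := Suc 0))" by simp
  finally show ?case by (simp del: fun_upd_apply)
next
  case (Suc n)
  let ?D = "real CARD('d)" and ?s = "\<lambda>j (c :: 'd \<Rightarrow> nat). c(j := Suc (c j))"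
  have "count_avg (Suc (Suc n)) (\<lambda>c. real (c i) * F c)
      = (\<Sum>j\<in>UNIV. count_avg (Suc n) (\<lambda>c. real (?s j c i) * F (?s j c))) / ?D"
    by (rule count_avg.simps)
  also have "\<dots> = (\<Sum>j\<in>UNIV. count_avg (Suc n) (\<lambda>c. real (c i) * F (?s j c))
      + (if j = i then count_avg (Suc n) (\<lambda>c. F (?s i c)) else 0)) / ?D"
  proof -
    have "count_avg (Suc n) (\<lambda>c. real (?s j c i) * F (?s j c)) = count_avg (Suc n) (\<lambda>c. real (c i) * F (?s j c))
        + (if j = i then count_avg (Suc n) (\<lambda>c. F (?s i c)) else 0)" for j
    proof (cases "j = i")
      case True
      then show ?thesis unfolding if_P[OF True] count_avg_add[symmetric] by (simp add: algebra_simps del: count_avg.simps)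
    next
      case False
      then show ?thesis by (simp del: count_avg.simps)
    qed
    then show ?thesis by (simp only:)
  qed
  also have "\<dots> = ((\<Sum>j\<in>UNIV. count_avg (Suc n) (\<lambda>c. real (c i) * F (?s j c))) + count_avg (Suc n) (\<lambda>c. F (?s i c))) / ?D"
    by (simp add: sum.distrib del: count_avg.simps)
  also have "(\<Sum>j\<in>UNIV. count_avg (Suc n) (\<lambda>c. real (c i) * F (?s j c)))
      = (real n + 1) * ((\<Sum>j\<in>UNIV. count_avg n (\<lambda>c. F (?s j (?s i c)))) / ?D)"
    unfolding Suc.IH[of "\<lambda>c. F (?s _ c)"] unfolding sum_distrib_left[symmetric] by (simp only: times_divide_eq_left times_divide_eq_right)
  also have "(\<Sum>j\<in>UNIV. count_avg n (\<lambda>c. F (?s j (?s i c)))) / ?D = count_avg (Suc n) (\<lambda>c. F (?s i c))"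
  proof -
    have "?s j (?s i c) = ?s i (?s j c)" for j and c :: "'d \<Rightarrow> nat" by (auto simp: fun_eq_iff)
    then show ?thesis by simp
  qed
  finally show ?case by (simp add: algebra_simps add_divide_distrib del: count_avg.simps fun_upd_apply)
qed

text \<open>
  Each factor \<open>1 / (c i + 1)\<close> is traded for one more step by \<open>count_avg_size_bias\<close>, at the price of
  \<open>CARD('d) / (n + 1)\<close>.
\<close>

lemma count_avg_prod_inverse_le:
  fixes S :: "'d :: finite set"
  shows "count_avg n (\<lambda>c. \<Prod>i\<in>S. 1 / (real (c i) + 1)) \<le> (real CARD('d) / (real n + 1)) ^ card S"
proof -
  have "finite S" by simp
  then show ?thesis
  proof (induction S arbitrary: n rule: finite_induct)
    case empty
    then show ?case by (simp add: count_avg_const)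
  next
    case (insert i S)
    let ?D = "real CARD('d)" and ?P = "\<lambda>c. \<Prod>j\<in>S. 1 / (real (c j) + 1)"
    (* For c i = 0 this is 0 by the convention on division, in favour of the upper bound. *)
    define F :: "('d \<Rightarrow> nat) \<Rightarrow> real" where "F c = 1 / real (c i) * ?P c" for c
    have P0: "0 \<le> ?P c" for c :: "'d \<Rightarrow> nat" by (intro prod_nonneg) auto
    have FS: "F (c(i := Suc (c i))) = (\<Prod>j\<in>insert i S. 1 / (real (c j) + 1))" for c
    proof -
      have "?P (c(i := Suc (c i))) = ?P c" using insert by (intro prod.cong) auto
      then show ?thesis using insert by (simp add: F_def add.commute)
    qed
    have "(real n + 1) / ?D * count_avg n (\<lambda>c. \<Prod>j\<in>insert i S. 1 / (real (c j) + 1))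
        = count_avg (Suc n) (\<lambda>c. real (c i) * F c)"
      unfolding count_avg_size_bias FS ..
    also have "\<dots> \<le> count_avg (Suc n) ?P"
      using P0 by (intro count_avg_mono) (auto simp: F_def)
    also have "\<dots> \<le> (?D / (real (Suc n) + 1)) ^ card S" by (rule insert.IH)
    also have "\<dots> \<le> (?D / (real n + 1)) ^ card S"
      by (intro power_mono divide_left_mono) auto
    finally have "(real n + 1) / ?D * count_avg n (\<lambda>c. \<Prod>j\<in>insert i S. 1 / (real (c j) + 1)) \<le> (?D / (real n + 1)) ^ card S" .
    then have "?D / (real n + 1) * ((real n + 1) / ?D * count_avg n (\<lambda>c. \<Prod>j\<in>insert i S. 1 / (real (c j) + 1)))
        \<le> ?D / (real n + 1) * (?D / (real n + 1)) ^ card S"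
      by (rule mult_left_mono) simp
    moreover have "?D / (real n + 1) * ((real n + 1) / ?D * X) = X" for X by simp
    ultimately show ?case using insert by simp
  qed
qed

lemma walk_kernel_nonneg: "0 \<le> walk_kernel n x"
  by (induction n arbitrary: x) (auto intro!: avg_nonneg)

text \<open>
  The product of the bounds for the coordinates is the square root of the product in
  \<open>count_avg_prod_inverse_le\<close>; Jensen's inequality takes the root outside.
\<close>

lemma walk_kernel_le:
  fixes x :: "int ^ 'd"
  shows "walk_kernel n x \<le> sqrt ((real CARD('d) / (real n + 1)) ^ CARD('d))"
proof -
  let ?F = "\<lambda>c :: 'd \<Rightarrow> nat. \<Prod>i\<in>UNIV. 1 / sqrt (real (c i) + 1)"
  have "walk_kernel n x \<le> count_avg n ?F"
    unfolding walk_kernel_eq_count_avg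
    by (intro count_avg_mono prod_mono) (auto simp: line_kernel_nonneg line_kernel_le)
  also have "\<dots> \<le> sqrt (count_avg n (\<lambda>c. (?F c)\<^sup>2))"
    by (intro real_le_rsqrt count_avg_square_le)
  also have "(\<lambda>c. (?F c)\<^sup>2) = (\<lambda>c. \<Prod>i\<in>UNIV. 1 / (real (c i) + 1))"
    by (simp add: prod_power_distrib power_divide fun_eq_iff)
  also have "sqrt (count_avg n \<dots>) \<le> sqrt ((real CARD('d) / (real n + 1)) ^ CARD('d))"
    using count_avg_prod_inverse_le[of n "UNIV :: 'd set"] by (rule real_sqrt_le_mono)
  finally show ?thesis .
qed

lemma walk_kernel_uminus: "walk_kernel n (- x) = walk_kernel n x"
proof (induction n arbitrary: x)
  case (Suc n)
  have "(\<Sum>e\<in>lattice_neighbors. walk_kernel n (- x + e)) = (\<Sum>e\<in>lattice_neighbors. walk_kernel n (- x + - e))"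
    by (rule sum_neighbors_uminus[symmetric])
  also have "\<dots> = (\<Sum>e\<in>lattice_neighbors. walk_kernel n (x + e))"
    using Suc[of "x + _"] by simp
  finally show ?case by (simp add: avg_eq_sum)
qed simp

section \<open>Averages over walks of a given length\<close>

text \<open>
  The expectation over \<open>n\<close> independent steps, by conditioning on the first one. It is a finite
  sum, so that it is linear and monotone for arbitrary functionals of the steps.
\<close>

primrec walk_avg :: "nat \<Rightarrow> ((int ^ 'd) list \<Rightarrow> real) \<Rightarrow> real" where
  "walk_avg 0 F = F []"
| "walk_avg (Suc n) F = avg (\<lambda>e. walk_avg n (\<lambda>l. F (e # l))) 0"

primrec walk_path :: "int ^ 'd \<Rightarrow> (int ^ 'd) list \<Rightarrow> (int ^ 'd) list" where
  "walk_path z [] = [z]"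
| "walk_path z (e # l) = z # walk_path (z + e) l"

lemma length_path [simp]: "length (walk_path z l) = Suc (length l)"
  by (induction l arbitrary: z) auto

lemma set_path_map:
  "set (walk_path z (map \<omega> [0..<n])) = (\<lambda>k. z + (\<Sum>i<k. \<omega> i)) ` {0..n}"
proof (induction n arbitrary: z \<omega>)
  case (Suc n)
  have "map \<omega> [0..<Suc n] = \<omega> 0 # map (\<lambda>i. \<omega> (Suc i)) [0..<n]"
    by (simp only: upt_conv_Cons zero_less_Suc map_Suc_upt[symmetric] list.map map_map comp_def One_nat_def)
  then have "set (walk_path z (map \<omega> [0..<Suc n]))
      = insert z ((\<lambda>k. z + \<omega> 0 + (\<Sum>i<k. \<omega> (Suc i))) ` {0..n})"
    by (simp only: walk_path.simps list.set Suc)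
  also have "\<dots> = insert z ((\<lambda>k. z + (\<Sum>i<Suc k. \<omega> i)) ` {0..n})"
    by (simp only: sum.lessThan_Suc_shift add.assoc)
  also have "\<dots> = (\<lambda>k. z + (\<Sum>i<k. \<omega> i)) ` {0..Suc n}"
    unfolding atLeast0_atMost_Suc_eq_insert_0 image_insert image_image by simp
  finally show ?case .
qed simp

lemma srw_range_eq_path: "srw_range \<omega> n = set (walk_path 0 (map \<omega> [0..<n]))"
  unfolding set_path_map srw_range_def srw_def by simp

lemma measurable_map_upt:
  "(\<lambda>\<omega>. map \<omega> [0..<n]) \<in> measurable (srw_measure :: (nat \<Rightarrow> int ^ 'd) measure) (count_space UNIV)"
  unfolding measurable_count_space_eq_countable[OF countableI_type]
proof (intro conjI ballI)
  fix l :: "(int ^ 'd) list"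
  have "{\<omega> \<in> space srw_measure. \<forall>i\<in>{..<n}. \<omega> i = l ! i} \<in> sets (srw_measure :: (nat \<Rightarrow> int ^ 'd) measure)"
  proof (intro sets.sets_Collect_finite_All)
    fix i
    have "(\<lambda>\<omega>. \<omega> i) \<in> measurable (srw_measure :: (nat \<Rightarrow> int ^ 'd) measure) (measure_pmf step_pmf)"
      unfolding srw_measure_def by (rule measurable_component_singleton) simp
    from measurable_sets[OF this, of "{l ! i}"]
    show "{\<omega> \<in> space srw_measure. \<omega> i = l ! i} \<in> sets (srw_measure :: (nat \<Rightarrow> int ^ 'd) measure)"
      by (simp add: srw_measure_def space_PiM vimage_def)
  qed simp
  then have "(if length l = n then {\<omega> \<in> space srw_measure. \<forall>i\<in>{..<n}. \<omega> i = l ! i} else {})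
      \<in> sets (srw_measure :: (nat \<Rightarrow> int ^ 'd) measure)" by simp
  also have "(if length l = n then {\<omega> \<in> space srw_measure. \<forall>i\<in>{..<n}. \<omega> i = l ! i} else {})
      = (\<lambda>\<omega>. map \<omega> [0..<n]) -` {l} \<inter> space (srw_measure :: (nat \<Rightarrow> int ^ 'd) measure)"
  proof -
    have "map \<omega> [0..<n] = l \<longleftrightarrow> length l = n \<and> (\<forall>i\<in>{..<n}. \<omega> i = l ! i)" for \<omega> :: "nat \<Rightarrow> int ^ 'd"
      unfolding list_eq_iff_nth_eq by auto
    then show ?thesis by (simp add: vimage_def Int_def conj_commute)
  qed
  finally show "(\<lambda>\<omega>. map \<omega> [0..<n]) -` {l} \<inter> space (srw_measure :: (nat \<Rightarrow> int ^ 'd) measure)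
      \<in> sets (srw_measure :: (nat \<Rightarrow> int ^ 'd) measure)" .
qed auto

lemma integral_srw_eq_walk_avg:
  fixes F :: "(int ^ 'd) list \<Rightarrow> real"
  assumes "\<And>l. length l = n \<Longrightarrow> \<bar>F l\<bar> \<le> B"
  shows "(\<integral>\<omega>. F (map \<omega> [0..<n]) \<partial>srw_measure) = walk_avg n F"
  using assms
proof (induction n arbitrary: F)
  case 0
  interpret S: prob_space "srw_measure :: (nat \<Rightarrow> int ^ 'd) measure"
    unfolding srw_measure_def by (intro prob_space_PiM measure_pmf.prob_space_axioms)
  show ?case using S.prob_space by simp
next
  case (Suc n)
  let ?S = "srw_measure :: (nat \<Rightarrow> int ^ 'd) measure" and ?M = "measure_pmf (step_pmf :: (int ^ 'd) pmf)"
  interpret Q: sequence_space ?M by unfold_locales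
  interpret S: prob_space ?S
    unfolding srw_measure_def by (intro prob_space_PiM measure_pmf.prob_space_axioms)
  interpret MS: pair_prob_space ?M ?S by unfold_locales
  let ?g = "\<lambda>(s, \<omega>). case_nat s \<omega> :: nat \<Rightarrow> int ^ 'd"
  have iter: "distr (?M \<Otimes>\<^sub>M ?S) ?S ?g = ?S"
    using Q.PiM_iter by (simp add: srw_measure_def)
  have g: "?g \<in> measurable (?M \<Otimes>\<^sub>M ?S) ?S"
    unfolding srw_measure_def by (rule measurable_case_nat'[THEN measurable_cong[THEN iffD1, rotated]]) (auto simp: case_prod_beta)
  have Fm: "(\<lambda>\<omega>. F (map \<omega> [0..<Suc n])) \<in> borel_measurable ?S"
    by (rule measurable_compose[OF measurable_map_upt]) simp
  have shift: "map (case_nat s \<omega>) [0..<Suc n] = s # map \<omega> [0..<n]" for s and \<omega> :: "nat \<Rightarrow> int ^ 'd"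
    by (simp only: upt_conv_Cons zero_less_Suc map_Suc_upt[symmetric] list.map map_map comp_def One_nat_def nat.case)
  have "(\<integral>\<omega>. F (map \<omega> [0..<Suc n]) \<partial>?S) = (\<integral>\<omega>. F (map \<omega> [0..<Suc n]) \<partial>distr (?M \<Otimes>\<^sub>M ?S) ?S ?g)"
    by (simp only: iter)
  also have "\<dots> = (\<integral>p. F (map (?g p) [0..<Suc n]) \<partial>(?M \<Otimes>\<^sub>M ?S))"
    by (rule integral_distr[OF g Fm])
  also have "\<dots> = (\<integral>p. F (fst p # map (snd p) [0..<n]) \<partial>(?M \<Otimes>\<^sub>M ?S))"
    by (simp only: case_prod_beta shift)
  also have "\<dots> = (\<integral>s. (\<integral>\<omega>. F (s # map \<omega> [0..<n]) \<partial>?S) \<partial>?M)"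
  proof -
    have "integrable (?M \<Otimes>\<^sub>M ?S) (\<lambda>p. F (fst p # map (snd p) [0..<n]))"
    proof (rule MS.P.integrable_const_bound[where B = B])
      show "AE p in ?M \<Otimes>\<^sub>M ?S. norm (F (fst p # map (snd p) [0..<n])) \<le> B"
        using Suc.prems by (intro AE_I2) simp
      have "(\<lambda>p. F (map (?g p) [0..<Suc n])) \<in> borel_measurable (?M \<Otimes>\<^sub>M ?S)"
        by (rule measurable_compose[OF g Fm])
      then show "(\<lambda>p. F (fst p # map (snd p) [0..<n])) \<in> borel_measurable (?M \<Otimes>\<^sub>M ?S)"
        by (simp only: case_prod_beta shift)
    qed
    from MS.integral_fst'[OF this] show ?thesis by simp
  qed
  also have "\<dots> = (\<integral>s. walk_avg n (\<lambda>l. F (s # l)) \<partial>?M)"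
    using Suc.prems by (intro Bochner_Integration.integral_cong refl Suc.IH) simp
  finally show ?case by (simp add: avg_def)
qed

lemma walk_avg_mono: "(\<And>l. length l = n \<Longrightarrow> F l \<le> G l) \<Longrightarrow> walk_avg n F \<le> walk_avg n G"
  by (induction n arbitrary: F G) (auto intro!: avg_mono)

lemma walk_avg_const [simp]: "walk_avg n (\<lambda>_. c) = c"
  by (induction n) simp_all

lemma walk_avg_add: "walk_avg n (\<lambda>l. F l + G l) = walk_avg n F + walk_avg n G"
  by (induction n arbitrary: F G) (simp_all add: avg_add)

lemma walk_avg_cmult: "walk_avg n (\<lambda>l. c * F l) = c * walk_avg n F"
  by (induction n arbitrary: F) (simp_all add: avg_cmult)

lemma walk_avg_sum: "walk_avg n (\<lambda>l. \<Sum>i\<in>I. F i l) = (\<Sum>i\<in>I. walk_avg n (F i))"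
  by (induction I rule: infinite_finite_induct) (simp_all add: walk_avg_add)

subsection \<open>The maximum of a walk\<close>

text \<open>
  The maximum so far is an argument, so that the current position and the current maximum together are a
  Markov chain.
\<close>

primrec running_max :: "(int ^ 'd \<Rightarrow> real) \<Rightarrow> real \<Rightarrow> int ^ 'd \<Rightarrow> (int ^ 'd) list \<Rightarrow> real" where
  "running_max g M z [] = M"
| "running_max g M z (e # l) = running_max g (max M (g (z + e))) (z + e) l"

lemma le_running_max: "M \<le> running_max g M z l"
proof (induction l arbitrary: M z)
  case (Cons e l)
  show ?case using Cons[of "max M (g (z + e))" "z + e"] by simp
qed simp

lemma path_le_running_max: "g z \<le> M \<Longrightarrow> x \<in> set (walk_path z l) \<Longrightarrow> g x \<le> running_max g M z l"
proof (induction l arbitrary: M z)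
  case (Cons e l)
  then show ?case
    using le_running_max[of M g z "e # l"] by auto
qed simp

lemma avg_odd:
  assumes "\<And>e. g (- e) = - g e"
  shows "avg g 0 = 0"
proof -
  have "(\<Sum>e\<in>lattice_neighbors. g (- e)) = (\<Sum>e\<in>lattice_neighbors. g e)" by (rule sum_neighbors_uminus)
  then show ?thesis by (simp add: assms sum_negf avg_eq_sum)
qed

text \<open>
  Doob's inequality in \<open>L\<^sup>2\<close> through the potential \<open>\<Psi> s M = 4 s\<^sup>2 - 4 M s + 2 M\<^sup>2\<close>. It dominates \<open>M\<^sup>2\<close>, as
  \<open>\<Psi> s M - M\<^sup>2 = (2 s - M)\<^sup>2\<close>; it does not increase when a new maximum \<open>s\<close> replaces \<open>M\<close>; and its mean
  increases by at most 4 per step, as the steps are centred.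
\<close>

lemma walk_avg_running_max_square:
  fixes g :: "int ^ 'd \<Rightarrow> real"
  assumes add: "\<And>x y. g (x + y) = g x + g y" and odd: "\<And>e. g (- e) = - g e"
    and le1: "\<And>e. e \<in> lattice_neighbors \<Longrightarrow> \<bar>g e\<bar> \<le> 1"
  shows "walk_avg n (\<lambda>l. (running_max g M z l)\<^sup>2) \<le> 4 * (g z)\<^sup>2 - 4 * M * g z + 2 * M\<^sup>2 + 4 * real n"
proof (induction n arbitrary: M z)
  case 0
  have "0 \<le> (2 * g z - M)\<^sup>2" by simp
  then show ?case by (simp add: power2_eq_square algebra_simps)
next
  case (Suc n)
  define \<Psi> where "\<Psi> s M = 4 * s\<^sup>2 - 4 * M * s + 2 * M\<^sup>2" for s M :: real
  have max_le: "\<Psi> s (max M s) \<le> \<Psi> s M" for s M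
  proof (cases "s \<le> M")
    case False
    have "0 \<le> 2 * (s - M)\<^sup>2" by simp
    then show ?thesis using False by (simp add: \<Psi>_def power2_eq_square algebra_simps)
  qed simp
  have sq: "avg (\<lambda>e. (g e)\<^sup>2) 0 \<le> 1"
  proof -
    have "(\<Sum>e\<in>(lattice_neighbors :: (int ^ 'd) set). (g (0 + e))\<^sup>2) \<le> (\<Sum>e\<in>(lattice_neighbors :: (int ^ 'd) set). 1)"
      using le1 by (intro sum_mono) (simp add: abs_square_le_1)
    then show ?thesis using card_lattice_neighbors_pos[where 'd = 'd] by (simp add: avg_eq_sum divide_le_eq)
  qed
  have "walk_avg (Suc n) (\<lambda>l. (running_max g M z l)\<^sup>2)
      = avg (\<lambda>e. walk_avg n (\<lambda>l. (running_max g (max M (g (z + e))) (z + e) l)\<^sup>2)) 0"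
    by simp
  also have "\<dots> \<le> avg (\<lambda>e. \<Psi> (g (z + e)) (max M (g (z + e))) + 4 * real n) 0"
    unfolding \<Psi>_def by (intro avg_mono Suc)
  also have "\<dots> \<le> avg (\<lambda>e. \<Psi> (g (z + e)) M + 4 * real n) 0"
    by (intro avg_mono add_right_mono max_le)
  also have "(\<lambda>e. \<Psi> (g (z + e)) M + 4 * real n)
      = (\<lambda>e. 4 * (g e)\<^sup>2 + (8 * g z - 4 * M) * g e + (\<Psi> (g z) M + 4 * real n))"
    unfolding add by (simp add: \<Psi>_def power2_eq_square fun_eq_iff algebra_simps)
  also have "avg \<dots> 0 = 4 * avg (\<lambda>e. (g e)\<^sup>2) 0 + (\<Psi> (g z) M + 4 * real n)"
    unfolding avg_add avg_cmult using avg_odd[of g] odd by simp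
  also have "\<dots> \<le> 4 + (\<Psi> (g z) M + 4 * real n)" using sq by simp
  finally show ?case by (simp add: \<Psi>_def)
qed

lemma walk_avg_path_sum:
  "walk_avg n (\<lambda>l. \<Sum>x\<leftarrow>walk_path z l. f x) = (\<Sum>k\<le>n. (avg ^^ k) f z)"
proof (induction n arbitrary: z)
  case (Suc n)
  have "walk_avg (Suc n) (\<lambda>l. \<Sum>x\<leftarrow>walk_path z l. f x) = avg (\<lambda>e. f z + walk_avg n (\<lambda>l. \<Sum>x\<leftarrow>walk_path (z + e) l. f x)) 0"
    by (simp add: walk_avg_add)
  also have "\<dots> = f z + avg (\<lambda>e. \<Sum>k\<le>n. (avg ^^ k) f (z + e)) 0"
    unfolding Suc avg_add by simp
  also have "\<dots> = f z + (\<Sum>k\<le>n. avg ((avg ^^ k) f) z)"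
    by (simp add: avg_sum) (simp add: avg_def)
  also have "\<dots> = (\<Sum>k\<le>Suc n. (avg ^^ k) f z)"
    by (simp add: sum.atMost_Suc_shift del: sum.atMost_Suc)
  finally show ?case .
qed simp

section \<open>The energy of a walk in dimension five\<close>

text \<open>
  The summand is compared with a telescoping difference.
\<close>

lemma inverse_three_halves_le:
  "1 / ((real i + 1) * sqrt (real i + 1)) \<le> 4 * (1 / sqrt (real i + 1) - 1 / sqrt (real i + 2))"
proof -
  define a b where "a = sqrt (real i + 1)" and "b = sqrt (real i + 2)"
  have a: "a \<ge> 1" "b > 0" "b\<^sup>2 = a\<^sup>2 + 1" "real i + 1 = a\<^sup>2" by (auto simp: a_def b_def)
  have "a\<^sup>2 \<ge> 1" using a(1) by simp
  then have "b * (a + b) \<le> 4 * a\<^sup>2"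
    using a(3) sum_squares_bound[of a b] by (simp add: power2_eq_square algebra_simps)
  then have "b * ((b - a) * (a + b)) \<le> 4 * a\<^sup>2 * (b - a)"
  proof -
    have "a \<le> b" by (simp add: a_def b_def)
    then have "(b * (a + b)) * (b - a) \<le> (4 * a\<^sup>2) * (b - a)"
      using \<open>b * (a + b) \<le> 4 * a\<^sup>2\<close> by (intro mult_right_mono) auto
    then show ?thesis by (simp add: mult_ac)
  qed
  moreover have "(b - a) * (a + b) = 1" using a(3) by (simp add: power2_eq_square algebra_simps)
  ultimately have le: "b \<le> 4 * a\<^sup>2 * (b - a)" by simp
  have "1 / (a\<^sup>2 * a) = b / (a\<^sup>2 * a * b)" using a by simp
  also have "\<dots> \<le> 4 * a\<^sup>2 * (b - a) / (a\<^sup>2 * a * b)" using le a by (intro divide_right_mono) auto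
  also have "\<dots> = 4 * (1 / a - 1 / b)" using a by (simp add: field_simps)
  finally show ?thesis by (simp only: a(4)) (simp add: a_def b_def)
qed

lemma sum_inverse_three_halves_le:
  "(\<Sum>j<N. 1 / ((real (j + k) + 1) * sqrt (real (j + k) + 1))) \<le> 4 / sqrt (real k + 1)"
proof -
  have "(\<Sum>j<N. 1 / ((real (j + k) + 1) * sqrt (real (j + k) + 1)))
      \<le> 4 / sqrt (real k + 1) - 4 / sqrt (real (N + k) + 1)"
  proof (induction N)
    case (Suc N)
    then show ?case using inverse_three_halves_le[of "N + k"] by (simp add: algebra_simps)
  qed simp
  moreover have "0 \<le> 4 / sqrt (real (N + k) + 1)" by simp
  ultimately show ?thesis by linarith
qed

lemma sum_inverse_sqrt_le: "(\<Sum>k\<le>n. 1 / sqrt (real k + 1)) \<le> 2 * sqrt (real n + 1)"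
proof (induction n)
  case (Suc n)
  define a b where "a = sqrt (real n + 1)" and "b = sqrt (real n + 2)"
  have b: "b > 0" "b\<^sup>2 = a\<^sup>2 + 1" "a \<ge> 0" by (auto simp: a_def b_def)
  have "0 \<le> (b - a)\<^sup>2" by simp
  then have "2 * a * b + 1 \<le> 2 * b * b" using b by (simp add: power2_eq_square algebra_simps)
  then have "2 * a + 1 / b \<le> 2 * b" using b by (simp add: field_simps)
  then show ?case using Suc by (simp add: a_def b_def add.commute)
qed simp

definition kernel_const :: real where
  "kernel_const = sqrt 3125"

lemma kernel_const_pos: "kernel_const > 0"
  by (simp add: kernel_const_def)

lemma weighted_kernel_le:
  fixes x :: "int ^ 5"
  shows "(real n + 1) * walk_kernel n x \<le> kernel_const * (1 / ((real n + 1) * sqrt (real n + 1)))"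
proof -
  define a where "a = real n + 1"
  have a: "a > 0" by (simp add: a_def)
  have "walk_kernel n x \<le> sqrt ((5 / a) ^ 5)"
    using walk_kernel_le[of n x] by (simp add: a_def)
  also have "(5 / a) ^ 5 = 3125 / ((a\<^sup>2)\<^sup>2 * a)"
    using a by (simp add: power_divide eval_nat_numeral)
  also have "sqrt \<dots> = kernel_const / (a\<^sup>2 * sqrt a)"
    unfolding real_sqrt_divide real_sqrt_mult real_sqrt_abs kernel_const_def by simp
  finally have "a * walk_kernel n x \<le> a * (kernel_const / (a\<^sup>2 * sqrt a))"
    using a by (intro mult_left_mono) auto
  also have "\<dots> = kernel_const * (1 / (a * sqrt a))"
    using a by (simp add: power2_eq_square)
  finally show ?thesis by (simp only: a_def)
qed

text \<open>
  The weight \<open>j + 1\<close> counts the pairs of times with sum \<open>j\<close>, that is, this is the kernel of the square of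
  the Green operator.
\<close>

definition energy_kernel :: "int ^ 5 \<Rightarrow> real" where
  "energy_kernel x = (\<Sum>j. (real j + 1) * walk_kernel j x)"

lemma partial_energy_le:
  "(\<Sum>j<N. (real j + 1) * walk_kernel (j + k) (x :: int ^ 5)) \<le> 4 * kernel_const / sqrt (real k + 1)"
proof -
  have "(\<Sum>j<N. (real j + 1) * walk_kernel (j + k) x)
      \<le> (\<Sum>j<N. kernel_const * (1 / ((real (j + k) + 1) * sqrt (real (j + k) + 1))))"
  proof (rule sum_mono)
    fix j
    have "(real j + 1) * walk_kernel (j + k) x \<le> (real (j + k) + 1) * walk_kernel (j + k) x"
      by (intro mult_right_mono walk_kernel_nonneg) auto
    then show "(real j + 1) * walk_kernel (j + k) x \<le> kernel_const * (1 / ((real (j + k) + 1) * sqrt (real (j + k) + 1)))"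
      using weighted_kernel_le[of "j + k" x] by linarith
  qed
  also have "\<dots> = kernel_const * (\<Sum>j<N. 1 / ((real (j + k) + 1) * sqrt (real (j + k) + 1)))"
    by (rule sum_distrib_left[symmetric])
  also have "\<dots> \<le> kernel_const * (4 / sqrt (real k + 1))"
    using kernel_const_pos by (intro mult_left_mono sum_inverse_three_halves_le) auto
  finally show ?thesis by (simp add: mult.commute)
qed

lemma summable_energy: "summable (\<lambda>j. (real j + 1) * walk_kernel j (x :: int ^ 5))"
  using partial_energy_le[where k = 0 and x = x]
  by (intro summableI_nonneg_bounded[where x = "4 * kernel_const / sqrt (real 0 + 1)"])
     (auto intro!: mult_nonneg_nonneg walk_kernel_nonneg simp del: of_nat_0)

lemma energy_kernel_nonneg: "0 \<le> energy_kernel x"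
  unfolding energy_kernel_def by (intro suminf_nonneg summable_energy mult_nonneg_nonneg walk_kernel_nonneg) auto

lemma energy_kernel_uminus: "energy_kernel (- x) = energy_kernel x"
  by (simp add: energy_kernel_def walk_kernel_uminus)

lemma avg_iter_energy_sums:
  "(\<lambda>j. (real j + 1) * walk_kernel (j + k) x) sums (avg ^^ k) energy_kernel x"
proof (induction k arbitrary: x)
  case 0
  then show ?case using summable_sums[OF summable_energy] by (simp add: energy_kernel_def)
next
  case (Suc k)
  have "(\<lambda>n. avg (\<lambda>y. \<Sum>j<n. (real j + 1) * walk_kernel (j + k) y) x) \<longlonglongrightarrow> avg ((avg ^^ k) energy_kernel) x"
    using Suc unfolding sums_def by (rule tendsto_avg)
  then show ?case
    unfolding sums_def by (simp add: avg_sum avg_cmult)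
qed

lemma avg_iter_energy_le: "(avg ^^ k) energy_kernel x \<le> 4 * kernel_const / sqrt (real k + 1)"
  by (rule LIMSEQ_le_const2[OF avg_iter_energy_sums[unfolded sums_def]])
     (use partial_energy_le in blast)

lemma avg_iter_translate: "(avg ^^ k) (\<lambda>x. f (x - z)) y = (avg ^^ k) f (y - z)"
proof (induction k arbitrary: y)
  case (Suc k)
  have "(avg ^^ k) (\<lambda>x. f (x - z)) = (\<lambda>y. (avg ^^ k) f (y - z))" using Suc by (rule ext)
  moreover have "avg (\<lambda>y. g (y - z)) y = avg g (y - z)" for g
    by (simp add: avg_def algebra_simps)
  ultimately show ?case by simp
qed simp

definition pair_energy :: "(int ^ 5) list \<Rightarrow> real" where
  "pair_energy xs = (\<Sum>x\<leftarrow>xs. \<Sum>y\<leftarrow>xs. energy_kernel (x - y))"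

lemma pair_energy_Cons_le:
  "pair_energy (z # xs) \<le> 2 * (\<Sum>x\<leftarrow>z # xs. energy_kernel (x - z)) + pair_energy xs"
proof -
  have sym: "energy_kernel (z - y) = energy_kernel (y - z)" for y
    using energy_kernel_uminus[of "y - z"] by simp
  have "pair_energy (z # xs) = energy_kernel 0 + 2 * (\<Sum>x\<leftarrow>xs. energy_kernel (x - z)) + pair_energy xs"
    unfolding pair_energy_def by (simp add: sum_list_addf sym)
  then show ?thesis using energy_kernel_nonneg[of 0] by simp
qed

text \<open>
  The pairs that contain the starting point contribute the mean of \<open>energy_kernel\<close> along the walk, and at
  time \<open>k\<close> this mean is of order \<open>1 / sqrt k\<close>. The remaining pairs belong to a walk that is shorter by one
  step.
\<close>

lemma walk_avg_pair_energy:
  "walk_avg n (\<lambda>l. pair_energy (walk_path z l)) \<le> 16 * kernel_const * ((real n + 1) * sqrt (real n + 1))"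
proof (induction n arbitrary: z)
  case 0
  have "energy_kernel 0 \<le> 4 * kernel_const" using avg_iter_energy_le[of 0 0] by simp
  then show ?case using kernel_const_pos by (simp add: pair_energy_def)
next
  case (Suc n)
  let ?f = "\<lambda>x. energy_kernel (x - z)"
  define r where "r = real n + 1"
  have "walk_avg (Suc n) (\<lambda>l. pair_energy (walk_path z l))
      = avg (\<lambda>e. walk_avg n (\<lambda>l. pair_energy (z # walk_path (z + e) l))) 0"
    by simp
  also have "\<dots> \<le> avg (\<lambda>e. walk_avg n (\<lambda>l. 2 * (\<Sum>x\<leftarrow>walk_path z (e # l). ?f x) + pair_energy (walk_path (z + e) l))) 0"
    using pair_energy_Cons_le by (intro avg_mono walk_avg_mono) simp
  also have "\<dots> = 2 * walk_avg (Suc n) (\<lambda>l. \<Sum>x\<leftarrow>walk_path z l. ?f x) + avg (\<lambda>e. walk_avg n (\<lambda>l. pair_energy (walk_path (z + e) l))) 0"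
    unfolding walk_avg_add walk_avg_cmult avg_add avg_cmult walk_avg.simps ..
  also have "walk_avg (Suc n) (\<lambda>l. \<Sum>x\<leftarrow>walk_path z l. ?f x) = (\<Sum>k\<le>Suc n. (avg ^^ k) energy_kernel 0)"
    unfolding walk_avg_path_sum avg_iter_translate by simp
  also have "\<dots> \<le> (\<Sum>k\<le>Suc n. 4 * kernel_const * (1 / sqrt (real k + 1)))"
    using avg_iter_energy_le[where x = 0] by (intro sum_mono) simp
  also have "\<dots> = 4 * kernel_const * (\<Sum>k\<le>Suc n. 1 / sqrt (real k + 1))"
    by (rule sum_distrib_left[symmetric])
  also have "\<dots> \<le> 4 * kernel_const * (2 * sqrt (real (Suc n) + 1))"
    using kernel_const_pos by (intro mult_left_mono sum_inverse_sqrt_le) auto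
  also have "avg (\<lambda>e. walk_avg n (\<lambda>l. pair_energy (walk_path (z + e) l))) 0 \<le> 16 * kernel_const * (r * sqrt r)"
    unfolding r_def by (intro avg_le Suc)
  also have "r * sqrt r \<le> r * sqrt (r + 1)"
    by (intro mult_left_mono) (auto simp: r_def)
  finally have "walk_avg (Suc n) (\<lambda>l. pair_energy (walk_path z l))
      \<le> 2 * (4 * kernel_const * (2 * sqrt (r + 1))) + 16 * kernel_const * (r * sqrt (r + 1))"
    using kernel_const_pos by (simp add: r_def add.commute)
  also have "\<dots> = 16 * kernel_const * ((r + 1) * sqrt (r + 1))" by (simp add: algebra_simps)
  finally show ?case by (simp add: r_def add.commute)
qed

section \<open>Occupation measures\<close>

definition occupation :: "(int ^ 'd) list \<Rightarrow> int ^ 'd \<Rightarrow> real" where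
  "occupation xs z = (\<Sum>x\<leftarrow>xs. walk_kernel 0 (z - x))"

lemma occupation_nonneg: "0 \<le> occupation xs z"
  unfolding occupation_def by (intro sum_list_nonneg) auto

lemma occupation_off: "z \<notin> set xs \<Longrightarrow> occupation xs z = 0"
  unfolding occupation_def by (induction xs) auto

lemma fin_supp_occupation: "fin_supp (occupation xs)"
  by (rule fin_supp_on[of "set xs"]) (auto simp: occupation_off)

lemma lsum_occupation: "lsum (\<lambda>z. occupation xs z * f z) = (\<Sum>x\<leftarrow>xs. f x)"
proof (induction xs)
  case Nil
  then show ?case by (simp add: occupation_def)
next
  case (Cons x xs)
  have eq: "occupation (x # xs) z * f z = (if z = x then f x else 0) + occupation xs z * f z" for z
    by (simp add: occupation_def algebra_simps)
  have fs: "fin_supp (\<lambda>z. if z = x then f x else 0)" by (rule fin_supp_on[of "{x}"]) auto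
  have one: "lsum (\<lambda>z. if z = x then f x else 0) = f x" by (subst lsum_on[of "{x}"]) auto
  show ?case
    unfolding eq by (subst lsum_add[OF fs fin_supp_mult1[OF fin_supp_occupation]]) (simp add: one Cons)
qed

lemma avg_sum_list: "avg (\<lambda>y. \<Sum>x\<leftarrow>xs. f x y) z = (\<Sum>x\<leftarrow>xs. avg (f x) z)"
  by (induction xs) (simp_all add: avg_add)

lemma avg_iter_occupation: "(avg ^^ k) (occupation xs) z = (\<Sum>x\<leftarrow>xs. walk_kernel k (z - x))"
proof (induction k arbitrary: z)
  case (Suc k)
  have eq: "(avg ^^ k) (occupation xs) = (\<lambda>z. \<Sum>x\<leftarrow>xs. walk_kernel k (z - x))" using Suc by (rule ext)
  have tr: "avg (\<lambda>y. walk_kernel k (y - x)) z = avg (walk_kernel k) (z - x)" for x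
    using avg_iter_translate[of 1 "walk_kernel k" x z] by simp
  show ?case by (simp add: eq avg_sum_list tr)
qed (simp add: occupation_def)

lemma green_eq_sum: "green \<nu> M z = (\<Sum>k\<le>M. (avg ^^ k) \<nu> z)"
proof (induction M arbitrary: z)
  case (Suc M)
  have "green \<nu> M = (\<lambda>z. \<Sum>k\<le>M. (avg ^^ k) \<nu> z)" using Suc by (rule ext)
  then have "green \<nu> (Suc M) z = \<nu> z + (\<Sum>k\<le>M. (avg ^^ Suc k) \<nu> z)" by (simp add: avg_sum)
  also have "\<dots> = (\<Sum>k\<le>Suc M. (avg ^^ k) \<nu> z)" by (simp add: sum.atMost_Suc_shift del: sum.atMost_Suc)
  finally show ?case .
qed simp

lemma fin_supp_avg_iter: "fin_supp u \<Longrightarrow> fin_supp ((avg ^^ k) u)"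
  by (induction k) (auto intro: fin_supp_avg)

lemma lsum_avg_iter:
  assumes "fin_supp u"
  shows "lsum (\<lambda>z. (avg ^^ i) u z * (avg ^^ j) u z) = lsum (\<lambda>z. u z * (avg ^^ (i + j)) u z)"
proof (induction i arbitrary: j)
  case (Suc i)
  have "lsum (\<lambda>z. avg ((avg ^^ i) u) z * (avg ^^ j) u z) = lsum (\<lambda>z. (avg ^^ i) u z * avg ((avg ^^ j) u) z)"
    by (rule lsum_avg_swap[symmetric]) (use fin_supp_avg_iter[OF assms] in auto)
  also have "\<dots> = lsum (\<lambda>z. u z * (avg ^^ (i + Suc j)) u z)" using Suc[of "Suc j"] by simp
  finally show ?case by simp
qed simp

text \<open>
  For a given \<open>k\<close>, there are at most \<open>k + 1\<close> values of \<open>i\<close> with \<open>i + j + 2 = k\<close> for some \<open>j\<close>.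
\<close>

lemma sum_antidiagonal_le:
  fixes a :: "nat \<Rightarrow> real"
  assumes "\<And>k. 0 \<le> a k"
  shows "(\<Sum>i\<le>M. \<Sum>j\<le>M. a (i + j + 2)) \<le> (\<Sum>k<2 * M + 3. (real k + 1) * a k)"
proof -
  have "(\<Sum>i\<le>M. \<Sum>j\<le>M. a (i + j + 2)) \<le> (\<Sum>i\<le>M. \<Sum>k<2 * M + 3. if i \<le> k then a k else 0)"
  proof (rule sum_mono)
    fix i assume "i \<in> {..M}"
    then have i: "i \<le> M" by simp
    have "(\<Sum>j\<le>M. a (i + j + 2)) = (\<Sum>k\<in>(\<lambda>j. i + j + 2) ` {..M}. a k)"
      by (subst sum.reindex) (auto simp: inj_on_def)
    also have "\<dots> = (\<Sum>k\<in>(\<lambda>j. i + j + 2) ` {..M}. if i \<le> k then a k else 0)"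
      by (intro sum.cong) auto
    also have "\<dots> \<le> (\<Sum>k<2 * M + 3. if i \<le> k then a k else 0)"
      using i assms by (intro sum_mono2) auto
    finally show "(\<Sum>j\<le>M. a (i + j + 2)) \<le> (\<Sum>k<2 * M + 3. if i \<le> k then a k else 0)" .
  qed
  also have "\<dots> = (\<Sum>k<2 * M + 3. \<Sum>i\<le>M. if i \<le> k then a k else 0)"
    by (rule sum.swap)
  also have "\<dots> \<le> (\<Sum>k<2 * M + 3. (real k + 1) * a k)"
  proof (rule sum_mono)
    fix k
    have "(\<Sum>i\<le>M. if i \<le> k then a k else 0) = (\<Sum>i\<in>{..M} \<inter> {i. i \<le> k}. a k)"
      by (subst sum.If_cases) simp_all
    also have "\<dots> \<le> (\<Sum>i\<le>k. a k)" using assms by (intro sum_mono2) auto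
    finally show "(\<Sum>i\<le>M. if i \<le> k then a k else 0) \<le> (real k + 1) * a k" by (simp add: algebra_simps)
  qed
  finally show ?thesis .
qed

text \<open>
  Symmetry of \<open>avg\<close> moves all steps to one side, which reduces both terms to the correlations
  \<open>a k\<close> of the occupation measure with its \<open>k\<close>-fold average.
\<close>

lemma occupation_energy_le:
  fixes xs :: "(int ^ 5) list" and C :: real
  assumes C: "0 \<le> C"
  shows "lsum (\<lambda>z. occupation xs z * green (occupation xs) M z) + C * lsum (\<lambda>z. (avg (green (occupation xs) M) z)\<^sup>2)
    \<le> (1 + C) * pair_energy xs"
proof -
  let ?u = "occupation xs"
  define a where "a k = lsum (\<lambda>z. ?u z * (avg ^^ k) ?u z)" for k
  have a_eq: "a k = (\<Sum>y\<leftarrow>xs. \<Sum>x\<leftarrow>xs. walk_kernel k (y - x))" for k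
    unfolding a_def lsum_occupation avg_iter_occupation ..
  have a0: "0 \<le> a k" for k
    unfolding a_eq by (intro sum_list_nonneg) (auto intro!: sum_list_nonneg walk_kernel_nonneg)
  have fu: "fin_supp ((avg ^^ k) ?u)" for k by (rule fin_supp_avg_iter[OF fin_supp_occupation])
  have weighted: "(\<Sum>k<N. (real k + 1) * a k) \<le> pair_energy xs" for N
  proof -
    have sum_list_swap: "(\<Sum>k<N. \<Sum>y\<leftarrow>ys. f k y) = (\<Sum>y\<leftarrow>ys. \<Sum>k<N. f k y)" for f :: "nat \<Rightarrow> int ^ 5 \<Rightarrow> real" and ys
      by (induction ys) (simp_all add: sum.distrib)
    have "(\<Sum>k<N. (real k + 1) * a k) = (\<Sum>y\<leftarrow>xs. \<Sum>x\<leftarrow>xs. \<Sum>k<N. (real k + 1) * walk_kernel k (y - x))"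
      unfolding a_eq sum_list_const_mult[symmetric] sum_list_swap ..
    also have "\<dots> \<le> pair_energy xs"
      unfolding pair_energy_def energy_kernel_def
      by (intro sum_list_mono sum_le_suminf summable_energy) (auto intro!: mult_nonneg_nonneg walk_kernel_nonneg)
    finally show ?thesis .
  qed
  have "lsum (\<lambda>z. ?u z * green ?u M z) = (\<Sum>k\<le>M. a k)"
    unfolding green_eq_sum sum_distrib_left a_def
    by (rule lsum_sum) (intro fin_supp_mult1 fin_supp_occupation)
  also have "\<dots> \<le> (\<Sum>k\<le>M. (real k + 1) * a k)"
  proof (rule sum_mono)
    fix k
    show "a k \<le> (real k + 1) * a k" using a0[of k] by (simp add: distrib_right)
  qed
  also have "\<dots> \<le> pair_energy xs" using weighted[of "Suc M"] by (simp add: lessThan_Suc_atMost)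
  finally have 1: "lsum (\<lambda>z. ?u z * green ?u M z) \<le> pair_energy xs" .
  have "lsum (\<lambda>z. (avg (green ?u M) z)\<^sup>2) = lsum (\<lambda>z. \<Sum>i\<le>M. \<Sum>j\<le>M. (avg ^^ Suc i) ?u z * (avg ^^ Suc j) ?u z)"
  proof (intro arg_cong[of _ _ lsum] ext)
    fix z
    have g: "green ?u M = (\<lambda>z. \<Sum>k\<le>M. (avg ^^ k) ?u z)" by (rule ext) (rule green_eq_sum)
    have "avg (green ?u M) z = (\<Sum>k\<le>M. (avg ^^ Suc k) ?u z)" unfolding g avg_sum by simp
    then show "(avg (green ?u M) z)\<^sup>2 = (\<Sum>i\<le>M. \<Sum>j\<le>M. (avg ^^ Suc i) ?u z * (avg ^^ Suc j) ?u z)"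
      by (simp only: power2_eq_square sum_product)
  qed
  also have "\<dots> = (\<Sum>i\<le>M. \<Sum>j\<le>M. a (i + j + 2))"
  proof (subst lsum_sum)
    show "fin_supp (\<lambda>z. \<Sum>j\<le>M. (avg ^^ Suc i) ?u z * (avg ^^ Suc j) ?u z)" for i
      by (intro fin_supp_sum fin_supp_mult1 fu)
    have "lsum (\<lambda>z. \<Sum>j\<le>M. (avg ^^ Suc i) ?u z * (avg ^^ Suc j) ?u z) = (\<Sum>j\<le>M. a (i + j + 2))" for i
    proof (subst lsum_sum)
      show "fin_supp (\<lambda>z. (avg ^^ Suc i) ?u z * (avg ^^ Suc j) ?u z)" for j
        by (intro fin_supp_mult1 fu)
      have "lsum (\<lambda>z. (avg ^^ Suc i) ?u z * (avg ^^ Suc j) ?u z) = a (i + j + 2)" for j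
        unfolding a_def using lsum_avg_iter[OF fin_supp_occupation, of "Suc i" xs "Suc j"] by simp
      then show "(\<Sum>j\<le>M. lsum (\<lambda>z. (avg ^^ Suc i) ?u z * (avg ^^ Suc j) ?u z)) = (\<Sum>j\<le>M. a (i + j + 2))" by simp
    qed
    then show "(\<Sum>i\<le>M. lsum (\<lambda>z. \<Sum>j\<le>M. (avg ^^ Suc i) ?u z * (avg ^^ Suc j) ?u z)) = (\<Sum>i\<le>M. \<Sum>j\<le>M. a (i + j + 2))"
      by simp
  qed
  also have "\<dots> \<le> pair_energy xs"
    by (rule order_trans[OF sum_antidiagonal_le[OF a0] weighted])
  finally have "C * lsum (\<lambda>z. (avg (green ?u M) z)\<^sup>2) \<le> C * pair_energy xs"
    using C by (rule mult_left_mono)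
  then show ?thesis using 1 by (simp add: distrib_right)
qed

section \<open>Expected capacity of the range\<close>

context offspring_law
begin

lemma capacity_le_card: "capacity A \<le> real (card A)"
proof -
  have "(\<Sum>x\<in>A. escape_lim A x) \<le> (\<Sum>x\<in>A. 1)" by (intro sum_mono escape_lim_le_1)
  then show ?thesis by (simp add: capacity_def)
qed

lemma capacity_le_linear:
  obtains c where "c > 0" "\<And>(A :: (int ^ 5) set) r. (\<And>x. x \<in> A \<Longrightarrow> linf x \<le> int r) \<Longrightarrow> r \<ge> 1 \<Longrightarrow> capacity A \<le> c * real r"
proof -
  define K where "K = max 16 (256 / (2 * real CARD(5) * branch_prob))"
  define c where "c = 36 * K * 49 ^ 5 / 256"
  have K: "K \<ge> 16" by (simp add: K_def)
  have "capacity A \<le> c * real r" if A: "\<And>x. x \<in> A \<Longrightarrow> linf x \<le> int r" and r: "r \<ge> 1" for A :: "(int ^ 5) set" and r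
  proof -
    have r': "real r \<ge> 1" using r by simp
    have "real (card {z :: int ^ 5. linf z \<le> 6 * int (4 * r)}) \<le> (2 * real_of_int (6 * int (4 * r)) + 1) ^ CARD(5)"
      by (rule card_box_le) simp
    also have "\<dots> = (48 * real r + 1) ^ 5" by simp
    also have "\<dots> \<le> (49 * real r) ^ 5" using r' by (intro power_mono) auto
    finally have card: "real (card {z :: int ^ 5. linf z \<le> 6 * int (4 * r)}) \<le> (49 * real r) ^ 5" .
    have "capacity A \<le> 36 * K * real (card {z :: int ^ 5. linf z \<le> 6 * int (4 * r)}) / real (4 * r) ^ 4"
      unfolding K_def using capacity_le_box[OF A r] by simp
    also have "\<dots> \<le> 36 * K * (49 * real r) ^ 5 / real (4 * r) ^ 4"
      using card K by (intro divide_right_mono mult_left_mono) auto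
    also have "\<dots> = c * real r"
      using r' by (simp add: c_def power_mult_distrib eval_nat_numeral)
    finally show ?thesis .
  qed
  moreover have "c > 0" using K by (simp add: c_def)
  ultimately show ?thesis using that by blast
qed

text \<open>
  A sum instead of a maximum over the signed coordinates, so that its average is a sum of averages of
  one-dimensional maxima.
\<close>

definition displacement :: "(int ^ 'd) list \<Rightarrow> real" where
  "displacement l = (\<Sum>i\<in>UNIV. running_max (\<lambda>z. real_of_int (z $ i)) 0 0 l + running_max (\<lambda>z. - real_of_int (z $ i)) 0 0 l)"

lemma linf_le_displacement:
  assumes "x \<in> set (walk_path 0 l)"
  shows "real_of_int (linf x) \<le> displacement l"
proof -
  obtain i where i: "linf x = \<bar>x $ i\<bar>" using linf_attained by blast
  let ?p = "\<lambda>i. running_max (\<lambda>z. real_of_int (z $ i)) 0 0 l" and ?m = "\<lambda>i. running_max (\<lambda>z. - real_of_int (z $ i)) 0 0 l"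
  have nn: "0 \<le> ?p i" "0 \<le> ?m i" for i using le_running_max by auto
  have "real_of_int (x $ i) \<le> ?p i" "- real_of_int (x $ i) \<le> ?m i"
    using path_le_running_max[OF _ assms, of "\<lambda>z. real_of_int (z $ i)" 0]
      path_le_running_max[OF _ assms, of "\<lambda>z. - real_of_int (z $ i)" 0] by simp_all
  then have "real_of_int (linf x) \<le> ?p i + ?m i" using nn[of i] unfolding i by (simp add: abs_if)
  also have "\<dots> \<le> displacement l"
    unfolding displacement_def by (rule member_le_sum) (use nn in \<open>auto intro: add_nonneg_nonneg\<close>)
  finally show ?thesis .
qed

lemma walk_avg_displacement_le:
  assumes "n \<ge> 1"
  shows "walk_avg n (displacement :: (int ^ 'd) list \<Rightarrow> real) \<le> 5 * real CARD('d) * sqrt (real n)"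
proof -
  define s where "s = sqrt (real n)"
  have s: "s > 0" "s * s = real n" using assms by (auto simp: s_def)
  have max: "walk_avg n (\<lambda>l. running_max g 0 0 l) \<le> 5 / 2 * s"
    if g: "\<And>x y. g (x + y) = g x + g y" "\<And>e. g (- e) = - g e" "\<And>e. e \<in> lattice_neighbors \<Longrightarrow> \<bar>g e\<bar> \<le> 1" "g 0 = 0"
    for g :: "int ^ 'd \<Rightarrow> real"
  proof -
    have "walk_avg n (\<lambda>l. running_max g 0 0 l) \<le> walk_avg n (\<lambda>l. s / 2 + 1 / (2 * s) * (running_max g 0 0 l)\<^sup>2)"
    proof (rule walk_avg_mono)
      fix l
      (* The maximum is bounded by its square with a weight that is optimal if the maximum is s. *)
      have "0 \<le> (running_max g 0 0 l - s)\<^sup>2 / (2 * s)" using s by simp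
      also have "\<dots> = s / 2 + 1 / (2 * s) * (running_max g 0 0 l)\<^sup>2 - running_max g 0 0 l"
        using s by (simp add: power2_eq_square field_simps)
      finally show "running_max g 0 0 l \<le> s / 2 + 1 / (2 * s) * (running_max g 0 0 l)\<^sup>2" by simp
    qed
    also have "\<dots> = s / 2 + 1 / (2 * s) * walk_avg n (\<lambda>l. (running_max g 0 0 l)\<^sup>2)"
      by (simp only: walk_avg_add walk_avg_cmult walk_avg_const)
    also have "\<dots> \<le> s / 2 + 1 / (2 * s) * (4 * real n)"
      using walk_avg_running_max_square[of g n 0 0] g s by (intro add_left_mono mult_left_mono) auto
    also have "\<dots> = 5 / 2 * s" using s(1) by (simp add: s(2)[symmetric])
    finally show ?thesis .
  qed
  have e1: "\<bar>real_of_int (e $ i)\<bar> \<le> 1" if "e \<in> lattice_neighbors" for e :: "int ^ 'd" and i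
    using that by (auto simp: lattice_neighbors_def axis_def)
  have "walk_avg n (displacement :: (int ^ 'd) list \<Rightarrow> real)
      = (\<Sum>i\<in>(UNIV :: 'd set). walk_avg n (\<lambda>l. running_max (\<lambda>z. real_of_int (z $ i)) 0 0 l)
          + walk_avg n (\<lambda>l. running_max (\<lambda>z. - real_of_int (z $ i)) 0 0 l))"
    unfolding displacement_def[abs_def] walk_avg_sum walk_avg_add ..
  also have "\<dots> \<le> (\<Sum>i\<in>(UNIV :: 'd set). 5 / 2 * s + 5 / 2 * s)"
    by (intro sum_mono add_mono max) (auto simp: e1)
  finally show ?thesis by (simp add: s_def)
qed

lemma expected_capacity_upper:
  obtains c where "c > 0" "\<And>n. n \<ge> 1 \<Longrightarrow> walk_avg n (\<lambda>l. capacity (set (walk_path (0 :: int ^ 5) l))) \<le> c * sqrt (real n)"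
proof -
  obtain c where c: "c > 0"
    and cap: "\<And>(A :: (int ^ 5) set) r. (\<And>x. x \<in> A \<Longrightarrow> linf x \<le> int r) \<Longrightarrow> r \<ge> 1 \<Longrightarrow> capacity A \<le> c * real r"
    by (rule capacity_le_linear) blast
  have pt: "capacity (set (walk_path 0 l)) \<le> c * displacement l + 2 * c" for l :: "(int ^ 5) list"
  proof -
    have d0: "0 \<le> displacement l"
      unfolding displacement_def by (intro sum_nonneg add_nonneg_nonneg le_running_max)
    define r where "r = nat \<lceil>displacement l\<rceil> + 1"
    have "capacity (set (walk_path 0 l)) \<le> c * real r"
    proof (rule cap)
      fix x assume "x \<in> set (walk_path 0 l)"
      then have "real_of_int (linf x) \<le> displacement l" by (rule linf_le_displacement)
      then show "linf x \<le> int r" unfolding r_def by linarith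
    qed (simp add: r_def)
    also have "real r \<le> displacement l + 2" unfolding r_def using d0 by linarith
    then have "c * real r \<le> c * (displacement l + 2)" using c by (intro mult_left_mono) auto
    finally show ?thesis by (simp add: algebra_simps)
  qed
  have "walk_avg n (\<lambda>l. capacity (set (walk_path (0 :: int ^ 5) l))) \<le> (27 * c) * sqrt (real n)" if n: "n \<ge> 1" for n
  proof -
    have "walk_avg n (\<lambda>l. capacity (set (walk_path (0 :: int ^ 5) l))) \<le> walk_avg n (\<lambda>l :: (int ^ 5) list. c * displacement l + 2 * c)"
      by (intro walk_avg_mono pt)
    also have "\<dots> = c * walk_avg n (displacement :: (int ^ 5) list \<Rightarrow> real) + 2 * c"
      by (simp only: walk_avg_add walk_avg_cmult walk_avg_const)
    also have "\<dots> \<le> c * (25 * sqrt (real n)) + 2 * c * sqrt (real n)"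
      using walk_avg_displacement_le[OF n, where 'd = 5] c n by (intro add_mono mult_left_mono) auto
    also have "\<dots> = (27 * c) * sqrt (real n)" by simp
    finally show ?thesis .
  qed
  then show ?thesis using that[of "27 * c"] c by simp
qed

text \<open>
  The energy bound for the occupation measure is used pointwise with one deterministic \<open>\<alpha>\<close>, which is
  chosen to maximise the resulting mean.
\<close>

lemma expected_capacity_lower:
  obtains c where "c > 0" "\<And>n. c * sqrt (real n) \<le> walk_avg n (\<lambda>l. capacity (set (walk_path (0 :: int ^ 5) l)))"
proof -
  define b where "b = branch_prob / (3 * second_moment)"
  define B where "B = (1 + second_moment) * (16 * kernel_const)"
  note C = second_moment_pos
  have b: "b > 0" using branch_prob_pos C by (simp add: b_def)
  have B: "B > 0" using kernel_const_pos C by (simp add: B_def)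
  have pt: "b * (\<alpha> * (real n + 1)) + (- (b * \<alpha>\<^sup>2 * (1 + second_moment))) * pair_energy (walk_path 0 l)
      \<le> capacity (set (walk_path 0 l))" if "0 \<le> \<alpha>" "length l = n" for \<alpha> n and l :: "(int ^ 5) list"
  proof -
    let ?xs = "walk_path 0 l"
    have "b * (\<alpha> * lsum (occupation ?xs) - \<alpha>\<^sup>2 * ((1 + second_moment) * pair_energy ?xs)) \<le> capacity (set ?xs)"
      unfolding b_def
      by (rule capacity_lower)
         (use that C in \<open>auto intro: occupation_nonneg occupation_off occupation_energy_le\<close>)
    moreover have "lsum (occupation ?xs) = real n + 1"
      using lsum_occupation[of ?xs "\<lambda>_. 1"] that by (simp add: sum_list_triv)
    ultimately show ?thesis by (simp add: algebra_simps)
  qed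
  have "b / (4 * B) * sqrt (real n) \<le> walk_avg n (\<lambda>l. capacity (set (walk_path (0 :: int ^ 5) l)))" for n
  proof -
    define r where "r = sqrt (real n + 1)"
    have r: "r > 0" "r * r = real n + 1" by (auto simp: r_def)
    define \<alpha> where "\<alpha> = 1 / (2 * B * r)"
    have \<alpha>: "\<alpha> > 0" using B r by (simp add: \<alpha>_def)
    have "b / (4 * B) * sqrt (real n) \<le> b / (4 * B) * r"
      using b B by (intro mult_left_mono) (auto simp: r_def)
    also have "\<dots> = b * (\<alpha> * (r * r)) + (- (b * \<alpha>\<^sup>2)) * (B * (r * r * r))"
      using B r(1) by (simp add: \<alpha>_def power2_eq_square field_simps)
    also have "\<dots> = b * (\<alpha> * (r * r)) + (- (b * \<alpha>\<^sup>2 * (1 + second_moment))) * (16 * kernel_const * (r * r * r))"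
      by (simp add: B_def)
    also have "\<dots> \<le> b * (\<alpha> * (r * r)) + (- (b * \<alpha>\<^sup>2 * (1 + second_moment))) * walk_avg n (\<lambda>l. pair_energy (walk_path 0 l))"
    proof (intro add_left_mono mult_left_mono_neg)
      show "walk_avg n (\<lambda>l. pair_energy (walk_path 0 l)) \<le> 16 * kernel_const * (r * r * r)"
        using walk_avg_pair_energy[of n 0] unfolding r(2) by (simp add: r_def)
      show "- (b * \<alpha>\<^sup>2 * (1 + second_moment)) \<le> 0" using b C by simp
    qed
    also have "\<dots> = walk_avg n (\<lambda>l. b * (\<alpha> * (real n + 1)) + (- (b * \<alpha>\<^sup>2 * (1 + second_moment))) * pair_energy (walk_path 0 l))"
      unfolding walk_avg_add walk_avg_cmult walk_avg_const r(2) ..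
    also have "\<dots> \<le> walk_avg n (\<lambda>l. capacity (set (walk_path (0 :: int ^ 5) l)))"
      using \<alpha> by (intro walk_avg_mono pt) auto
    finally show ?thesis .
  qed
  then show ?thesis using that[of "b / (4 * B)"] b B by simp
qed

lemma expected_BCap_eq:
  "(\<integral>\<omega>. BCap \<mu> (srw_range \<omega> n) \<partial>(srw_measure :: (nat \<Rightarrow> int ^ 'd) measure))
    = walk_avg n (\<lambda>l. capacity (set (walk_path (0 :: int ^ 'd) l)))"
  unfolding BCap_eq_capacity srw_range_eq_path
proof (rule integral_srw_eq_walk_avg)
  fix l :: "(int ^ 'd) list" assume "length l = n"
  then have "card (set (walk_path 0 l)) \<le> Suc n" using card_length[of "walk_path 0 l"] by simp
  then show "\<bar>capacity (set (walk_path 0 l))\<bar> \<le> real (Suc n)"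
    using capacity_le_card[of "set (walk_path 0 l)"] capacity_nonneg[of "set (walk_path 0 l)"] by linarith
qed

end

theorem proposition1p3:
  fixes \<mu> :: "nat pmf"
  assumes critical: "(\<lambda>i. real i * pmf \<mu> i) sums 1"
    and finite_variance: "integrable (measure_pmf \<mu>) (\<lambda>i. (real i)\<^sup>2)"
    and positive_variance: "measure_pmf.variance \<mu> real > 0"
  shows "\<exists>c_minus c_plus :: real. c_minus > 0 \<and> c_plus > 0 \<and>
    (\<forall>n::nat. n \<ge> 1 \<longrightarrow>
      c_minus * sqrt (real n)
        \<le> (\<integral>\<omega>. BCap \<mu> (srw_range \<omega> n) \<partial>(srw_measure :: (nat \<Rightarrow> int ^ 5) measure)) \<and>
      (\<integral>\<omega>. BCap \<mu> (srw_range \<omega> n) \<partial>(srw_measure :: (nat \<Rightarrow> int ^ 5) measure))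
        \<le> c_plus * sqrt (real n))"
proof -
  interpret offspring_law \<mu>
    using critical finite_variance positive_variance by (rule offspring_law.intro)
  obtain c_minus where "c_minus > 0"
    "\<And>n. c_minus * sqrt (real n) \<le> walk_avg n (\<lambda>l. capacity (set (walk_path (0 :: int ^ 5) l)))"
    by (rule expected_capacity_lower) blast
  moreover obtain c_plus where "c_plus > 0"
    "\<And>n. n \<ge> 1 \<Longrightarrow> walk_avg n (\<lambda>l. capacity (set (walk_path (0 :: int ^ 5) l))) \<le> c_plus * sqrt (real n)"
    by (rule expected_capacity_upper) blast
  ultimately show ?thesis
    unfolding expected_BCap_eq by blast
qed

end
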